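(* Let $k \ge 2$, $m \ge 2$, and let $F = F_m \circ F_{m-1} \circ \cdots \circ F_1 : \mathbb{C}^k \to \mathbb{C}^k$, where $F_i(z_1,\dots,z_k) = (z_2,z_3,\dots,z_k,\alpha_i z_1 + p_i(z_k))$ with $p_i$ a polynomial of degree $d_i \ge 2$ and $\alpha_i \ne 0$ for $1 \le i \le m$. Let $d = d_1 d_2 \cdots d_m$. Suppose $a \in \mathbb{C}^k$ is a $(k-1,1)$ saddle point of $F$, let $\lambda$ be the eigenvalue of $DF(a)$ with $|\lambda|>1$, and let $H : \mathbb{C} \to \mathbb{C}^k$ be an entire mapping with $H(\mathbb{C}) = W^u(a)$, $H(0)=a$ and $F\circ H(t) = H(\lambda t)$ for all $t \in \mathbb{C}$. Let $\tilde K = H^{-1}(K)$, and let $N, p, q$ be the integers attached to the action of multiplication by $\lambda$ on the components of $\mathbb{C}\setminus\tilde K$ as defined in the context. If $\tilde K$ is bridged, there is a choice of logarithm $\tau = \log\lambda$ such that $$\frac{\Re \tau}{|\tau - 2\pi i p/q|^2} \ge \frac{Nq}{2\log d}.$$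
   Context: A $(k-1,1)$ saddle of $F$ is a fixed point $a$ of $F$ such that exactly one eigenvalue of $DF(a)$ (counted with multiplicity), denoted $\lambda$, satisfies $|\lambda|>1$ and all others have modulus $<1$. $W^u(a) = \{z : F^{-n}(z) \to a \text{ as } n\to\infty\}$. $K^{\pm} = \{z \in \mathbb{C}^k : \text{the sequence } F^{\pm n}(z),\ n\ge 0, \text{ is bounded}\}$ and $K = K^+\cap K^-$. $\tilde K$ is called bridged if the origin is not isolated in it, in the sense that the connected component of $\tilde K$ containing $0$ is not the single point $\{0\}$. The set $\mathbb{C}\setminus\tilde K$ has finitely many connected components, say $q'$ of them, and each is mapped into a component by multiplication by $\lambda$. The origin is accessible from each component $U$: there is a path $\Gamma:[0,1]\to\overline{U}$ with $\Gamma(0)=0$ and $\Gamma((0,1])\subset U$ (an access). Choosing an access $\Gamma_j$ for each component and $0<r\le \min_j|\Gamma_j(1)|$, the first points at which the $\Gamma_j$ meet the circle $|z|=r$ are circularly ordered on that circle (anticlockwise); this gives a circular ordering $U_1,\dots,U_{q'}$ of the components, independent of the choices, and preserved by multiplication by $\lambda$. Hence there is an integer $p'$ with $\lambda U_j \subset U_{j+p'}$ for every $1\le j\le q'$ (indices modulo $q'$). Put $N = \gcd(p',q')$, $p = p'/N$, $q = q'/N$. *)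

theory Defs
  imports "HOL-Analysis.Analysis" "HOL-Computational_Algebra.Computational_Algebra"
begin

text \<open>Points of \<open>\<complex>\<^sup>k\<close> have type \<open>complex ^ 'n\<close> with \<open>k = CARD('n)\<close>; the coordinates
  \<open>z\<^sub>1, \<dots>, z\<^sub>k\<close> are listed in the increasing order of the index type, so that \<open>z\<^sub>1\<close> is
  \<open>z $ Min UNIV\<close>, \<open>z\<^sub>k\<close> is \<open>z $ Max UNIV\<close>, and the index after \<open>i\<close> is \<open>Min {i<..}\<close>.\<close>

definition shift_map ::
  "complex \<Rightarrow> complex poly \<Rightarrow> (complex, 'n :: {finite, linorder}) vec \<Rightarrow> (complex, 'n) vec" where
  "shift_map \<alpha> P z = (\<chi> i. if i = Max UNIV then \<alpha> * z $ Min UNIV + poly P (z $ Max UNIV)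
                            else z $ Min {i<..})"

primrec shift_comp ::
  "(nat \<Rightarrow> complex) \<Rightarrow> (nat \<Rightarrow> complex poly) \<Rightarrow> nat \<Rightarrow> (complex, 'n :: {finite, linorder}) vec \<Rightarrow> (complex, 'n) vec"
where
  "shift_comp \<alpha> P 0 = id"
| "shift_comp \<alpha> P (Suc m) = shift_map (\<alpha> (Suc m)) (P (Suc m)) \<circ> shift_comp \<alpha> P m"

definition charpoly :: "complex ^ 'n ^ 'n \<Rightarrow> complex poly" where
  "charpoly A = det (\<chi> i j. (if i = j then [:0, 1:] else 0) - [:A $ i $ j:])"

text \<open>\<open>proots (charpoly A)\<close> is the multiset of eigenvalues of \<open>A\<close>, counted with algebraic
  multiplicity. The derivative is the real Frechet derivative, here required to be the complex
  linear map with matrix \<open>A\<close>.\<close>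

definition saddle :: "(complex ^ 'n \<Rightarrow> complex ^ 'n) \<Rightarrow> complex ^ 'n \<Rightarrow> complex \<Rightarrow> bool" where
  "saddle F a l \<longleftrightarrow> F a = a \<and>
     (\<exists>A M. (F has_derivative (\<lambda>v. A *v v)) (at a) \<and> proots (charpoly A) = add_mset l M \<and>
        cmod l > 1 \<and> (\<forall>\<mu>\<in>#M. cmod \<mu> < 1))"

definition unstable_set :: "(complex ^ 'n \<Rightarrow> complex ^ 'n) \<Rightarrow> complex ^ 'n \<Rightarrow> (complex ^ 'n) set" where
  "unstable_set F a = {z. (\<lambda>n. (inv F ^^ n) z) \<longlonglongrightarrow> a}"

definition K_plus :: "(complex ^ 'n \<Rightarrow> complex ^ 'n) \<Rightarrow> (complex ^ 'n) set" where
  "K_plus F = {z. bounded (range (\<lambda>n. (F ^^ n) z))}"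

definition K_minus :: "(complex ^ 'n \<Rightarrow> complex ^ 'n) \<Rightarrow> (complex ^ 'n) set" where
  "K_minus F = {z. bounded (range (\<lambda>n. (inv F ^^ n) z))}"

definition K_set :: "(complex ^ 'n \<Rightarrow> complex ^ 'n) \<Rightarrow> (complex ^ 'n) set" where
  "K_set F = K_plus F \<inter> K_minus F"

definition bridged :: "complex set \<Rightarrow> bool" where
  "bridged S \<longleftrightarrow> connected_component_set S 0 \<noteq> {0}"

definition is_access :: "complex set \<Rightarrow> (real \<Rightarrow> complex) \<Rightarrow> bool" where
  "is_access U \<Gamma> \<longleftrightarrow> path \<Gamma> \<and> path_image \<Gamma> \<subseteq> closure U \<and> \<Gamma> 0 = 0 \<and> \<Gamma> ` {0<..1} \<subseteq> U"

definition first_hit :: "(real \<Rightarrow> complex) \<Rightarrow> real \<Rightarrow> complex \<Rightarrow> bool" where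
  "first_hit \<Gamma> r w \<longleftrightarrow>
     (\<exists>t\<in>{0..1}. \<Gamma> t = w \<and> cmod w = r \<and> (\<forall>s\<in>{0..<t}. cmod (\<Gamma> s) \<noteq> r))"

text \<open>The points \<open>w 0, \<dots>, w (n - 1)\<close> of the circle of radius \<open>r\<close> are distinct and occur in this
  order during one anticlockwise turn starting at \<open>w 0\<close>.\<close>

definition anticlockwise :: "real \<Rightarrow> nat \<Rightarrow> (nat \<Rightarrow> complex) \<Rightarrow> bool" where
  "anticlockwise r n w \<longleftrightarrow>
     (\<exists>\<theta>. (\<forall>j<n. w j = rcis r (\<theta> j)) \<and> strict_mono_on {..<n} \<theta> \<and>
          (\<forall>j<n. \<theta> j < \<theta> 0 + 2 * pi))"

definition circular_ordering :: "complex set \<Rightarrow> nat \<Rightarrow> (nat \<Rightarrow> complex set) \<Rightarrow> bool" where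
  "circular_ordering S n U \<longleftrightarrow> bij_betw U {..<n} (components (- S)) \<and>
     (\<exists>\<Gamma> r w. r > 0 \<and>
        (\<forall>j<n. is_access (U j) (\<Gamma> j) \<and> r \<le> cmod (\<Gamma> j 1) \<and> first_hit (\<Gamma> j) r (w j)) \<and>
        anticlockwise r n w)"

text \<open>\<open>S\<close> has exactly \<open>q'\<close> complementary components, and multiplication by \<open>l\<close> advances their
  circular ordering by \<open>p'\<close> steps. The components are indexed by \<open>0, \<dots>, q' - 1\<close>, modulo \<open>q'\<close>;
  \<open>p'\<close> is determined only modulo \<open>q'\<close>.\<close>

definition component_shift :: "complex \<Rightarrow> complex set \<Rightarrow> int \<Rightarrow> nat \<Rightarrow> bool" where
  "component_shift l S p' q' \<longleftrightarrow>
     (\<exists>U. circular_ordering S q' U \<and>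
        (\<forall>j<q'. (*) l ` U j \<subseteq> U (nat ((int j + p') mod int q'))))"

end

theory Submission
  imports Defs "HOL-Complex_Analysis.Complex_Analysis"
begin

text \<open>  Write \<open>\<lambda>\<close> for the eigenvalue \<open>l\<close> and \<open>S\<close> for \<open>Kt\<close>. The inequality is a length-area estimate on the torus
  \<open>(\<complex> - {0}) / \<langle>\<lambda>\<rangle>\<close>, in which the complementary components of \<open>S\<close> become disjoint annuli.

  The escape rate of \<open>F\<close>, pulled back by \<open>H\<close>, is a continuous function \<open>g \<ge> 0\<close> on the plane that is
  positive and harmonic exactly off \<open>S\<close> and satisfies \<open>g (\<lambda> t) = d g t\<close> (\<open>green_function_exists\<close>). It exists
  because on the cone of points whose last coordinate dominates, \<open>F\<close> acts on that coordinate almost like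
  a monomial of degree \<open>d\<close>.

  Now pass to the coordinate \<open>log t\<close>. Since \<open>S\<close> is bridged and invariant under \<open>\<lambda>\<close>, its component of the
  origin is unbounded, so no complementary component winds around the origin, and the \<open>q'\<close> components lift
  to pairwise disjoint open sets \<open>V k\<close>, indexed by the integers in the order in which their accesses
  leave the circle \<open>|t| = r\<close>; thus \<open>V k + 2 \<pi> \<i> = V (k + q')\<close>. Translation by a logarithm of \<open>\<lambda>\<close> permutes the
  lifts. It preserves their vertical order, which does not depend on the accesses used to read it off
  (\<open>vertical_order_invariant\<close>), so it shifts all indices by the same number, and for one logarithm \<open>\<tau>\<close>
  this number is \<open>p'\<close> (\<open>ordered_lifts\<close>). As \<open>q p' = p q'\<close>, the translation by \<open>T = q \<tau> - 2 \<pi> \<i> p\<close>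
  maps every \<open>V k\<close> onto itself.

  Rotate the plane so that \<open>T\<close> becomes the positive number \<open>L = |T|\<close>. Each lift is then an \<open>L\<close>-periodic strip
  of bounded height, on which \<open>g \<circ> exp\<close> is multiplied by \<open>d ^ q\<close> along each period. By Carleman's method, such
  growth needs room: if \<open>A x\<close> is the integral of the square of a truncation of \<open>g \<circ> exp\<close> over the vertical slice
  at \<open>x\<close>, and \<open>\<theta> x\<close> is the length of that slice, then Wirtinger's inequality on the slice gives
  \<open>A'' \<ge> 2 (\<pi> / \<theta>) A'\<close>, so the exponential rate of \<open>g \<circ> exp\<close>, which is \<open>\<kappa> = q ln d / L\<close>, is on average
  at least \<open>\<pi> / \<theta>\<close> (\<open>strip_growth\<close>). The slices of the disjoint strips share the vertical line, on which \<open>q'\<close>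
  consecutive strips have on average the height \<open>h = 2 \<pi> Re T / L\<close> of the translation \<open>2 \<pi> \<i>\<close> at their disposal. Hence
  \<open>\<pi> q' \<le> \<kappa> h\<close> (\<open>strips_packing\<close>), and this is the asserted inequality, because \<open>q' = N q\<close>.

  Carleman's method uses the components as they are, without a Riemann map, so holes in them do no harm.\<close>

section \<open>Wirtinger's inequality on an open subset of the line\<close>

text \<open>  If \<open>k\<close> vanishes off an open set of measure \<open>\<theta>\<close>, then \<open>k'\<close> is at least as large in mean square as for a half
  wave on an interval of length \<open>\<theta>\<close>, however the open set is split into intervals. The proof is the Picone
  identity for the comparison function \<open>sin (c (m y + \<eta>))\<close>, where \<open>m y\<close> is the measure of the part of the
  open set below \<open>y\<close>, so that gaps are collapsed. The margin \<open>\<eta>\<close> keeps the sine away from its zeros.\<close>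

lemma wirtinger_open:
  fixes k k' :: "real \<Rightarrow> real"
  assumes ab: "a \<le> b"
    and der: "\<And>y. y \<in> {a..b} \<Longrightarrow> (k has_real_derivative k' y) (at y within {a..b})"
    and cont: "continuous_on {a..b} k'"
    and op: "open \<Omega>"
    and supp: "\<And>y. y \<in> {a..b} \<Longrightarrow> y \<notin> \<Omega> \<Longrightarrow> k y = 0"
    and ends: "k a = 0" "k b = 0"
    and eta: "\<eta> > 0"
  shows "(pi / (measure lborel (\<Omega> \<inter> {a..b}) + 2 * \<eta>))\<^sup>2 * integral {a..b} (\<lambda>y. (k y)\<^sup>2)
           \<le> integral {a..b} (\<lambda>y. (k' y)\<^sup>2)"
proof -
  define m where "m y = measure lborel (\<Omega> \<inter> {a..y})" for y
  define \<theta> where "\<theta> = measure lborel (\<Omega> \<inter> {a..b})"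
  have fm: "\<Omega> \<inter> {a..y} \<in> fmeasurable lborel" for y
    by (rule fmeasurableI2[of "{a..y}"]) (use op emeasure_bounded_finite[of "{a..y}"] in \<open>auto simp: fmeasurable_def\<close>)
  have m0: "0 \<le> m y" for y by (simp add: m_def)
  have m1: "m y \<le> \<theta>" if "y \<le> b" for y
    unfolding m_def \<theta>_def by (rule measure_mono_fmeasurable) (use that op fm in \<open>auto\<close>)
  have theta0: "\<theta> \<ge> 0" by (simp add: \<theta>_def)
  have mder: "(m has_real_derivative 1) (at y within {a..b})" if y: "y \<in> \<Omega>" "a < y" "y < b" for y
  proof -
    obtain e where e: "e > 0" "\<And>z. \<bar>z - y\<bar> < e \<Longrightarrow> z \<in> \<Omega>"
      using op y(1) unfolding open_dist by (auto simp: dist_real_def)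
    define e' where "e' = min e (min (y - a) (b - y))"
    have e': "e' > 0" using e y by (auto simp: e'_def)
    have add: "m z = m x + (z - x)" if "x < z" "\<And>u. x < u \<Longrightarrow> u \<le> z \<Longrightarrow> u \<in> \<Omega>" "a \<le> x" for x z
    proof -
      have eq: "\<Omega> \<inter> {a..z} = (\<Omega> \<inter> {a..x}) \<union> {x<..z}" using that by auto
      have dif: "{x<..z} - \<Omega> \<inter> {a..x} = {x<..z}" by auto
      have bf: "{x<..z} \<in> fmeasurable lborel"
        using emeasure_bounded_finite[of "{x<..z}"] by (simp add: fmeasurable_def)
      have "measure lborel (\<Omega> \<inter> {a..z}) = measure lborel (\<Omega> \<inter> {a..x}) + measure lborel {x<..z}"
        using measure_Un2[OF fm[of x] bf] dif eq by simp
      thus ?thesis using that by (simp add: m_def)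
    qed
    have loc: "m z = m y + (z - y)" if "\<bar>z - y\<bar> < e'" for z
    proof (cases "z > y")
      case True
      show ?thesis by (rule add) (use True that y e in \<open>auto simp: e'_def\<close>)
    next
      case False
      show ?thesis
      proof (cases "z = y")
        case True thus ?thesis by simp
      next
        case 2: False
        have "m y = m z + (y - z)" by (rule add) (use False 2 that y e in \<open>auto simp: e'_def\<close>)
        thus ?thesis by simp
      qed
    qed
    have "((\<lambda>z. m y + (z - y)) has_real_derivative 1) (at y)"
      by (auto intro!: derivative_eq_intros)
    hence "(m has_real_derivative 1) (at y)"
      by (rule has_field_derivative_transform_within[OF _ e']) (simp_all add: loc[symmetric] dist_real_def)
    thus ?thesis by (rule DERIV_subset) simp
  qed
  define c where "c = pi / (\<theta> + 2 * \<eta>)"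
  have c0: "c > 0" using theta0 eta by (simp add: c_def add_nonneg_pos)
  define \<phi> where "\<phi> y = c * (m y + \<eta>)" for y
  \<comment> \<open>The boundary term of the Picone identity. It is differentiable everywhere: off the zeros of \<open>k\<close> by
    the product rule, and at each zero because it is bounded there by a multiple of \<open>k\<^sup>2\<close>. So the
    fundamental theorem of calculus applies without splitting the open set into intervals.\<close>
  define q where "q y = (k y)\<^sup>2 * c * cot (\<phi> y)" for y
  have phi: "c * \<eta> \<le> \<phi> y" "\<phi> y \<le> pi - c * \<eta>" if "y \<le> b" for y
  proof -
    show "c * \<eta> \<le> \<phi> y" using m0[of y] c0 by (simp add: \<phi>_def)
    have "c * (m y + \<eta>) \<le> c * (\<theta> + \<eta>)" using m1[OF that] c0 by simp
    also have "\<dots> = pi - c * \<eta>" using theta0 eta unfolding c_def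
      by (simp add: field_simps add_nonneg_pos)
    finally show "\<phi> y \<le> pi - c * \<eta>" by (simp add: \<phi>_def)
  qed
  have ceta: "0 < c * \<eta>" "c * \<eta> \<le> pi / 2" 
    using c0 eta phi[of a] ab by auto
  define B where "B = 1 / sin (c * \<eta>)"
  have sc: "sin (c * \<eta>) > 0" using ceta pi_gt_zero by (intro sin_gt_zero) linarith+
  have sinphi: "sin (\<phi> y) \<ge> sin (c * \<eta>)" if "y \<le> b" for y
  proof (cases "\<phi> y \<le> pi / 2")
    case True
    show ?thesis by (rule sin_monotone_2pi_le) (use phi[OF that] True ceta in auto)
  next
    case False
    have "sin (c * \<eta>) \<le> sin (pi - \<phi> y)"
      by (rule sin_monotone_2pi_le) (use phi[OF that] False ceta in auto)
    thus ?thesis by simp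
  qed
  have cotB: "\<bar>cot (\<phi> y)\<bar> \<le> B" if "y \<le> b" for y
  proof -
    have s: "sin (\<phi> y) > 0" using sinphi[OF that] sc by linarith
    have "\<bar>cot (\<phi> y)\<bar> = \<bar>cos (\<phi> y)\<bar> / sin (\<phi> y)" using s by (simp add: cot_def)
    also have "\<dots> \<le> 1 / sin (c * \<eta>)"
      by (rule frac_le) (use sinphi[OF that] sc in auto)
    finally show ?thesis by (simp add: B_def)
  qed
  define q' where "q' y = (if k y = 0 then 0 else 2 * k y * k' y * c * cot (\<phi> y) - (k y)\<^sup>2 * c\<^sup>2 / (sin (\<phi> y))\<^sup>2)" for y
  have qder: "(q has_real_derivative q' y) (at y within {a..b})" if y: "y \<in> {a..b}" for y
  proof (cases "k y = 0")
    case True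
    have "((\<lambda>z. (k z)\<^sup>2) has_real_derivative 0) (at y within {a..b})"
      by (rule derivative_eq_intros der[OF y] refl)+ (use True in auto)
    hence l: "((\<lambda>z. (k z)\<^sup>2 / (z - y)) \<longlongrightarrow> 0) (at y within {a..b})"
      unfolding has_field_derivative_iff using True by simp
    have l2: "((\<lambda>z. B * c * \<bar>(k z)\<^sup>2 / (z - y)\<bar>) \<longlongrightarrow> 0) (at y within {a..b})"
      using tendsto_mult_left[OF tendsto_rabs_zero[OF l], of "B * c"] by simp
    have "((\<lambda>z. (q z - q y) / (z - y)) \<longlongrightarrow> 0) (at y within {a..b})"
    proof (rule Lim_null_comparison[OF _ l2])
      show "\<forall>\<^sub>F z in at y within {a..b}. norm ((q z - q y) / (z - y)) \<le> B * c * \<bar>(k z)\<^sup>2 / (z - y)\<bar>"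
        unfolding eventually_at_filter
      proof (rule eventuallyI, intro impI)
        fix z assume z: "z \<noteq> y" "z \<in> {a..b}"
        have "norm ((q z - q y) / (z - y)) = \<bar>cot (\<phi> z)\<bar> * c * \<bar>(k z)\<^sup>2 / (z - y)\<bar>"
          using True c0 by (simp add: q_def abs_mult)
        also have "\<dots> \<le> B * c * \<bar>(k z)\<^sup>2 / (z - y)\<bar>"
          using cotB[of z] z c0 by (intro mult_right_mono) auto
        finally show "norm ((q z - q y) / (z - y)) \<le> B * c * \<bar>(k z)\<^sup>2 / (z - y)\<bar>" .
      qed
    qed
    thus ?thesis unfolding has_field_derivative_iff using True by (simp add: q'_def)
  next
    case False
    hence y2: "y \<in> \<Omega>" "a < y" "y < b" using supp y ends by (force simp: less_le)+
    have s: "sin (\<phi> y) \<noteq> 0" using sinphi[of y] sc y by auto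
    have "(\<phi> has_real_derivative c) (at y within {a..b})"
      unfolding \<phi>_def by (rule derivative_eq_intros mder[OF y2] refl)+ simp
    hence "((\<lambda>z. cot (\<phi> z)) has_real_derivative (- inverse ((sin (\<phi> y))\<^sup>2)) * c) (at y within {a..b})"
      by (rule DERIV_chain2[where f = cot and g = \<phi>, OF DERIV_cot[OF s]])
    hence "(q has_real_derivative (2 * k y * k' y) * c * cot (\<phi> y) + (k y)\<^sup>2 * c * ((- inverse ((sin (\<phi> y))\<^sup>2)) * c)) (at y within {a..b})"
      unfolding q_def 
      by (auto intro!: derivative_eq_intros der[OF y])
    thus ?thesis by (rule DERIV_cong) (use False in \<open>simp add: q'_def power2_eq_square field_simps\<close>)
  qed
  have I: "(q' has_integral (q b - q a)) {a..b}"
    by (rule fundamental_theorem_of_calculus[OF ab])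
       (use qder in \<open>auto simp: has_real_derivative_iff_has_vector_derivative[symmetric]\<close>)
  have kc: "continuous_on {a..b} k"
    using der by (meson DERIV_continuous_on)
  have i1: "(\<lambda>y. (k y)\<^sup>2) integrable_on {a..b}" "(\<lambda>y. (k' y)\<^sup>2) integrable_on {a..b}"
    by (intro integrable_continuous_real continuous_intros kc cont)+
  have I2: "((\<lambda>y. (k' y)\<^sup>2 - c\<^sup>2 * (k y)\<^sup>2) has_integral (integral {a..b} (\<lambda>y. (k' y)\<^sup>2) - c\<^sup>2 * integral {a..b} (\<lambda>y. (k y)\<^sup>2))) {a..b}"
    by (intro has_integral_diff has_integral_mult_right integrable_integral i1)
  have "q b - q a \<le> integral {a..b} (\<lambda>y. (k' y)\<^sup>2) - c\<^sup>2 * integral {a..b} (\<lambda>y. (k y)\<^sup>2)"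
  proof (rule has_integral_le[OF I I2])
    fix y assume y: "y \<in> {a..b}"
    have s: "sin (\<phi> y) \<noteq> 0" using sinphi[of y] sc y by auto
    have e1: "1 / (sin (\<phi> y))\<^sup>2 = 1 + (cot (\<phi> y))\<^sup>2"
      using s sin_cos_squared_add[of "\<phi> y"] by (simp add: cot_def field_simps)
    show "q' y \<le> (k' y)\<^sup>2 - c\<^sup>2 * (k y)\<^sup>2"
    proof (cases "k y = 0")
      case False
      have "(k y)\<^sup>2 * c\<^sup>2 / (sin (\<phi> y))\<^sup>2 = (k y)\<^sup>2 * c\<^sup>2 * (1 + (cot (\<phi> y))\<^sup>2)"
        using e1 by (metis times_divide_eq_right mult.right_neutral)
      hence "(k' y)\<^sup>2 - c\<^sup>2 * (k y)\<^sup>2 - q' y = (k' y - k y * c * cot (\<phi> y))\<^sup>2"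
        using False by (simp add: q'_def power2_eq_square algebra_simps)
      thus ?thesis by (metis diff_ge_0_iff_ge zero_le_power2)
    qed (simp add: q'_def)
  qed
  moreover have "q b - q a = 0" using ends by (simp add: q_def)
  ultimately show ?thesis by (simp add: c_def \<theta>_def)
qed

section \<open>Growth of harmonic functions in periodic strips\<close>

text \<open>  A convex function of class \<open>C\<^sup>2\<close> that vanishes up to 1 and is asymptotic to the identity. Composed with a
  nonnegative function that is harmonic where it is positive, it gives a subharmonic \<open>C\<^sup>2\<close> function of the same
  growth, and nothing has to be known about the boundary of the domain of positivity.\<close>

definition trunc :: "real \<Rightarrow> real" where
  "trunc s = max 0 (s - 1) ^ 3 / s ^ 2"
definition trunc' :: "real \<Rightarrow> real" where
  "trunc' s = 3 * max 0 (s - 1) ^ 2 / s ^ 2 - 2 * max 0 (s - 1) ^ 3 / s ^ 3"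
definition trunc'' :: "real \<Rightarrow> real" where
  "trunc'' s = 6 * max 0 (s - 1) / s ^ 2 - 12 * max 0 (s - 1) ^ 2 / s ^ 3 + 6 * max 0 (s - 1) ^ 3 / s ^ 4"

lemma trunc_eq_0 [simp]: "s \<le> 1 \<Longrightarrow> trunc s = 0" "s \<le> 1 \<Longrightarrow> trunc' s = 0" "s \<le> 1 \<Longrightarrow> trunc'' s = 0"
  by (simp_all add: trunc_def trunc'_def trunc''_def)

lemma trunc_nonneg: "0 \<le> trunc s"
  by (simp add: trunc_def)

lemma trunc_pos: "s > 1 \<Longrightarrow> 0 < trunc s"
  by (simp add: trunc_def)

lemma trunc_le: "0 \<le> s \<Longrightarrow> trunc s \<le> s"
proof (cases "s \<le> 1")
  case False
  have "(s - 1) ^ 3 \<le> s ^ 3" using False by (intro power_mono) auto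
  thus ?thesis using False by (simp add: trunc_def divide_le_eq power3_eq_cube power2_eq_square)
qed simp

lemma trunc''_nonneg: "0 \<le> trunc'' s"
proof (cases "s \<le> 1")
  case False
  have "trunc'' s = 6 * (s - 1) / s ^ 4"
    using False by (simp add: trunc''_def field_simps power2_eq_square power3_eq_cube power4_eq_xxxx)
  thus ?thesis using False by simp
qed simp

lemma DERIV_max_power:
  "((\<lambda>s. max 0 (s - 1) ^ Suc (Suc n)) has_real_derivative real (Suc (Suc n)) * max 0 (s - 1) ^ Suc n) (at s)"
proof -
  consider "s < 1" | "s > 1" | "s = 1" by linarith
  thus ?thesis
  proof cases
    case 1
    have "((\<lambda>s. 0::real) has_real_derivative 0) (at s)" by simp
    thus ?thesis
    proof (rule has_field_derivative_transform_within_open[THEN DERIV_cong])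
      show "open {..<1::real}" by simp
    qed (use 1 in auto)
  next
    case 2
    have "((\<lambda>s. (s - 1) ^ Suc (Suc n)) has_real_derivative real (Suc (Suc n)) * max 0 (s - 1) ^ Suc n) (at s)"
      using 2 by (auto intro!: derivative_eq_intros simp del: power_Suc)
    thus ?thesis
    proof (rule has_field_derivative_transform_within_open)
      show "open {1::real<..}" by simp
    qed (use 2 in auto)
  next
    case 3
    have l: "((\<lambda>z. \<bar>z - 1\<bar>) \<longlongrightarrow> 0) (at (1::real))"
      by (auto intro!: tendsto_eq_intros)
    have "((\<lambda>z. (max 0 (z - 1) ^ Suc (Suc n)) / (z - 1)) \<longlongrightarrow> 0) (at (1::real))"
    proof (rule Lim_null_comparison[OF _ l])
      show "\<forall>\<^sub>F z::real in at 1. norm (max 0 (z - 1) ^ Suc (Suc n) / (z - 1)) \<le> \<bar>z - 1\<bar>"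
        unfolding eventually_at
      proof (intro exI[of _ 1] conjI ballI impI)
        fix z :: real assume z: "z \<noteq> 1 \<and> dist z 1 < 1"
        show "norm (max 0 (z - 1) ^ Suc (Suc n) / (z - 1)) \<le> \<bar>z - 1\<bar>"
        proof (cases "z < 1")
          case False
          have "norm (max 0 (z - 1) ^ Suc (Suc n) / (z - 1)) = (z - 1) * (z - 1) ^ n"
            using False z by (simp add: abs_mult)
          also have "\<dots> \<le> (z - 1) * 1"
            using False z by (intro mult_left_mono power_le_one) (auto simp: dist_real_def)
          finally show ?thesis using False by simp
        qed simp
      qed simp
    qed
    thus ?thesis using 3 by (simp add: has_field_derivative_iff)
  qed
qed

lemma DERIV_trunc: "(trunc has_real_derivative trunc' s) (at s)"
proof (cases "s < 1")
  case True
  have "((\<lambda>s. 0::real) has_real_derivative 0) (at s)" by simp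
  thus ?thesis
    by (rule has_field_derivative_transform_within_open[of _ _ _ "{..<1}", THEN DERIV_cong]) (use True in auto)
next
  case False
  have d: "((\<lambda>s. max 0 (s - 1) ^ 3) has_real_derivative 3 * max 0 (s - 1) ^ 2) (at s)"
    using DERIV_max_power[of 1 s] by (simp add: numeral_3_eq_3 numeral_2_eq_2)
  show ?thesis unfolding trunc_def[abs_def]
    by (rule derivative_eq_intros d refl)+
       (use False in \<open>auto simp: trunc'_def field_simps power2_eq_square power3_eq_cube\<close>)
qed

lemma DERIV_trunc': "(trunc' has_real_derivative trunc'' s) (at s)"
proof (cases "s < 1")
  case True
  have "((\<lambda>s. 0::real) has_real_derivative 0) (at s)" by simp
  thus ?thesis
    by (rule has_field_derivative_transform_within_open[of _ _ _ "{..<1}", THEN DERIV_cong]) (use True in auto)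
next
  case False
  have d: "((\<lambda>s. max 0 (s - 1) ^ 3) has_real_derivative 3 * max 0 (s - 1) ^ 2) (at s)"
    using DERIV_max_power[of 1 s] by (simp add: numeral_3_eq_3 numeral_2_eq_2)
  have d2: "((\<lambda>s. max 0 (s - 1) ^ 2) has_real_derivative 2 * max 0 (s - 1)) (at s)"
    using DERIV_max_power[of 0 s] by (simp add: numeral_2_eq_2)
  define p where "p = max 0 (s - 1)"
  have "((\<lambda>s. 3 * max 0 (s - 1) ^ 2 / s ^ 2 - 2 * max 0 (s - 1) ^ 3 / s ^ 3) has_real_derivative 
     ((3 * (2 * p)) * s ^ 2 - (3 * p ^ 2) * (2 * s)) / (s ^ 2 * s ^ 2)
     - ((2 * (3 * p ^ 2)) * s ^ 3 - (2 * p ^ 3) * (3 * s ^ 2)) / (s ^ 3 * s ^ 3)) (at s)"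
    unfolding p_def
    by (intro DERIV_diff DERIV_divide DERIV_cmult d d2) (use False in \<open>auto intro!: derivative_eq_intros\<close>)
  moreover have "((3 * (2 * p)) * s ^ 2 - (3 * p ^ 2) * (2 * s)) / (s ^ 2 * s ^ 2)
     - ((2 * (3 * p ^ 2)) * s ^ 3 - (2 * p ^ 3) * (3 * s ^ 2)) / (s ^ 3 * s ^ 3) = trunc'' s"
    unfolding trunc''_def p_def[symmetric] using False 
    by (simp add: divide_simps) (simp add: algebra_simps power_numeral_reduce)
  ultimately show ?thesis unfolding trunc'_def[abs_def] by simp
qed

lemma continuous_trunc'': "continuous_on UNIV trunc''"
proof -
  have "continuous_on {0<..} trunc''" unfolding trunc''_def[abs_def]
    by (intro continuous_intros) auto
  moreover have "continuous_on {..<1} trunc''"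
    by (rule continuous_on_eq[of _ "\<lambda>_. 0"]) auto
  ultimately have "continuous_on ({0<..} \<union> {..<1}) trunc''"
    by (intro continuous_on_open_Un) auto
  moreover have "{0<..} \<union> {..<1::real} = UNIV" by auto
  ultimately show ?thesis by simp
qed

text \<open>  \<open>G\<close> is positive and harmonic on a strip-like open set that is \<open>L\<close>-periodic and of bounded height, zero
  elsewhere, and grows at the exponential rate \<open>\<kappa>\<close>. The field \<open>\<psi>\<close> is \<open>G\<^sub>x - \<i> G\<^sub>y\<close>, so that
  harmonicity of \<open>G\<close> is holomorphy of \<open>\<psi>\<close>.\<close>

locale harmonic_strip =
  fixes G :: "complex \<Rightarrow> real" and \<psi> :: "complex \<Rightarrow> complex" and Y L \<kappa> :: real
  assumes cont: "continuous_on UNIV G"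
    and nonneg: "\<And>z. 0 \<le> G z"
    and supp: "\<And>z. Y \<le> \<bar>Im z\<bar> \<Longrightarrow> G z = 0"
    and hol: "\<psi> holomorphic_on {z. 0 < G z}"
    and der: "\<And>z. 0 < G z \<Longrightarrow> (G has_derivative (\<lambda>v. Re (\<psi> z * v))) (at z)"
    and per: "\<And>z. G (z + of_real L) = exp (\<kappa> * L) * G z"
    and l_pos: "0 < L" and k_pos: "0 < \<kappa>"
    and ex_pos: "\<exists>z. 0 < G z"
begin

lemma open_pos: "open {z. 0 < G z}"
  using cont by (intro open_Collect_less) auto

lemma open_small: "open {z. G z < 1}"
  using cont by (intro open_Collect_less) auto

lemma Y_pos: "0 < Y"
  using ex_pos supp by (metis abs_ge_zero less_le_not_le linorder_not_le order_trans)

lemma continuous_cut: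
  fixes u :: "complex \<Rightarrow> real"
  assumes "continuous_on UNIV b" "\<And>s. s \<le> 1 \<Longrightarrow> b s = 0" "continuous_on {z. 0 < G z} u"
  shows "continuous_on UNIV (\<lambda>z. b (G z) * u z)"
proof -
  have bG: "continuous_on S (\<lambda>z. b (G z))" for S
    using continuous_on_compose2[OF assms(1) cont] continuous_on_subset by blast
  have "continuous_on {z. 0 < G z} (\<lambda>z. b (G z) * u z)"
    by (intro continuous_on_mult bG assms)
  moreover have "continuous_on {z. G z < 1} (\<lambda>z. b (G z) * u z)"
    by (rule continuous_on_eq[of _ "\<lambda>_. 0"]) (use assms in auto)
  ultimately have "continuous_on ({z. 0 < G z} \<union> {z. G z < 1}) (\<lambda>z. b (G z) * u z)"
    by (intro continuous_on_open_Un open_pos open_small) auto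
  moreover have "{z. 0 < G z} \<union> {z. G z < 1} = UNIV"
    by (auto intro: less_le_trans[of 0 1])
  ultimately show ?thesis by simp
qed

lemma cut_derivative:
  fixes u u' :: "complex \<Rightarrow> real"
  assumes b: "\<And>s. (b has_real_derivative b' s) (at s)" "\<And>s. s \<le> 1 \<Longrightarrow> b s = 0" "\<And>s. s \<le> 1 \<Longrightarrow> b' s = 0"
    and u: "\<And>s. 0 < G (c + of_real s * e) \<Longrightarrow>
             ((\<lambda>s. u (c + of_real s * e)) has_real_derivative u' (c + of_real s * e)) (at s)"
  shows "((\<lambda>s. b (G (c + of_real s * e)) * u (c + of_real s * e)) has_real_derivative
            (let z = c + of_real s * e in b' (G z) * Re (\<psi> z * e) * u z + b (G z) * u' z)) (at s)"
proof (cases "0 < G (c + of_real s * e)")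
  case True
  define z where "z = c + of_real s * e"
  have "((\<lambda>s. c + of_real s * e) has_derivative (\<lambda>h. of_real h * e)) (at s)"
    by (auto intro!: derivative_eq_intros)
  from diff_chain_at[OF this, of G "\<lambda>v. Re (\<psi> z * v)"]
  have "((\<lambda>s. G (c + of_real s * e)) has_derivative (\<lambda>h. Re (\<psi> z * (of_real h * e)))) (at s)"
    using der[OF True] by (simp add: z_def o_def)
  moreover have "(\<lambda>h. Re (\<psi> z * (of_real h * e))) = (\<lambda>h. Re (\<psi> z * e) * h)"
    by (auto simp: algebra_simps)
  ultimately have Gd: "((\<lambda>s. G (c + of_real s * e)) has_real_derivative Re (\<psi> z * e)) (at s)"
    by (simp add: has_field_derivative_def)
  show ?thesis
    unfolding Let_def z_def[symmetric]
    by (rule derivative_eq_intros DERIV_chain2[OF b(1) Gd] u[OF True] refl)+ (simp add: z_def algebra_simps)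
next
  case False
  hence 0: "G (c + of_real s * e) \<le> 0" by simp
  have op: "open ((\<lambda>s::real. c + of_real s * e) -` {z. G z < 1})"
    by (intro open_vimage open_small continuous_intros)
  have "((\<lambda>s. 0::real) has_real_derivative 0) (at s)" by simp
  hence "((\<lambda>s. b (G (c + of_real s * e)) * u (c + of_real s * e)) has_real_derivative 0) (at s)"
    by (rule has_field_derivative_transform_within_open[OF _ op]) (use 0 b in auto)
  thus ?thesis using 0 b by (simp add: Let_def)
qed

text \<open>  The truncated function and its first and second derivatives in a direction \<open>e\<close>, which is \<open>1\<close> or \<open>\<i>\<close> below.\<close>

definition K where "K z = trunc (G z)"
definition K1 where "K1 e z = trunc' (G z) * Re (\<psi> z * e)"
definition K2 where "K2 e z = trunc'' (G z) * (Re (\<psi> z * e))\<^sup>2 + trunc' (G z) * Re (deriv \<psi> z * e\<^sup>2)"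

lemma DERIV_K: "((\<lambda>s. K (c + of_real s * e)) has_real_derivative K1 e (c + of_real s * e)) (at s)"
  using cut_derivative[where b = trunc and b' = trunc' and u = "\<lambda>_. 1" and u' = "\<lambda>_. 0" and c = c and e = e and s = s, OF DERIV_trunc]
  by (simp add: K_def K1_def Let_def)

lemma DERIV_K1: "((\<lambda>s. K1 e (c + of_real s * e)) has_real_derivative K2 e (c + of_real s * e)) (at s)"
proof -
  have "((\<lambda>s. Re (\<psi> (c + of_real s * e) * e)) has_real_derivative Re (deriv \<psi> (c + of_real s * e) * e\<^sup>2)) (at s)"
    if "0 < G (c + of_real s * e)" for s
  proof -
    have "(\<psi> has_field_derivative deriv \<psi> (c + of_real s * e)) (at (c + of_real s * e))"
      using hol open_pos that holomorphic_derivI by fastforce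
    moreover have "((\<lambda>s. c + of_real s * e) has_vector_derivative e) (at s)"
      by (auto intro!: derivative_eq_intros simp: has_vector_derivative_def scaleR_conv_of_real)
    ultimately have "((\<lambda>s. \<psi> (c + of_real s * e)) has_vector_derivative e * deriv \<psi> (c + of_real s * e)) (at s)"
      using field_vector_diff_chain_at[of "\<lambda>s. c + of_real s * e" e s \<psi>] by (simp add: o_def)
    hence "((\<lambda>s. \<psi> (c + of_real s * e) * e) has_vector_derivative (e * deriv \<psi> (c + of_real s * e)) * e) (at s)"
      by (intro has_vector_derivative_mult_left)
    hence "((\<lambda>s. Re (\<psi> (c + of_real s * e) * e)) has_vector_derivative Re ((e * deriv \<psi> (c + of_real s * e)) * e)) (at s)"
      by (rule bounded_linear.has_vector_derivative[OF bounded_linear_Re])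
    thus ?thesis by (simp add: has_real_derivative_iff_has_vector_derivative power2_eq_square algebra_simps)
  qed
  from cut_derivative[where b = trunc' and b' = trunc'' and u = "\<lambda>z. Re (\<psi> z * e)" and u' = "\<lambda>z. Re (deriv \<psi> z * e\<^sup>2)"
        and c = c and e = e and s = s, OF DERIV_trunc' _ _ this]
  show ?thesis by (simp add: K1_def K2_def Let_def power2_eq_square algebra_simps)
qed

lemma contK: "continuous_on UNIV K" "continuous_on UNIV (K1 e)" "continuous_on UNIV (K2 e)"
proof -
  have c1: "continuous_on UNIV trunc" "continuous_on UNIV trunc'"
    using DERIV_trunc DERIV_trunc' by (meson DERIV_continuous_on has_field_derivative_at_within)+
  have c2: "continuous_on {z. 0 < G z} \<psi>" "continuous_on {z. 0 < G z} (deriv \<psi>)"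
    using hol open_pos by (auto intro!: holomorphic_on_imp_continuous_on holomorphic_deriv)
  show "continuous_on UNIV K" unfolding K_def[abs_def]
    using continuous_cut[OF c1(1), of "\<lambda>_. 1"] by simp
  show "continuous_on UNIV (K1 e)" unfolding K1_def[abs_def]
    by (intro continuous_cut c1 continuous_intros c2) auto
  show "continuous_on UNIV (K2 e)" unfolding K2_def[abs_def]
    by (intro continuous_on_add continuous_cut c1 continuous_trunc'' continuous_intros c2) auto
qed

lemma K_supp: "Y \<le> \<bar>Im z\<bar> \<Longrightarrow> K z = 0"
  by (simp add: K_def supp)

lemma K_eq_0: "G z \<le> 0 \<Longrightarrow> K z = 0"
  by (simp add: K_def)

lemma K_nonneg: "0 \<le> K z"
  by (simp add: K_def trunc_nonneg)

text \<open>  The harmonic parts of the two second derivatives cancel, and the convexity of the truncation gives the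
  remaining term \<open>trunc'' (G z) |\<psi> z|\<^sup>2\<close> its sign.\<close>

lemma subharmonic_K: "- K2 \<i> z \<le> K2 1 z"
proof -
  have "0 \<le> trunc'' (G z) * ((Re (\<psi> z))\<^sup>2 + (Im (\<psi> z))\<^sup>2)"
    by (intro mult_nonneg_nonneg trunc''_nonneg) auto
  thus ?thesis by (simp add: K2_def algebra_simps)
qed

abbreviation "Ks x y \<equiv> K (Complex x y)"
abbreviation "Kx x y \<equiv> K1 1 (Complex x y)"
abbreviation "Ky x y \<equiv> K1 \<i> (Complex x y)"
abbreviation "Kxx x y \<equiv> K2 1 (Complex x y)"
abbreviation "Kyy x y \<equiv> K2 \<i> (Complex x y)"

definition A where "A x = integral {-Y..Y} (\<lambda>y. (Ks x y)\<^sup>2)"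
definition A' where "A' x = integral {-Y..Y} (\<lambda>y. 2 * Ks x y * Kx x y)"
definition A'' where "A'' x = integral {-Y..Y} (\<lambda>y. 2 * (Kx x y)\<^sup>2 + 2 * Ks x y * Kxx x y)"

lemma contC: "continuous_on S (\<lambda>y. Complex x y)" "continuous_on T (\<lambda>p. Complex (fst p) (snd p))"
  by (auto simp: Complex_eq intro!: continuous_intros)

lemma cont_slice:
  "continuous_on S (\<lambda>y. K (Complex x y))" "continuous_on S (\<lambda>y. K1 e (Complex x y))" "continuous_on S (\<lambda>y. K2 e (Complex x y))"
  "continuous_on T (\<lambda>p. K (Complex (fst p) (snd p)))" "continuous_on T (\<lambda>p. K1 e (Complex (fst p) (snd p)))"
  "continuous_on T (\<lambda>p. K2 e (Complex (fst p) (snd p)))"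
  by (rule continuous_on_compose2[OF contK(1) contC(1)] continuous_on_compose2[OF contK(2) contC(1)] continuous_on_compose2[OF contK(3) contC(1)]
           continuous_on_compose2[OF contK(1) contC(2)] continuous_on_compose2[OF contK(2) contC(2)] continuous_on_compose2[OF contK(3) contC(2)]; simp)+

lemma dx: "((\<lambda>x. Ks x y) has_real_derivative Kx x y) (at x)"
          "((\<lambda>x. Kx x y) has_real_derivative Kxx x y) (at x)"
  using DERIV_K[of "\<i> * y" 1 x] DERIV_K1[of 1 "\<i> * y" x] by (simp_all add: Complex_eq add.commute)

lemma dy: "((\<lambda>y. Ks x y) has_real_derivative Ky x y) (at y)"
          "((\<lambda>y. Ky x y) has_real_derivative Kyy x y) (at y)"
  using DERIV_K[of x \<i> y] DERIV_K1[of \<i> x y] by (simp_all add: Complex_eq mult.commute)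

lemma DERIV_A: "(A has_real_derivative A' x) (at x)"
proof -
  have "((\<lambda>x. integral (cbox (-Y) Y) (\<lambda>y. (Ks x y)\<^sup>2)) has_field_derivative
      integral (cbox (-Y) Y) (\<lambda>y. 2 * Ks x y * Kx x y)) (at x within UNIV)"
    by (rule leibniz_rule_field_derivative)
       (auto intro!: derivative_eq_intros dx integrable_continuous_real continuous_intros cont_slice simp: split_beta)
  thus ?thesis by (simp add: A_def[abs_def] A'_def)
qed

lemma DERIV_A': "(A' has_real_derivative A'' x) (at x)"
proof -
  have "((\<lambda>x. integral (cbox (-Y) Y) (\<lambda>y. 2 * Ks x y * Kx x y)) has_field_derivative
      integral (cbox (-Y) Y) (\<lambda>y. 2 * (Kx x y)\<^sup>2 + 2 * Ks x y * Kxx x y)) (at x within UNIV)"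
    by (rule leibniz_rule_field_derivative)
       (auto intro!: derivative_eq_intros dx integrable_continuous_real continuous_intros cont_slice simp: split_beta power2_eq_square)
  thus ?thesis by (simp add: A'_def[abs_def] A''_def)
qed

lemma parts: "integral {-Y..Y} (\<lambda>y. Ks x y * Kyy x y) = - integral {-Y..Y} (\<lambda>y. (Ky x y)\<^sup>2)"
proof -
  have "((\<lambda>y. (Ky x y)\<^sup>2 + Ks x y * Kyy x y) has_integral
      (K (Complex x Y) * K1 \<i> (Complex x Y) - K (Complex x (-Y)) * K1 \<i> (Complex x (-Y)))) {-Y..Y}"
  proof (rule fundamental_theorem_of_calculus)
    fix y
    have "((\<lambda>y. Ks x y * Ky x y) has_real_derivative
        (Ky x y)\<^sup>2 + Ks x y * Kyy x y) (at y within {-Y..Y})"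
      by (rule DERIV_subset[OF _ subset_UNIV]) (auto intro!: derivative_eq_intros dy simp: power2_eq_square)
    thus "((\<lambda>y. Ks x y * Ky x y) has_vector_derivative
        (Ky x y)\<^sup>2 + Ks x y * Kyy x y) (at y within {-Y..Y})"
      by (simp add: has_real_derivative_iff_has_vector_derivative)
  qed (use Y_pos in simp)
  moreover have "integral {-Y..Y} (\<lambda>y. (Ky x y)\<^sup>2 + Ks x y * Kyy x y)
     = integral {-Y..Y} (\<lambda>y. (Ky x y)\<^sup>2) + integral {-Y..Y} (\<lambda>y. Ks x y * Kyy x y)"
    by (intro Henstock_Kurzweil_Integration.integral_add integrable_continuous_real continuous_intros cont_slice)
  ultimately show ?thesis using Y_pos by (simp add: has_integral_iff K_supp)
qed

lemma A''_ge: "A'' x \<ge> integral {-Y..Y} (\<lambda>y. 2 * (Kx x y)\<^sup>2) + 2 * integral {-Y..Y} (\<lambda>y. (Ky x y)\<^sup>2)"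
proof -
  have "integral {-Y..Y} (\<lambda>y. 2 * (Kx x y)\<^sup>2 - 2 * (Ks x y * Kyy x y)) \<le> A'' x"
    unfolding A''_def
  proof (rule integral_le)
    fix y
    have "Ks x y * (- Kyy x y) \<le> Ks x y * Kxx x y"
      by (intro mult_left_mono subharmonic_K K_nonneg)
    thus "2 * (Kx x y)\<^sup>2 - 2 * (Ks x y * Kyy x y)
       \<le> 2 * (Kx x y)\<^sup>2 + 2 * Ks x y * Kxx x y" by simp
  qed (intro integrable_continuous_real continuous_intros cont_slice)+
  moreover have "integral {-Y..Y} (\<lambda>y. 2 * (Kx x y)\<^sup>2 - 2 * (Ks x y * Kyy x y))
     = integral {-Y..Y} (\<lambda>y. 2 * (Kx x y)\<^sup>2) - 2 * integral {-Y..Y} (\<lambda>y. Ks x y * Kyy x y)"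
    by (subst Henstock_Kurzweil_Integration.integral_diff)
       (auto intro!: integrable_continuous_real continuous_intros cont_slice)
  ultimately show ?thesis by (simp add: parts)
qed

lemma A''_nonneg: "0 \<le> A'' x"
proof -
  have "0 \<le> integral {-Y..Y} (\<lambda>y. 2 * (Kx x y)\<^sup>2)" "0 \<le> integral {-Y..Y} (\<lambda>y. (Ky x y)\<^sup>2)"
    by (intro integral_nonneg integrable_continuous_real continuous_intros cont_slice; simp)+
  thus ?thesis using A''_ge[of x] by linarith
qed

definition \<theta> where "\<theta> x = measure lborel {y. 0 < G (Complex x y)}"

text \<open>  With \<open>p = \<pi> / (\<theta> + 2 \<eta>)\<close>: subharmonicity and Wirtinger's inequality bound \<open>A''\<close> below by the integral of
  \<open>2 K\<^sub>x\<^sup>2 + 2 p\<^sup>2 K\<^sup>2\<close>, and this integrand dominates \<open>4 p K K\<^sub>x\<close>, whose integral is \<open>2 p A'\<close>. Comparing \<open>A''\<close> with \<open>A'\<close>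
  instead of with \<open>A\<close> avoids a Riccati equation.\<close>

lemma carleman:
  assumes "\<eta> > 0"
  shows "2 * (pi / (\<theta> x + 2 * \<eta>)) * A' x \<le> A'' x"
proof -
  define p where "p = pi / (\<theta> x + 2 * \<eta>)"
  have sub: "{y. 0 < G (Complex x y)} \<inter> {-Y..Y} = {y. 0 < G (Complex x y)}"
  proof -
    have "y \<in> {-Y..Y}" if "0 < G (Complex x y)" for y
      using supp[of "Complex x y"] that by (cases "Y \<le> \<bar>y\<bar>") (auto simp: abs_if split: if_splits)
    thus ?thesis by auto
  qed
  have op: "open {y. 0 < G (Complex x y)}"
    by (intro open_Collect_less continuous_intros continuous_on_compose2[OF cont contC(1)]) auto
  have "(pi / (measure lborel ({y. 0 < G (Complex x y)} \<inter> {-Y..Y}) + 2 * \<eta>))\<^sup>2 * integral {-Y..Y} (\<lambda>y. (Ks x y)\<^sup>2)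
           \<le> integral {-Y..Y} (\<lambda>y. (Ky x y)\<^sup>2)"
    by (rule wirtinger_open) 
       (use Y_pos op assms in \<open>auto intro!: DERIV_subset[OF dy(1)] cont_slice K_eq_0 simp: not_less K_supp\<close>)
  hence w: "p\<^sup>2 * integral {-Y..Y} (\<lambda>y. (Ks x y)\<^sup>2) \<le> integral {-Y..Y} (\<lambda>y. (Ky x y)\<^sup>2)"
    by (simp add: p_def \<theta>_def sub)
  have "2 * p * A' x = integral {-Y..Y} (\<lambda>y. 2 * p * (2 * Ks x y * Kx x y))"
    unfolding A'_def by (rule integral_mult_right[symmetric])
  also have "\<dots> \<le> integral {-Y..Y} (\<lambda>y. 2 * (Kx x y)\<^sup>2 + 2 * p\<^sup>2 * (Ks x y)\<^sup>2)"
  proof (rule integral_le)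
    fix y
    have "0 \<le> 2 * (Kx x y - p * Ks x y)\<^sup>2" by simp
    thus "2 * p * (2 * Ks x y * Kx x y) \<le> 2 * (Kx x y)\<^sup>2 + 2 * p\<^sup>2 * (Ks x y)\<^sup>2"
      by (simp add: power2_eq_square algebra_simps)
  qed (intro integrable_continuous_real continuous_intros cont_slice)+
  also have "\<dots> = integral {-Y..Y} (\<lambda>y. 2 * (Kx x y)\<^sup>2) + 2 * (p\<^sup>2 * integral {-Y..Y} (\<lambda>y. (Ks x y)\<^sup>2))"
    by (subst Henstock_Kurzweil_Integration.integral_add)
       (auto intro!: integrable_continuous_real continuous_intros cont_slice)
  also have "\<dots> \<le> A'' x" using w A''_ge[of x] by linarith
  finally show ?thesis by (simp add: p_def)
qed

lemma periodic_int: "exp (- \<kappa> * Re (z + of_int n * of_real L)) * G (z + of_int n * of_real L) = exp (- \<kappa> * Re z) * G z"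
proof -
  define h where "h z = exp (- \<kappa> * Re z) * G z" for z
  have 1: "h (z + of_real L) = h z" for z
    by (simp add: h_def per algebra_simps exp_add[symmetric] exp_diff) (simp add: exp_minus field_simps exp_add)
  have "h (z + of_int n * of_real L) = h z"
  proof (induction n rule: int_induct[where k = 0])
    case (step1 i)
    have "h (z + of_int (i + 1) * of_real L) = h ((z + of_int i * of_real L) + of_real L)" by (simp add: algebra_simps)
    thus ?case using step1 1 by simp
  next
    case (step2 i)
    have "h (z + of_int i * of_real L) = h ((z + of_int (i - 1) * of_real L) + of_real L)" by (simp add: algebra_simps)
    thus ?case using step2 1 by simp
  qed simp
  thus ?thesis by (simp add: h_def)
qed

lemma growth: obtains C where "C > 0" "\<And>z. G z \<le> C * exp (\<kappa> * Re z)"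
proof -
  have cpt: "compact (cbox (Complex 0 (-Y)) (Complex L Y))" by (rule compact_cbox)
  have "compact ((\<lambda>z. exp (- \<kappa> * Re z) * G z) ` cbox (Complex 0 (-Y)) (Complex L Y))"
    by (intro compact_continuous_image cpt continuous_intros continuous_on_subset[OF cont]) auto
  then obtain B where B: "\<And>z. z \<in> cbox (Complex 0 (-Y)) (Complex L Y) \<Longrightarrow> \<bar>exp (- \<kappa> * Re z) * G z\<bar> \<le> B"
    using compact_imp_bounded[of "(\<lambda>z. exp (- \<kappa> * Re z) * G z) ` cbox (Complex 0 (-Y)) (Complex L Y)"]
    unfolding bounded_iff by auto
  have "G z \<le> (\<bar>B\<bar> + 1) * exp (\<kappa> * Re z)" for z
  proof (cases "Y \<le> \<bar>Im z\<bar>")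
    case True thus ?thesis by (simp add: supp)
  next
    case False
    define n where "n = - \<lfloor>Re z / L\<rfloor>"
    define w where "w = z + of_int n * of_real L"
    have "of_int \<lfloor>Re z / L\<rfloor> * L \<le> Re z" "Re z \<le> (of_int \<lfloor>Re z / L\<rfloor> + 1) * L"
      by (rule pos_le_divide_eq[OF l_pos, THEN iffD1, OF of_int_floor_le]
               pos_divide_le_eq[OF l_pos, THEN iffD1, OF real_of_int_floor_add_one_ge])+
    hence "w \<in> cbox (Complex 0 (-Y)) (Complex L Y)"
      using False by (auto simp: w_def n_def in_cbox_complex_iff algebra_simps)
    from B[OF this] have "exp (- \<kappa> * Re z) * G z \<le> \<bar>B\<bar> + 1"
      unfolding w_def periodic_int by linarith
    thus ?thesis by (simp add: exp_minus field_simps)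
  qed
  thus ?thesis using that[of "\<bar>B\<bar> + 1"] by simp
qed

lemma A_le: assumes "C > 0" "\<And>z. G z \<le> C * exp (\<kappa> * Re z)"
  shows "A x \<le> 2 * Y * (C * exp (\<kappa> * x))\<^sup>2"
proof -
  have "A x \<le> integral {-Y..Y} (\<lambda>y. (C * exp (\<kappa> * x))\<^sup>2)"
    unfolding A_def
  proof (rule integral_le)
    fix y
    have "Ks x y \<le> C * exp (\<kappa> * x)"
      using trunc_le[OF nonneg, of "Complex x y"] assms(2)[of "Complex x y"] by (simp add: K_def)
    thus "(Ks x y)\<^sup>2 \<le> (C * exp (\<kappa> * x))\<^sup>2"
      using K_nonneg by (intro power_mono)
  qed (intro integrable_continuous_real continuous_intros cont_slice)+
  thus ?thesis using Y_pos by simp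
qed

lemma A'_mono: "x \<le> y \<Longrightarrow> A' x \<le> A' y"
  by (rule DERIV_nonneg_imp_nondecreasing[of x y A']) (use DERIV_A' A''_nonneg in blast)+

text \<open>  \<open>A\<close> vanishes far to the left, where \<open>G < 1\<close>, and not far to the right.\<close>

lemma A'_ex: "\<exists>x. A' x > 0"
proof -
  obtain C where C: "C > 0" "\<And>z. G z \<le> C * exp (\<kappa> * Re z)" using growth by blast
  obtain z where z: "G z > 0" using ex_pos by blast
  obtain n :: nat where n: "real n > - (ln (exp (- \<kappa> * Re z) * G z) / \<kappa> + Re z) / L"
    using reals_Archimedean2 by blast
  define w where "w = z + of_int (int n) * of_real L"
  have eqw: "exp (- \<kappa> * Re w) * G w = exp (- \<kappa> * Re z) * G z" unfolding w_def by (rule periodic_int)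
  have "- ln (exp (- \<kappa> * Re z) * G z) < \<kappa> * Re w"
    using n l_pos k_pos by (simp add: w_def field_simps)
  hence "exp (- ln (exp (- \<kappa> * Re z) * G z)) < exp (\<kappa> * Re w)" by simp
  hence "1 < exp (\<kappa> * Re w) * (exp (- \<kappa> * Re z) * G z)"
    using z by (simp add: exp_minus field_simps)
  hence "1 < exp (\<kappa> * Re w) * exp (- \<kappa> * Re w) * G w" unfolding eqw[symmetric] mult.assoc .
  hence "1 < G w" by (simp add: exp_add[symmetric])
  hence Kw: "K w > 0" by (simp add: K_def trunc_pos)
  have Im: "Im w \<in> {-Y..Y}" using K_supp[of w] Kw by (cases "Y \<le> \<bar>Im w\<bar>") (auto simp: abs_if split: if_splits)
  have Apos: "A (Re w) > 0"
  proof -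
    have i: "(\<lambda>y. (K (Complex (Re w) y))\<^sup>2) integrable_on {-Y..Y}"
      by (intro integrable_continuous_real continuous_intros cont_slice)
    have "A (Re w) \<ge> 0" unfolding A_def by (intro integral_nonneg i) auto
    moreover have "A (Re w) \<noteq> 0"
    proof
      assume "A (Re w) = 0"
      hence "((\<lambda>y. (K (Complex (Re w) y))\<^sup>2) has_integral 0) (cbox (-Y) Y)"
        using i by (simp add: A_def has_integral_iff)
      hence "(K (Complex (Re w) (Im w)))\<^sup>2 = 0"
        by (rule has_integral_0_cbox_imp_0[rotated 2])
           (use Im Y_pos in \<open>auto intro!: continuous_intros cont_slice simp: box_real\<close>)
      thus False using Kw by simp
    qed
    ultimately show ?thesis by simp
  qed
  define x0 where "x0 = min (Re w - 1) (- ln C / \<kappa>)"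
  have "A x0 = 0"
  proof -
    have "K (Complex x0 y) = 0" for y
    proof -
      have "\<kappa> * x0 \<le> - ln C" using k_pos by (auto simp: x0_def min_def field_simps)
      hence "exp (\<kappa> * x0) \<le> exp (- ln C)" by simp
      hence "C * exp (\<kappa> * x0) \<le> 1" using C(1) by (simp add: exp_minus field_simps)
      thus ?thesis using C(2)[of "Complex x0 y"] by (simp add: K_def)
    qed
    thus ?thesis by (simp add: A_def)
  qed
  moreover have "x0 < Re w" by (simp add: x0_def)
  ultimately obtain \<xi> where "A (Re w) - A x0 = (Re w - x0) * A' \<xi>"
    using MVT2[of x0 "Re w" A A'] DERIV_A by blast
  hence "(Re w - x0) * A' \<xi> > 0" using Apos \<open>A x0 = 0\<close> by simp
  thus ?thesis using \<open>x0 < Re w\<close> by (auto simp: zero_less_mult_iff)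
qed

text \<open>  \<open>\<Lambda> = ln A' / 2\<close> has slope at least \<open>\<pi> / \<theta>\<close>. The bound is stated through the tangents \<open>2 t - t\<^sup>2 \<theta>\<close> of \<open>1 / \<theta>\<close>,
  because these are affine in \<open>\<theta>\<close> and can be added over several strips; this takes the place of the
  Cauchy-Schwarz inequality in the usual length-area argument.\<close>

lemma strip_growth:
  "\<exists>\<Lambda> \<Lambda>' x\<^sub>1 C. \<forall>x\<ge>x\<^sub>1. (\<Lambda> has_real_derivative \<Lambda>' x) (at x) \<and> \<Lambda> x \<le> \<kappa> * x + C \<and>
     (\<forall>t. 2 * pi * t - pi * t\<^sup>2 * measure lborel {y. 0 < G (Complex x y)} \<le> \<Lambda>' x)"
proof -
  obtain C where C: "C > 0" "\<And>z. G z \<le> C * exp (\<kappa> * Re z)" using growth by blast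
  obtain x1 where x1: "A' x1 > 0" using A'_ex by blast
  have pos: "A' x > 0" if "x \<ge> x1" for x using A'_mono[OF that] x1 by simp
  show ?thesis
  proof (rule exI[of _ "\<lambda>x. ln (A' x) / 2"], rule exI[of _ "\<lambda>x. A'' x / (2 * A' x)"], rule exI[of _ x1],
         rule exI[of _ "\<kappa> + ln (2 * Y * C\<^sup>2) / 2"], intro allI impI conjI)
    fix x assume x: "x1 \<le> x"
    show "((\<lambda>x. ln (A' x) / 2) has_real_derivative A'' x / (2 * A' x)) (at x)"
      by (auto intro!: derivative_eq_intros DERIV_A' pos[OF x])
    have "\<exists>\<xi>>x. \<xi> < x + 1 \<and> A (x + 1) - A x = (x + 1 - x) * A' \<xi>"
      using MVT2[of x "x + 1" A A'] DERIV_A by force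
    then obtain \<xi> where xi: "x < \<xi>" "A (x + 1) - A x = A' \<xi>" by auto
    have "0 \<le> A x" unfolding A_def by (intro integral_nonneg integrable_continuous_real continuous_intros cont_slice) auto
    hence "A' x \<le> A (x + 1)" using xi A'_mono[of x \<xi>] by linarith
    also have "\<dots> \<le> 2 * Y * (C * exp (\<kappa> * (x + 1)))\<^sup>2" by (rule A_le[OF C])
    also have "\<dots> = (2 * Y * C\<^sup>2) * exp (2 * (\<kappa> * (x + 1)))"
      by (simp add: power_mult_distrib exp_double)
    finally have "ln (A' x) \<le> ln ((2 * Y * C\<^sup>2) * exp (2 * (\<kappa> * (x + 1))))"
      using pos[OF x] C(1) Y_pos by (subst ln_le_cancel_iff) auto
    also have "\<dots> = ln (2 * Y * C\<^sup>2) + 2 * (\<kappa> * (x + 1))"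
      using C(1) Y_pos by (subst ln_mult_pos) auto
    finally show "ln (A' x) / 2 \<le> \<kappa> * x + (\<kappa> + ln (2 * Y * C\<^sup>2) / 2)" by (simp add: algebra_simps)
    fix t
    show "2 * pi * t - pi * t\<^sup>2 * measure lborel {y. 0 < G (Complex x y)} \<le> A'' x / (2 * A' x)"
      unfolding \<theta>_def[symmetric]
    proof (rule field_le_epsilon)
      fix e :: real assume e: "e > 0"
      define \<eta> where "\<eta> = e / (2 * pi * (t\<^sup>2 + 1))"
      have t1: "t\<^sup>2 + 1 > 0" by (simp add: add_nonneg_pos)
      have eta: "\<eta> > 0" using e t1 by (simp add: \<eta>_def)
      define s where "s = \<theta> x + 2 * \<eta>"
      have s: "s > 0" using eta by (simp add: s_def \<theta>_def add_nonneg_pos)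
      have "0 \<le> (1 - t * s)\<^sup>2" by simp
      hence "(2 * t - t\<^sup>2 * s) * s \<le> 1" by (simp add: power2_eq_square algebra_simps)
      hence "2 * t - t\<^sup>2 * s \<le> 1 / s" using s by (simp add: field_simps)
      hence "pi * (2 * t - t\<^sup>2 * s) \<le> pi / s"
        using mult_left_mono[of _ _ pi] by fastforce
      also have "\<dots> \<le> A'' x / (2 * A' x)"
        proof -
        have "(pi / s) * (2 * A' x) \<le> A'' x"
          using carleman[OF eta, of x] unfolding s_def[symmetric] by (simp add: mult_ac)
        thus ?thesis using pos[OF x] by (subst pos_le_divide_eq) auto
      qed
      finally have *: "2 * pi * t - pi * t\<^sup>2 * \<theta> x - 2 * pi * t\<^sup>2 * \<eta> \<le> A'' x / (2 * A' x)"
        by (simp add: s_def algebra_simps)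
      have "2 * pi * t\<^sup>2 * \<eta> = e * (t\<^sup>2 / (t\<^sup>2 + 1))" using t1 by (simp add: \<eta>_def)
      also have "\<dots> \<le> e * 1" using e t1 by (intro mult_left_mono) auto
      finally show "2 * pi * t - pi * t\<^sup>2 * \<theta> x \<le> A'' x / (2 * A' x) + e" using * by linarith
    qed
  qed
qed
end

text \<open>  Any \<open>n m\<close> consecutive strips lie in a horizontal band of height about \<open>m h\<close>, so the lengths of their disjoint
  slices add up to at most that. Adding the slopes of their functions \<open>\<Lambda>\<close> gives
  \<open>2 \<pi> t n m - \<pi> t\<^sup>2 (2 B + m h) \<le> n m \<kappa>\<close>; divide by \<open>m\<close>, let \<open>m\<close> tend to infinity and take \<open>t = n / h\<close>.\<close>

lemma strips_packing:
  fixes G :: "nat \<Rightarrow> complex \<Rightarrow> real" and \<psi> :: "nat \<Rightarrow> complex \<Rightarrow> complex" and n :: nat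
  assumes strip: "\<And>i. harmonic_strip (G i) (\<psi> i) (Y i) L \<kappa>"
    and n: "n > 0" and h: "h > 0"
    and disj: "\<And>i j z. i \<noteq> j \<Longrightarrow> 0 < G i z \<Longrightarrow> \<not> 0 < G j z"
    and bound: "\<And>i z. 0 < G i z \<Longrightarrow> \<bar>Im z - real (i div n) * h\<bar> \<le> B"
  shows "pi * n \<le> \<kappa> * h"
proof -
  obtain \<Lambda> \<Lambda>' X C where lam: "\<And>i x. x \<ge> X i \<Longrightarrow> (\<Lambda> i has_real_derivative \<Lambda>' i x) (at x) \<and> \<Lambda> i x \<le> \<kappa> * x + C i \<and>
     (\<forall>t. 2 * pi * t - pi * t\<^sup>2 * measure lborel {y. 0 < G i (Complex x y)} \<le> \<Lambda>' i x)"
    using harmonic_strip.strip_growth[OF strip] by metis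
  define sl where "sl i x = {y. 0 < G i (Complex x y)}" for i x
  have op: "open (sl i x)" for i x
    unfolding sl_def using harmonic_strip.cont[OF strip, of i]
    by (intro open_Collect_less continuous_intros continuous_on_compose2[of UNIV "G i" UNIV "Complex x"] harmonic_strip.contC[OF strip[of 0]]) auto
  have m_bound: "2 * pi * t * (n * m) - pi * t\<^sup>2 * (2 * B + m * h) \<le> n * m * \<kappa>" if m: "m > 0" for m :: nat and t :: real
  proof -
    define I where "I = {..<n * m}"
    have I: "finite I" "I \<noteq> {}" using n m by (simp_all add: I_def lessThan_empty_iff)
    define x0 where "x0 = Max (X ` I)"
    have x0: "X i \<le> x0" if "i \<in> I" for i using that I by (auto simp: x0_def)
    define D where "D = 2 * pi * t * (n * m) - pi * t\<^sup>2 * (2 * B + m * h)"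
    define S where "S x = (\<Sum>i\<in>I. \<Lambda> i x)" for x
    have slice_sum: "(\<Sum>i\<in>I. measure lborel (sl i x)) \<le> 2 * B + m * h" for x
    proof -
      have sub: "sl i x \<subseteq> {- B..B + real (m - 1) * h}" if "i \<in> I" for i
      proof
        fix y assume "y \<in> sl i x"
        hence b: "\<bar>y - real (i div n) * h\<bar> \<le> B" using bound[of i "Complex x y"] by (simp add: sl_def)
        have "i div n < m" using that n by (simp add: I_def div_less_iff_less_mult mult.commute)
        hence "real (i div n) \<le> real (m - 1)" by simp
        hence "real (i div n) * h \<le> real (m - 1) * h" using h by (intro mult_right_mono) auto
        moreover have "0 \<le> real (i div n) * h" using h by simp
        ultimately show "y \<in> {- B..B + real (m - 1) * h}" using b by (auto simp: abs_le_iff)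
      qed
      have B0: "0 \<le> B"
      proof -
        obtain z where "0 < G 0 z" using harmonic_strip.ex_pos[OF strip] by blast
        thus ?thesis using bound[of 0 z] by linarith
      qed
      have ne: "emeasure lborel (sl i x) \<noteq> \<infinity>" if "i \<in> I" for i
        using emeasure_bounded_finite[OF bounded_subset[OF bounded_closed_interval sub[OF that]]] by simp
      have "(\<Sum>i\<in>I. measure lborel (sl i x)) = measure lborel (\<Union>i\<in>I. sl i x)"
      proof (rule measure_finite_Union[symmetric])
        show "disjoint_family_on (\<lambda>i. sl i x) I"
          using disj by (auto simp: disjoint_family_on_def sl_def)
      qed (use I op ne in auto)
      also have "\<dots> \<le> measure lborel {- B..B + real (m - 1) * h}"
        using sub op B0 h
        by (intro measure_mono_fmeasurable) (auto simp: fmeasurable_def intro!: borel_open)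
      also have "\<dots> = 2 * B + real (m - 1) * h" using B0 h by simp
      also have "\<dots> \<le> 2 * B + m * h" using h by (intro add_left_mono mult_right_mono) auto
      finally show ?thesis .
    qed
    have der: "\<exists>y. ((\<lambda>x. S x - D * x) has_real_derivative y) (at x) \<and> 0 \<le> y" if x: "x \<ge> x0" for x
    proof (intro exI conjI)
      have lx: "(\<Lambda> i has_real_derivative \<Lambda>' i x) (at x)" if "i \<in> I" for i using lam[of i x] x0[OF that] x by auto
      have "((\<lambda>x. \<Sum>i\<in>I. \<Lambda> i x) has_real_derivative (\<Sum>i\<in>I. \<Lambda>' i x)) (at x)"
        by (rule DERIV_sum) (rule lx)
      thus "((\<lambda>x. S x - D * x) has_real_derivative (\<Sum>i\<in>I. \<Lambda>' i x) - D * 1) (at x)"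
        unfolding S_def by (intro DERIV_diff DERIV_cmult DERIV_ident)
      have "D \<le> 2 * pi * t * (n * m) - pi * t\<^sup>2 * (\<Sum>i\<in>I. measure lborel (sl i x))"
        unfolding D_def by (intro diff_left_mono mult_left_mono slice_sum) auto
      also have "\<dots> = (\<Sum>i\<in>I. 2 * pi * t - pi * t\<^sup>2 * measure lborel (sl i x))"
        by (simp add: sum_subtractf sum_distrib_left I_def)
      also have "\<dots> \<le> (\<Sum>i\<in>I. \<Lambda>' i x)"
      proof (rule sum_mono)
        fix i assume "i \<in> I"
        thus "2 * pi * t - pi * t\<^sup>2 * measure lborel (sl i x) \<le> \<Lambda>' i x"
          using lam[of i x] x0 x unfolding sl_def by fastforce
      qed
      finally show "0 \<le> (\<Sum>i\<in>I. \<Lambda>' i x) - D * 1" by simp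
    qed
    have low: "S x0 - D * x0 \<le> S x - D * x" if "x \<ge> x0" for x
      by (rule DERIV_nonneg_imp_nondecreasing[OF that]) (use der in blast)
    have up: "S x \<le> n * m * \<kappa> * x + (\<Sum>i\<in>I. C i)" if x: "x \<ge> x0" for x
    proof -
      have "S x \<le> (\<Sum>i\<in>I. \<kappa> * x + C i)"
        unfolding S_def by (rule sum_mono) (use lam x0 x in fastforce)
      also have "\<dots> = n * m * \<kappa> * x + (\<Sum>i\<in>I. C i)" by (simp add: sum.distrib I_def)
      finally show ?thesis .
    qed
    show ?thesis unfolding D_def[symmetric]
    proof (rule ccontr)
      assume "\<not> D \<le> n * m * \<kappa>"
      hence pos: "D - n * m * \<kappa> > 0" by simp
      define c where "c = (\<Sum>i\<in>I. C i) - (S x0 - D * x0)"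
      define x where "x = max x0 ((c + 1) / (D - n * m * \<kappa>))"
      have xx: "x \<ge> x0" "(c + 1) / (D - n * m * \<kappa>) \<le> x" by (auto simp: x_def)
      have "(D - n * m * \<kappa>) * x \<le> c" using low[OF xx(1)] up[OF xx(1)] by (simp add: c_def algebra_simps)
      moreover have "c + 1 \<le> (D - n * m * \<kappa>) * x" using xx(2) pos by (simp add: pos_divide_le_eq mult.commute)
      ultimately show False by simp
    qed
  qed
  define t where "t = n / h"
  define e where "e = 2 * pi * t * n - pi * t\<^sup>2 * h - n * \<kappa>"
  have "e \<le> 0"
  proof (rule ccontr)
    assume e: "\<not> e \<le> 0"
    obtain m :: nat where m: "pi * t\<^sup>2 * (2 * B) < real m * e" using reals_Archimedean3[of e] e by auto
    hence "m > 0 \<or> pi * t\<^sup>2 * (2 * B) < 0" by (cases m) auto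
    moreover have "0 \<le> B"
    proof -
      obtain z where "0 < G 0 z" using harmonic_strip.ex_pos[OF strip] by blast
      thus ?thesis using bound[of 0 z] by linarith
    qed
    ultimately have "m > 0" by (auto simp: mult_less_0_iff)
    from m_bound[OF this, of t] show False using m by (simp add: e_def algebra_simps)
  qed
  hence "2 * pi * t * n - pi * t\<^sup>2 * h \<le> n * \<kappa>" by (simp add: e_def)
  moreover have "2 * pi * t * n - pi * t\<^sup>2 * h = n * (pi * n / h)"
    using h by (simp add: t_def power2_eq_square field_simps)
  ultimately have "n * (pi * n / h) \<le> n * \<kappa>" by simp
  hence "pi * n / h \<le> \<kappa>" by (rule mult_left_le_imp_le) (use n in simp)
  thus ?thesis using h by (simp add: pos_divide_le_eq)
qed

text \<open>  The local holomorphic functions \<open>\<Phi>\<close> with real part \<open>G\<close> differ by imaginary constants, so their derivatives fit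
  together to one field, which can be read off from the real derivative of \<open>G\<close>.\<close>

lemma local_real_part_gradient:
  fixes G :: "complex \<Rightarrow> real"
  assumes loc: "\<And>z. 0 < G z \<Longrightarrow> \<exists>e>0. \<exists>\<Phi>. \<Phi> holomorphic_on ball z e \<and> (\<forall>s\<in>ball z e. G s = Re (\<Phi> s))"
    and op: "open {z. 0 < G z}"
  obtains \<psi> where "\<psi> holomorphic_on {z. 0 < G z}" "\<And>z. 0 < G z \<Longrightarrow> (G has_derivative (\<lambda>v. Re (\<psi> z * v))) (at z)"
proof -
  define \<psi> where "\<psi> z = Complex (frechet_derivative G (at z) 1) (- frechet_derivative G (at z) \<i>)" for z
  have key: "\<exists>e>0. \<psi> holomorphic_on ball z e \<and> (G has_derivative (\<lambda>v. Re (\<psi> z * v))) (at z)" if z: "0 < G z" for z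
  proof -
    obtain e \<Phi> where e: "e > 0" "\<Phi> holomorphic_on ball z e" "\<And>s. s \<in> ball z e \<Longrightarrow> G s = Re (\<Phi> s)" using loc[OF z] by blast
    have d: "(G has_derivative (\<lambda>v. Re (deriv \<Phi> s * v))) (at s)" if s: "s \<in> ball z e" for s
    proof -
      have "(\<Phi> has_derivative (\<lambda>v. deriv \<Phi> s * v)) (at s)"
        using holomorphic_derivI[OF e(2) open_ball s] by (simp add: has_field_derivative_def)
      hence "((\<lambda>s. Re (\<Phi> s)) has_derivative (\<lambda>v. Re (deriv \<Phi> s * v))) (at s)"
        by (rule bounded_linear.has_derivative[OF bounded_linear_Re])
      thus ?thesis
        by (rule has_derivative_transform_within_open[OF _ open_ball s]) (use e(3) in simp)
    qed
    have eq: "\<psi> s = deriv \<Phi> s" if s: "s \<in> ball z e" for s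
    proof -
      have "frechet_derivative G (at s) = (\<lambda>v. Re (deriv \<Phi> s * v))" using frechet_derivative_at[OF d[OF s]] by simp
      thus ?thesis by (simp add: \<psi>_def complex_eq_iff)
    qed
    have "deriv \<Phi> holomorphic_on ball z e" using e(2) by (intro holomorphic_deriv) auto
    hence "\<psi> holomorphic_on ball z e" using eq by (metis holomorphic_transform)
    moreover have "(G has_derivative (\<lambda>v. Re (\<psi> z * v))) (at z)" using d[of z] eq[of z] e(1) by simp
    ultimately show ?thesis using e(1) by blast
  qed
  show ?thesis
  proof (rule that)
    show "\<psi> holomorphic_on {z. 0 < G z}"
    proof (subst holomorphic_on_open[OF op], intro ballI)
      fix z assume "z \<in> {z. 0 < G z}"
      then obtain e where "e > 0" "\<psi> holomorphic_on ball z e" using key by blast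
      thus "\<exists>f'. (\<psi> has_field_derivative f') (at z)"
        using holomorphic_derivI[of \<psi> "ball z e" z] by auto
    qed
  qed (use key in blast)
qed

section \<open>Vertical order of accesses\<close>

lemma continuous_logs_unique:
  fixes L1 L2 :: "'a::topological_space \<Rightarrow> complex"
  assumes "connected S" "continuous_on S L1" "continuous_on S L2"
    and "\<And>p. p \<in> S \<Longrightarrow> exp (L1 p) = exp (L2 p)"
    and "p0 \<in> S" "L1 p0 = L2 p0" "p \<in> S"
  shows "L1 p = L2 p"
proof -
  have "(\<lambda>p. L1 p - L2 p) constant_on S"
  proof (rule continuous_discrete_range_constant[OF assms(1)])
    show "continuous_on S (\<lambda>p. L1 p - L2 p)" by (intro continuous_intros assms)
    fix x assume x: "x \<in> S"
    show "\<exists>e>0. \<forall>y. y \<in> S \<and> L1 y - L2 y \<noteq> L1 x - L2 x \<longrightarrow> e \<le> norm (L1 y - L2 y - (L1 x - L2 x))"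
    proof (intro exI[of _ "2 * pi"] conjI allI impI)
      fix y assume y: "y \<in> S \<and> L1 y - L2 y \<noteq> L1 x - L2 x"
      have "exp (L1 y - L2 y) = exp (L1 x - L2 x)"
        using assms(4) x y by (simp add: exp_diff)
      then obtain n :: int where n: "L1 y - L2 y = (L1 x - L2 x) + (of_int (2 * n) * pi) * \<i>"
        unfolding exp_eq by blast
      hence "n \<noteq> 0" using y by auto
      hence "1 \<le> \<bar>real_of_int n\<bar>" by linarith
      moreover have "norm (L1 y - L2 y - (L1 x - L2 x)) = 2 * pi * \<bar>real_of_int n\<bar>"
        unfolding n by (simp add: norm_mult)
      ultimately show "2 * pi \<le> norm (L1 y - L2 y - (L1 x - L2 x))" by simp
    qed simp
  qed
  then obtain c where "\<And>p. p \<in> S \<Longrightarrow> L1 p - L2 p = c" unfolding constant_on_def by blast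
  from this[OF assms(5)] this[OF assms(7)] show ?thesis using assms(6) by simp
qed

text \<open>  The branch of the logarithm on the left half-plane that agrees with the principal branch on the positive
  imaginary axis and exceeds it by \<open>2 \<pi> \<i>\<close> on the negative imaginary axis. This discrepancy is what
  distinguishes above from below in the argument on the vertical order.\<close>

definition left_log :: "complex \<Rightarrow> complex" where
  "left_log z = Ln (- z) + \<i> * pi"

lemma left_log_propagates:
  fixes L Z :: "'a::topological_space \<Rightarrow> complex"
  assumes "connected S" "continuous_on S L" "\<And>p. p \<in> S \<Longrightarrow> exp (L p) = Z p"
    and "\<And>p. p \<in> S \<Longrightarrow> Re (Z p) \<le> 0"
    and "p0 \<in> S" "L p0 = left_log (Z p0)" "p \<in> S"
  shows "L p = left_log (Z p)"
proof (rule continuous_logs_unique[OF assms(1,2)])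
  have "continuous_on S Z"
    by (rule continuous_on_eq[OF continuous_on_exp[OF assms(2)] assms(3)])
  moreover have "- Z p \<notin> \<real>\<^sub>\<le>\<^sub>0" if "p \<in> S" for p
    using assms(3,4)[OF that] exp_not_eq_zero[of "L p"]
    by (auto simp: complex_nonpos_Reals_iff complex_eq_iff)
  ultimately show "continuous_on S (\<lambda>p. left_log (Z p))"
    unfolding left_log_def by (intro continuous_intros) auto
  show "exp (L p) = exp (left_log (Z p))" if "p \<in> S" for p
    using assms(3)[OF that] exp_not_eq_zero[of "L p"] by (simp add: left_log_def exp_add)
qed (use assms in auto)

lemma log_of_difference:
  fixes \<alpha> \<beta> :: "real \<Rightarrow> complex"
  assumes "continuous_on {0..1} \<alpha>" "continuous_on {0..1} \<beta>"
    and ne: "\<And>s t. s \<in> {0..1} \<Longrightarrow> t \<in> {0..1} \<Longrightarrow> \<alpha> s \<noteq> \<beta> t"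
    and "s0 \<in> {0..1}" "t0 \<in> {0..1}" "exp c = \<alpha> s0 - \<beta> t0"
  obtains L where "continuous_on ({0..1} \<times> {0..1}) L"
    "\<And>s t. s \<in> {0..1} \<Longrightarrow> t \<in> {0..1} \<Longrightarrow> exp (L (s, t)) = \<alpha> s - \<beta> t" "L (s0, t0) = c"
proof -
  have cv: "convex ({0..1::real} \<times> {0..1::real})" by (intro convex_Times) auto
  have ct: "continuous_on ({0..1::real} \<times> {0..1::real}) (\<lambda>p. \<alpha> (fst p) - \<beta> (snd p))"
    by (intro continuous_intros continuous_on_compose2[OF assms(1)] continuous_on_compose2[OF assms(2)]) auto
  obtain g where g: "continuous_on ({0..1::real} \<times> {0..1::real}) g"
    "\<And>p. p \<in> {0..1} \<times> {0..1} \<Longrightarrow> \<alpha> (fst p) - \<beta> (snd p) = exp (g p)"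
    by (rule continuous_logarithm_on_contractible[OF ct convex_imp_contractible[OF cv]]) (use ne in auto)
  show ?thesis
  proof
    show "continuous_on ({0..1} \<times> {0..1}) (\<lambda>p. g p + (c - g (s0, t0)))"
      by (intro continuous_intros g)
    fix s t :: real assume "s \<in> {0..1}" "t \<in> {0..1}"
    moreover have "exp (c - g (s0, t0)) = 1"
      using g(2)[of "(s0, t0)"] assms(4-6) by (simp add: exp_diff)
    ultimately show "exp (g (s, t) + (c - g (s0, t0))) = \<alpha> s - \<beta> t"
      using g(2)[of "(s, t)"] by (simp add: exp_add)
  qed simp
qed

lemma left_log_moves:
  fixes \<alpha> \<beta> :: "real \<Rightarrow> complex"
  assumes L: "continuous_on ({0..1} \<times> {0..1}) L"
      "\<forall>s\<in>{0..1}. \<forall>t\<in>{0..1}. exp (L (s, t)) = \<alpha> s - \<beta> t"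
    and I: "connected I" "I \<subseteq> {0..1}" and J: "connected J" "J \<subseteq> {0..1}"
    and start: "L (s0, t0) = left_log (\<alpha> s0 - \<beta> t0)"
    and le: "\<And>s t. s \<in> I \<Longrightarrow> t \<in> J \<Longrightarrow> Re (\<alpha> s) \<le> Re (\<beta> t)"
    and st: "s0 \<in> I" "t0 \<in> J" "s1 \<in> I" "t1 \<in> J"
  shows "L (s1, t1) = left_log (\<alpha> s1 - \<beta> t1)"
proof -
  have "I \<times> J \<subseteq> {0..1} \<times> {0..1}" using I(2) J(2) by (rule Sigma_mono)
  hence c: "continuous_on (I \<times> J) L" using L(1) continuous_on_subset by blast
  have e: "exp (L p) = \<alpha> (fst p) - \<beta> (snd p)" if "p \<in> I \<times> J" for p
  proof -
    have f: "fst p \<in> {0..1}" by (rule subsetD[OF I(2)]) (use that in auto)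
    have "snd p \<in> {0..1}" by (rule subsetD[OF J(2)]) (use that in auto)
    from bspec[OF bspec[OF L(2) f] this] show ?thesis by simp
  qed
  have m: "Re (\<alpha> (fst p) - \<beta> (snd p)) \<le> 0" if "p \<in> I \<times> J" for p
    using le that by auto
  from left_log_propagates[OF connected_Times[OF I(1) J(1)] c e m, of "(s0, t0)" "(s1, t1)"]
  show ?thesis using start st by simp
qed

text \<open>  Here \<open>\<alpha>\<close> and \<open>\<beta>\<close> each come from far on the left, reach their first marked point at time \<open>1/4\<close> and their second
  at time \<open>1/2\<close>, and go back to the far left. The logarithm \<open>L\<close> of \<open>\<alpha> s - \<beta> t\<close> is followed from the first pair
  of marked points to the second, along a route on which \<open>\<alpha> s\<close> stays to the left of \<open>\<beta> t\<close>, except that \<open>\<alpha>\<close> has to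
  pass from its initial to its final end. For this passage the point \<open>\<beta> (1/4)\<close> is first moved
  far to the right along \<open>\<rho>\<close>.\<close>

lemma track_left:
  fixes \<alpha> \<beta> \<rho> :: "real \<Rightarrow> complex"
  assumes ca: "continuous_on {0..1} \<alpha>" and cr: "continuous_on {0..1} \<rho>"
    and ner: "\<And>s t. s \<in> {0..1} \<Longrightarrow> t \<in> {0..1} \<Longrightarrow> \<alpha> s \<noteq> \<rho> t"
    and L: "continuous_on ({0..1} \<times> {0..1}) L"
      "\<And>s t. s \<in> {0..1} \<Longrightarrow> t \<in> {0..1} \<Longrightarrow> exp (L (s, t)) = \<alpha> s - \<beta> t"
      "L (1/4, 1/4) = left_log (\<alpha> (1/4) - \<beta> (1/4))"
    and left0: "\<And>s. s \<in> {0..1/4} \<Longrightarrow> Re (\<alpha> s) \<le> Re (\<beta> (1/4))"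
    and left1: "\<And>s. s \<in> {1/2..1} \<Longrightarrow> Re (\<alpha> s) \<le> Re (\<beta> (1/2))"
    and far: "\<And>t. t \<in> {1/4..1/2} \<Longrightarrow> Re (\<alpha> 1) \<le> Re (\<beta> t)"
    and rho0: "\<rho> 0 = \<beta> (1/4)" and rho1: "\<And>s. s \<in> {0..1} \<Longrightarrow> Re (\<alpha> s) \<le> Re (\<rho> 1)"
    and rho: "\<And>t. t \<in> {0..1} \<Longrightarrow> Re (\<alpha> 0) \<le> Re (\<rho> t)" "\<And>t. t \<in> {0..1} \<Longrightarrow> Re (\<alpha> 1) \<le> Re (\<rho> t)"
  shows "L (1/2, 1/2) = left_log (\<alpha> (1/2) - \<beta> (1/2))"
proof -
  have "\<forall>s\<in>{0..1}. \<forall>t\<in>{0..1}. exp (L (s, t)) = \<alpha> s - \<beta> t" using L(2) by blast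
  note move = left_log_moves[OF L(1) this]
  have 1: "L (0, 1/4) = left_log (\<alpha> 0 - \<beta> (1/4))"
    proof -
    have r: "Re (\<alpha> s) \<le> Re (\<beta> t)" if "s \<in> {0..1/4}" "t \<in> {1/4}" for s t
      using that by (metis singletonD left0)
    show ?thesis by (rule move[of "{0..1/4}" "{1/4}", OF _ _ _ _ L(3) r]) auto
  qed
  have 2: "L (1, 1/4) = left_log (\<alpha> 1 - \<beta> (1/4))"
  proof -
    obtain L1 where L1: "continuous_on ({0..1} \<times> {0..1}) L1"
      "\<And>s t. s \<in> {0..1} \<Longrightarrow> t \<in> {0..1} \<Longrightarrow> exp (L1 (s, t)) = \<alpha> s - \<rho> t" "L1 (0, 0) = L (0, 1/4)"
      by (rule log_of_difference[OF ca cr ner, of 0 0 "L (0, 1/4)"]) (use L(2) rho0 in auto)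
    have "\<forall>s\<in>{0..1}. \<forall>t\<in>{0..1}. exp (L1 (s, t)) = \<alpha> s - \<rho> t" using L1(2) by blast
    note move1 = left_log_moves[OF L1(1) this]
    have 4: "L1 (0, 0) = left_log (\<alpha> 0 - \<rho> 0)" unfolding L1(3) rho0 by (rule 1)
    have 5: "L1 (0, 1) = left_log (\<alpha> 0 - \<rho> 1)"
      proof -
    have r: "Re (\<alpha> s) \<le> Re (\<rho> t)" if "s \<in> {0}" "t \<in> {0..1}" for s t
      using that by (metis singletonD rho(1))
    show ?thesis by (rule move1[of "{0}" "{0..1}", OF _ _ _ _ 4 r]) auto
  qed
    have 6: "L1 (1, 1) = left_log (\<alpha> 1 - \<rho> 1)"
      proof -
    have r: "Re (\<alpha> s) \<le> Re (\<rho> t)" if "s \<in> {0..1}" "t \<in> {1}" for s t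
      using that by (metis singletonD rho1)
    show ?thesis by (rule move1[of "{0..1}" "{1}", OF _ _ _ _ 5 r]) auto
  qed
    have 3: "L1 (1, 0) = left_log (\<alpha> 1 - \<rho> 0)"
      proof -
    have r: "Re (\<alpha> s) \<le> Re (\<rho> t)" if "s \<in> {1}" "t \<in> {0..1}" for s t
      using that by (metis singletonD rho(2))
    show ?thesis by (rule move1[of "{1}" "{0..1}", OF _ _ _ _ 6 r]) auto
  qed
    \<comment> \<open>Both sides continue the same value along the same path of \<open>\<alpha> s - \<beta> (1/4)\<close>.\<close>
    have "L (1, 1/4) = L1 (1, 0)"
    proof (rule continuous_logs_unique[where S = "{0..1::real}" and ?L1.0 = "\<lambda>s. L (s, 1/4)" and ?L2.0 = "\<lambda>s. L1 (s, 0)" and ?p0.0 = 0])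
      show "connected {0..1::real}" by simp
      show "L (0, 1/4) = L1 (0, 0)" by (rule L1(3)[symmetric])
      show "exp (L (s, 1/4)) = exp (L1 (s, 0))" if "s \<in> {0..1}" for s
        using L(2)[OF that, of "1/4"] L1(2)[OF that, of 0] rho0 by simp
      show "continuous_on {0..1} (\<lambda>s. L (s, 1/4))"
        by (rule continuous_on_compose2[OF L(1), where f = "\<lambda>s. (s, 1/4)"]) (intro continuous_intros, force)
      show "continuous_on {0..1} (\<lambda>s. L1 (s, 0))"
        by (rule continuous_on_compose2[OF L1(1), where f = "\<lambda>s. (s, 0)"]) (intro continuous_intros, force)
    qed simp_all
    thus ?thesis unfolding 3 rho0 .
  qed
  have 3: "L (1, 1/2) = left_log (\<alpha> 1 - \<beta> (1/2))"
    proof -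
    have r: "Re (\<alpha> s) \<le> Re (\<beta> t)" if "s \<in> {1}" "t \<in> {1/4..1/2}" for s t
      using that by (metis singletonD far)
    show ?thesis by (rule move[of "{1}" "{1/4..1/2}", OF _ _ _ _ 2 r]) auto
  qed
  show ?thesis
    proof -
    have r: "Re (\<alpha> s) \<le> Re (\<beta> t)" if "s \<in> {1/2..1}" "t \<in> {1/2}" for s t
      using that by (metis singletonD left1)
    show ?thesis by (rule move[of "{1/2..1}" "{1/2}", OF _ _ _ _ 3 r]) auto
  qed
qed

text \<open>  From \<open>a\<close> one can go arbitrarily far to the left inside \<open>A\<close> without passing to the right of \<open>a\<close>: this is what
  remains of an access in logarithmic coordinates. To the right only a uniform bound \<open>m\<close> is kept.\<close>

definition reaches_left :: "complex set \<Rightarrow> complex \<Rightarrow> bool" where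
  "reaches_left A a \<longleftrightarrow> (\<forall>M. \<exists>b. Re b < M \<and> path_component (A \<inter> {z. Re z \<le> Re a}) a b)"

definition reaches_right :: "complex set \<Rightarrow> complex \<Rightarrow> bool" where
  "reaches_right A a \<longleftrightarrow> (\<exists>m. \<forall>M. \<exists>b. Re b > M \<and> path_component (A \<inter> {z. m \<le> Re z}) a b)"

lemma two_sided_path:
  assumes l0: "reaches_left A a0" and l1: "reaches_left A a1"
    and p: "path p" "path_image p \<subseteq> A" "pathstart p = a0" "pathfinish p = a1"
  obtains \<alpha> :: "real \<Rightarrow> complex" where "continuous_on {0..1} \<alpha>" "\<alpha> ` {0..1} \<subseteq> A" "\<alpha> (1/4) = a0" "\<alpha> (1/2) = a1"
    "\<And>s. s \<in> {0..1/4} \<Longrightarrow> Re (\<alpha> s) \<le> Re a0" "\<And>s. s \<in> {1/2..1} \<Longrightarrow> Re (\<alpha> s) \<le> Re a1"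
    "Re (\<alpha> 0) < M" "Re (\<alpha> 1) < M" "\<And>s. s \<in> {1/4..1/2} \<Longrightarrow> \<alpha> s \<in> path_image p"
proof -
  obtain b0 g0 where g0: "Re b0 < M" "path g0" "path_image g0 \<subseteq> A \<inter> {z. Re z \<le> Re a0}" "pathstart g0 = a0" "pathfinish g0 = b0"
    using l0 unfolding reaches_left_def path_component_def by metis
  obtain b1 g1 where g1: "Re b1 < M" "path g1" "path_image g1 \<subseteq> A \<inter> {z. Re z \<le> Re a1}" "pathstart g1 = a1" "pathfinish g1 = b1"
    using l1 unfolding reaches_left_def path_component_def by metis
  define \<alpha> where "\<alpha> = (reversepath g0 +++ p) +++ g1"
  have "path \<alpha>" unfolding \<alpha>_def using g0 g1 p by (intro path_join_imp) auto
  moreover have "path_image \<alpha> \<subseteq> A" unfolding \<alpha>_def using g0 g1 p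
    by (intro order.trans[OF path_image_join_subset] Un_least) auto
  moreover have "\<alpha> (1/4) = a0" using g0 by (simp add: \<alpha>_def joinpaths_def reversepath_def pathstart_def)
  moreover have "\<alpha> (1/2) = a1" using p by (simp add: \<alpha>_def joinpaths_def reversepath_def pathfinish_def)
  moreover have "Re (\<alpha> s) \<le> Re a0" if "s \<in> {0..1/4}" for s
  proof -
    have "\<alpha> s = g0 (1 - 4 * s)" using that by (simp add: \<alpha>_def joinpaths_def reversepath_def)
    also have "\<dots> \<in> path_image g0" using that by (auto simp: path_image_def)
    finally show ?thesis using g0 by auto
  qed
  moreover have "Re (\<alpha> s) \<le> Re a1" if "s \<in> {1/2..1}" for s
  proof (cases "s = 1/2")
    case True
    have "Re (\<alpha> (1/2)) \<le> Re a1" using \<open>\<alpha> (1/2) = a1\<close> by simp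
    thus ?thesis unfolding True .
  next
    case False
    have "\<alpha> s = g1 (2 * s - 1)" using that False by (simp add: \<alpha>_def joinpaths_def)
    also have "\<dots> \<in> path_image g1" using that by (auto simp: path_image_def)
    finally show ?thesis using g1 by auto
  qed
  moreover have "Re (\<alpha> 0) < M" "Re (\<alpha> 1) < M"
    using g0 g1 by (auto simp: \<alpha>_def joinpaths_def reversepath_def pathfinish_def)
  moreover have "\<alpha> s \<in> path_image p" if "s \<in> {1/4..1/2}" for s
  proof (cases "s = 1/4")
    case True thus ?thesis using \<open>\<alpha> (1/4) = a0\<close> p by (metis pathstart_in_path_image)
  next
    case False
    have "\<alpha> s = p (4 * s - 1)" using that False by (simp add: \<alpha>_def joinpaths_def)
    also have "\<dots> \<in> path_image p" using that by (auto simp: path_image_def)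
    finally show ?thesis .
  qed
  ultimately show ?thesis using that[of \<alpha>] by (auto simp: path_def path_image_def)
qed

lemma Re_bounds_on_compact:
  assumes "compact (S :: complex set)"
  obtains m M where "\<And>z. z \<in> S \<Longrightarrow> m < Re z" "\<And>z. z \<in> S \<Longrightarrow> Re z < M"
proof -
  obtain B where "\<And>z. z \<in> S \<Longrightarrow> cmod z \<le> B"
    using compact_imp_bounded[OF assms] unfolding bounded_iff by auto
  hence "z \<in> S \<Longrightarrow> \<bar>Re z\<bar> \<le> B" for z using abs_Re_le_cmod order_trans by blast
  thus ?thesis using that[of "- B - 1" "B + 1"] by (force simp: abs_le_iff)
qed

text \<open>  Accesses of two disjoint domains are ordered in the same way wherever the order is read off, provided
  that both domains extend to the right. Take a logarithm of \<open>\<alpha> s - \<beta> t\<close> that is principal at \<open>a0 - b0\<close>, which lies on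
  the positive imaginary axis. Followed with \<open>\<alpha>\<close> on the left it arrives at \<open>a1 - b1\<close> as \<open>left_log\<close>,
  followed with \<open>\<beta>\<close> on the left it arrives there as the principal branch. If \<open>a1\<close> were below \<open>b1\<close>, these
  two values would differ by \<open>2 \<pi> \<i>\<close>.\<close>

lemma vertical_order_invariant:
  assumes disj: "A \<inter> B = {}"
    and pA: "path_component A a0 a1" and pB: "path_component B b0 b1"
    and lev: "Re a0 = Re b0" "Re a1 = Re b1"
    and left: "reaches_left A a0" "reaches_left A a1" "reaches_left B b0" "reaches_left B b1"
    and right: "reaches_right A a0" "reaches_right B b0"
    and above: "Im b0 < Im a0"
  shows "Im b1 < Im a1"
proof (rule ccontr)
  assume "\<not> Im b1 < Im a1"
  obtain p where p: "path p" "path_image p \<subseteq> A" "pathstart p = a0" "pathfinish p = a1"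
    using pA unfolding path_component_def by blast
  obtain q where q: "path q" "path_image q \<subseteq> B" "pathstart q = b0" "pathfinish q = b1"
    using pB unfolding path_component_def by blast
  have "a1 \<noteq> b1" using p q disj by (metis disjoint_iff pathfinish_in_path_image subsetD)
  hence below: "Im a1 < Im b1" using \<open>\<not> Im b1 < Im a1\<close> lev by (auto simp: complex_eq_iff)
  obtain mA where mA: "\<And>M. \<exists>b. Re b > M \<and> path_component (A \<inter> {z. mA \<le> Re z}) a0 b"
    using right(1) unfolding reaches_right_def by blast
  obtain mB where mB: "\<And>M. \<exists>b. Re b > M \<and> path_component (B \<inter> {z. mB \<le> Re z}) b0 b"
    using right(2) unfolding reaches_right_def by blast
  obtain np where np: "\<And>z. z \<in> path_image p \<Longrightarrow> np < Re z"
    using Re_bounds_on_compact[OF compact_path_image[OF p(1)]] by metis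
  obtain nq where nq: "\<And>z. z \<in> path_image q \<Longrightarrow> nq < Re z"
    using Re_bounds_on_compact[OF compact_path_image[OF q(1)]] by metis
  obtain \<alpha> :: "real \<Rightarrow> complex" where al: "continuous_on {0..1} \<alpha>" "\<alpha> ` {0..1} \<subseteq> A" "\<alpha> (1/4) = a0" "\<alpha> (1/2) = a1"
    "\<And>s. s \<in> {0..1/4} \<Longrightarrow> Re (\<alpha> s) \<le> Re a0" "\<And>s. s \<in> {1/2..1} \<Longrightarrow> Re (\<alpha> s) \<le> Re a1"
    "Re (\<alpha> 0) < min mB nq" "Re (\<alpha> 1) < min mB nq" "\<And>s. s \<in> {1/4..1/2} \<Longrightarrow> \<alpha> s \<in> path_image p"
    using two_sided_path[OF left(1,2) p] by metis
  obtain \<beta> :: "real \<Rightarrow> complex" where be: "continuous_on {0..1} \<beta>" "\<beta> ` {0..1} \<subseteq> B" "\<beta> (1/4) = b0" "\<beta> (1/2) = b1"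
    "\<And>s. s \<in> {0..1/4} \<Longrightarrow> Re (\<beta> s) \<le> Re b0" "\<And>s. s \<in> {1/2..1} \<Longrightarrow> Re (\<beta> s) \<le> Re b1"
    "Re (\<beta> 0) < min mA np" "Re (\<beta> 1) < min mA np" "\<And>s. s \<in> {1/4..1/2} \<Longrightarrow> \<beta> s \<in> path_image q"
    using two_sided_path[OF left(3,4) q] by metis
  obtain Ma where Ma: "\<And>z. z \<in> \<alpha> ` {0..1} \<Longrightarrow> Re z < Ma"
    using Re_bounds_on_compact[OF compact_continuous_image[OF al(1) compact_Icc]] by metis
  obtain Mb where Mb: "\<And>z. z \<in> \<beta> ` {0..1} \<Longrightarrow> Re z < Mb"
    using Re_bounds_on_compact[OF compact_continuous_image[OF be(1) compact_Icc]] by metis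
  obtain \<rho> where rho: "path \<rho>" "path_image \<rho> \<subseteq> B \<inter> {z. mB \<le> Re z}" "\<rho> 0 = b0" "Re (\<rho> 1) > Ma"
    using mB[of Ma] unfolding path_component_def pathstart_def pathfinish_def by metis
  obtain \<sigma> where sig: "path \<sigma>" "path_image \<sigma> \<subseteq> A \<inter> {z. mA \<le> Re z}" "\<sigma> 0 = a0" "Re (\<sigma> 1) > Mb"
    using mA[of Mb] unfolding path_component_def pathstart_def pathfinish_def by metis
  have ne: "\<alpha> s \<noteq> \<beta> t" "\<alpha> s \<noteq> \<rho> t" "\<beta> t \<noteq> \<sigma> s" if "s \<in> {0..1}" "t \<in> {0..1}" for s t
  proof -
    have "\<alpha> s \<in> A" "\<beta> t \<in> B" "\<rho> t \<in> B" "\<sigma> s \<in> A"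
      using al(2) be(2) rho(2) sig(2) that unfolding path_image_def by blast+
    thus "\<alpha> s \<noteq> \<beta> t" "\<alpha> s \<noteq> \<rho> t" "\<beta> t \<noteq> \<sigma> s" using disj by (metis disjoint_iff)+
  qed
  obtain L where L: "continuous_on ({0..1} \<times> {0..1}) L"
      "\<And>s t. s \<in> {0..1} \<Longrightarrow> t \<in> {0..1} \<Longrightarrow> exp (L (s, t)) = \<alpha> s - \<beta> t" "L (1/4, 1/4) = Ln (a0 - b0)"
    by (rule log_of_difference[OF al(1) be(1) ne(1), of "1/4" "1/4" "Ln (a0 - b0)"])
       (use ne(1)[of "1/4" "1/4"] al(3) be(3) in simp_all)
  define y where "y = Im a0 - Im b0"
  have y: "y > 0" "a0 - b0 = of_real y * \<i>" using above lev by (auto simp: y_def complex_eq_iff)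
  have start: "Ln (a0 - b0) = left_log (a0 - b0)"
  proof -
    have l1: "Ln (- (of_real y * \<i>)) = of_real (ln y) - \<i> * pi / 2"
      using Ln_times_of_real[OF y(1), of "- \<i>"] Ln_of_real[OF y(1)] by simp
    have l2: "Ln (of_real y * \<i>) = of_real (ln y) + \<i> * pi / 2"
      using Ln_times_of_real[OF y(1), of "\<i>"] Ln_of_real[OF y(1)] by simp
    show ?thesis unfolding y(2) left_log_def l1 l2 by (simp add: complex_eq_iff)
  qed
  have e1: "L (1/2, 1/2) = left_log (a1 - b1)"
  proof -
    have "L (1/2, 1/2) = left_log (\<alpha> (1/2) - \<beta> (1/2))"
    proof (rule track_left[OF al(1) _ ne(2) L(1,2)])
      show "continuous_on {0..1} \<rho>" using rho(1) by (simp add: path_def)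
      show "L (1/4, 1/4) = left_log (\<alpha> (1/4) - \<beta> (1/4))" using L(3) start al(3) be(3) by simp
      show "Re (\<alpha> s) \<le> Re (\<beta> (1/4))" if "s \<in> {0..1/4}" for s using al(5)[OF that] lev be(3) by simp
      show "Re (\<alpha> s) \<le> Re (\<beta> (1/2))" if "s \<in> {1/2..1}" for s using al(6)[OF that] lev be(4) by simp
      show "Re (\<alpha> 1) \<le> Re (\<beta> t)" if "t \<in> {1/4..1/2}" for t using al(8) nq[OF be(9)[OF that]] by simp
      show "Re (\<alpha> s) \<le> Re (\<rho> 1)" if "s \<in> {0..1}" for s using Ma[OF imageI[OF that]] rho(4) by linarith
      show "Re (\<alpha> 0) \<le> Re (\<rho> t)" "Re (\<alpha> 1) \<le> Re (\<rho> t)" if "t \<in> {0..1}" for t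
      proof -
        have "\<rho> t \<in> path_image \<rho>" using that by (auto simp: path_image_def)
        hence "mB \<le> Re (\<rho> t)" using rho(2) by blast
        thus "Re (\<alpha> 0) \<le> Re (\<rho> t)" "Re (\<alpha> 1) \<le> Re (\<rho> t)" using al(7,8) by linarith+
      qed
      show "\<rho> 0 = \<beta> (1/4)" using rho(3) be(3) by simp
    qed
    thus ?thesis using al(4) be(4) by simp
  qed
  have e2: "L (1/2, 1/2) = Ln (a1 - b1)"
  proof -
    have "(\<lambda>p. L (snd p, fst p) + \<i> * pi) (1/2, 1/2) = left_log (\<beta> (1/2) - \<alpha> (1/2))"
    proof (rule track_left[OF be(1), of \<sigma> "\<lambda>p. L (snd p, fst p) + \<i> * pi" \<alpha>])
      show "continuous_on {0..1} \<sigma>" using sig(1) by (simp add: path_def)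
      show "continuous_on ({0..1} \<times> {0..1}) (\<lambda>p. L (snd p, fst p) + \<i> * pi)"
        by (intro continuous_intros continuous_on_compose2[OF L(1)]) auto
      show "exp (L (snd (s, t), fst (s, t)) + \<i> * pi) = \<beta> s - \<alpha> t" if "s \<in> {0..1}" "t \<in> {0..1}" for s t
        using L(2)[OF that(2,1)] by (simp add: exp_add)
      show "L (snd (1/4, 1/4), fst (1/4, 1/4)) + \<i> * pi = left_log (\<beta> (1/4) - \<alpha> (1/4))"
        using L(3) al(3) be(3) by (simp add: left_log_def)
      show "Re (\<beta> s) \<le> Re (\<alpha> (1/4))" if "s \<in> {0..1/4}" for s using be(5)[OF that] lev al(3) by simp
      show "Re (\<beta> s) \<le> Re (\<alpha> (1/2))" if "s \<in> {1/2..1}" for s using be(6)[OF that] lev al(4) by simp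
      show "Re (\<beta> 1) \<le> Re (\<alpha> t)" if "t \<in> {1/4..1/2}" for t using be(8) np[OF al(9)[OF that]] by simp
      show "Re (\<beta> s) \<le> Re (\<sigma> 1)" if "s \<in> {0..1}" for s using Mb[OF imageI[OF that]] sig(4) by linarith
      show "Re (\<beta> 0) \<le> Re (\<sigma> t)" "Re (\<beta> 1) \<le> Re (\<sigma> t)" if "t \<in> {0..1}" for t
      proof -
        have "\<sigma> t \<in> path_image \<sigma>" using that by (auto simp: path_image_def)
        hence "mA \<le> Re (\<sigma> t)" using sig(2) by blast
        thus "Re (\<beta> 0) \<le> Re (\<sigma> t)" "Re (\<beta> 1) \<le> Re (\<sigma> t)" using be(7,8) by linarith+
      qed
      show "\<sigma> 0 = \<alpha> (1/4)" using sig(3) al(3) by simp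
      show "\<beta> s \<noteq> \<sigma> t" if "s \<in> {0..1}" "t \<in> {0..1}" for s t using ne(3)[OF that(2,1)] .
    qed
    thus ?thesis using al(4) be(4) by (simp add: left_log_def)
  qed
  define x where "x = Im b1 - Im a1"
  have x: "x > 0" "a1 - b1 = - (of_real x * \<i>)" using below lev by (auto simp: x_def complex_eq_iff)
  have k1: "Ln (- (of_real x * \<i>)) = of_real (ln x) - \<i> * pi / 2"
    using Ln_times_of_real[OF x(1), of "- \<i>"] Ln_of_real[OF x(1)] by simp
  have k2: "Ln (of_real x * \<i>) = of_real (ln x) + \<i> * pi / 2"
    using Ln_times_of_real[OF x(1), of "\<i>"] Ln_of_real[OF x(1)] by simp
  have "Ln (of_real x * \<i>) + \<i> * pi = Ln (- (of_real x * \<i>))"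
    using e1 e2 unfolding left_log_def x(2) by simp
  hence "pi / 2 + pi = - (pi / 2)" unfolding k1 k2 by (simp add: complex_eq_iff)
  thus False using pi_gt_zero by linarith
qed

section \<open>Periodic domains disjoint from a translate\<close>

text \<open>  The Fashoda theorem, without the requirement that the paths end on the sides of the box: clamping the
  abscissa of \<open>f\<close> and the ordinate of \<open>g\<close> produces paths in the box, and the strict bounds show that no
  clamping takes place at the point where these meet.\<close>

lemma crossing_paths_meet:
  fixes f g :: "real \<Rightarrow> complex"
  assumes f: "path f" "Re (f 0) \<le> x1" "x2 \<le> Re (f 1)" "\<And>z. z \<in> path_image f \<Longrightarrow> y1 < Im z \<and> Im z < y2"
    and g: "path g" "Im (g 0) \<le> y1" "y2 \<le> Im (g 1)" "\<And>z. z \<in> path_image g \<Longrightarrow> x1 < Re z \<and> Re z < x2"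
  shows "path_image f \<inter> path_image g \<noteq> {}"
proof -
  define clamp' where "clamp' l u x = max l (min u x)" for l u x :: real
  have f0: "f 0 \<in> path_image f" "g 0 \<in> path_image g" by (auto simp: path_image_def)
  have xy: "x1 < x2" "y1 < y2" using f(4)[OF f0(1)] g(4)[OF f0(2)] by auto
  have cc: "continuous_on S (clamp' l u)" for l u S unfolding clamp'_def[abs_def] by (intro continuous_intros)
  have cf: "continuous_on {0..1} f" "continuous_on {0..1} g" using f g by (auto simp: path_def)
  define F :: "real \<Rightarrow> real^2" where "F t = vector [clamp' x1 x2 (Re (f t)), Im (f t)]" for t
  define H :: "real \<Rightarrow> real^2" where "H t = vector [Re (g t), clamp' y1 y2 (Im (g t))]" for t
  have vec: "continuous_on {0..1} (\<lambda>t::real. vector [u t, v t] :: real^2)"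
    if "continuous_on {0..1} u" "continuous_on {0..1} v" for u v :: "real \<Rightarrow> real"
  proof -
    have eq: "(\<lambda>t. vector [u t, v t] :: real^2) = (\<lambda>t. \<chi> i. if i = 1 then u t else v t)"
      by (auto simp: vec_eq_iff forall_2)
    show ?thesis unfolding eq
    proof (rule continuous_on_vec_lambda)
      fix i :: 2
      show "continuous_on {0..1} (\<lambda>t. if i = 1 then u t else v t)"
        using that by (cases "i = 1") auto
    qed
  qed
  have "path F" "path H"
    unfolding path_def F_def[abs_def] H_def[abs_def]
    by (intro vec continuous_intros cf continuous_on_compose2[OF cc[of UNIV]]; simp)+
  moreover have "path_image F \<subseteq> cbox (vector [x1, y1]) (vector [x2, y2])"
  proof
    fix v assume "v \<in> path_image F"
    then obtain t where t: "t \<in> {0..1}" "v = F t" by (auto simp: path_image_def)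
    have "y1 < Im (f t) \<and> Im (f t) < y2" using f(4)[of "f t"] t by (auto simp: path_image_def)
    thus "v \<in> cbox (vector [x1, y1]) (vector [x2, y2])"
      using xy t by (auto simp: F_def mem_box_cart forall_2 clamp'_def)
  qed
  moreover have "path_image H \<subseteq> cbox (vector [x1, y1]) (vector [x2, y2])"
  proof
    fix v assume "v \<in> path_image H"
    then obtain t where t: "t \<in> {0..1}" "v = H t" by (auto simp: path_image_def)
    have "x1 < Re (g t) \<and> Re (g t) < x2" using g(4)[of "g t"] t by (auto simp: path_image_def)
    thus "v \<in> cbox (vector [x1, y1]) (vector [x2, y2])"
      using xy t by (auto simp: H_def mem_box_cart forall_2 clamp'_def)
  qed
  ultimately obtain v where v: "v \<in> path_image F" "v \<in> path_image H"
    by (rule fashoda) (use f g xy in \<open>auto simp: F_def H_def clamp'_def pathstart_def pathfinish_def\<close>)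
  then obtain s t where st: "s \<in> {0..1}" "t \<in> {0..1}" "F s = H t" by (auto simp: path_image_def)
  have e: "clamp' x1 x2 (Re (f s)) = Re (g t)" "Im (f s) = clamp' y1 y2 (Im (g t))"
    using arg_cong[OF st(3), of "\<lambda>v::real^2. vec_nth v 1"] arg_cong[OF st(3), of "\<lambda>v::real^2. vec_nth v 2"] by (auto simp: F_def H_def)
  have "y1 < Im (f s) \<and> Im (f s) < y2" "x1 < Re (g t) \<and> Re (g t) < x2"
    using f(4)[of "f s"] g(4)[of "g t"] st by (auto simp: path_image_def)
  hence "f s = g t" using e by (auto simp: clamp'_def complex_eq_iff max_def min_def split: if_splits)
  hence "f s \<in> path_image f \<inter> path_image g" using st unfolding path_image_def by blast
  thus ?thesis by blast
qed

lemma path_component_translation: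
  assumes "path_component S x y" "\<And>z. z \<in> S \<Longrightarrow> z + c \<in> T"
  shows "path_component T (x + c) (y + c :: complex)"
proof -
  obtain p where p: "path p" "path_image p \<subseteq> S" "pathstart p = x" "pathfinish p = y"
    using assms(1) unfolding path_component_def by blast
  have "path ((\<lambda>z. z + c) \<circ> p)" using p by (auto simp: path_def intro!: continuous_intros)
  moreover have "path_image ((\<lambda>z. z + c) \<circ> p) \<subseteq> T" using p assms(2) by (auto simp: path_image_def)
  ultimately show ?thesis unfolding path_component_def using p
    by (intro exI[of _ "(\<lambda>z. z + c) \<circ> p"]) (auto simp: pathstart_def pathfinish_def)
qed

text \<open>  A periodic path in \<open>A\<close>, translated by \<open>w\<close>, lies in the complement of \<open>A\<close> and runs from the far left to the far right, above
  the lowest point of the original path. A point of \<open>A\<close> above it could be joined to this lowest point inside \<open>A\<close>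
  only by crossing it.\<close>

lemma periodic_bounded_above:
  fixes A :: "complex set"
  assumes pc: "path_connected A" and a: "a \<in> A"
    and per: "\<And>z. z \<in> A \<Longrightarrow> z + of_real L \<in> A" "\<And>z. z \<in> A \<Longrightarrow> z - of_real L \<in> A" and L: "L > 0"
    and w: "Im w > 0" "\<And>z. z \<in> A \<Longrightarrow> z + w \<notin> A"
  obtains Y where "\<And>z. z \<in> A \<Longrightarrow> Im z \<le> Y"
proof -
  obtain d where d: "path d" "path_image d \<subseteq> A" "pathstart d = a" "pathfinish d = a + of_real L"
    using pc per(1)[OF a] a unfolding path_connected_def by meson
  have cpt: "compact (path_image d)" "path_image d \<noteq> {}" using d by auto
  obtain u where u: "u \<in> path_image d" "\<And>z. z \<in> path_image d \<Longrightarrow> Im u \<le> Im z"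
    using continuous_attains_inf[OF cpt, of Im] continuous_on_Im[OF continuous_on_id] by auto
  obtain v where v: "v \<in> path_image d" "\<And>z. z \<in> path_image d \<Longrightarrow> Im z \<le> Im v"
    using continuous_attains_sup[OF cpt, of Im] continuous_on_Im[OF continuous_on_id] by auto
  define S where "S = {z \<in> A. Im u \<le> Im z \<and> Im z \<le> Im v}"
  have 1: "path_component S a (a + of_real L)"
    unfolding path_component_def using d u v by (intro exI[of _ d]) (auto simp: S_def)
  have trS: "z + of_real L \<in> S" "z - of_real L \<in> S" if "z \<in> S" for z using that per by (auto simp: S_def)
  have nfold: "path_component S a (a + of_real (real n * L))" for n
  proof (induction n)
    case 0 show ?case using path_component_mem(1)[OF 1] by (simp add: path_component_refl)
  next
    case (Suc n)
    have "path_component S (a + of_real L) (a + of_real (real n * L) + of_real L)"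
      by (rule path_component_translation[OF Suc trS(1)])
    with 1 have "path_component S a (a + of_real (real n * L) + of_real L)" by (rule path_component_trans)
    thus ?case by (simp add: algebra_simps)
  qed
  have shift_back: "z - of_real (real n * L) \<in> S" if "z \<in> S" for n z
  proof (induction n)
    case (Suc n)
    have "z - of_real (real n * L) - of_real L \<in> S" by (rule trS(2)[OF Suc])
    thus ?case by (simp add: algebra_simps)
  qed (use that in simp)
  have "Im z \<le> Im v + Im w" if z: "z \<in> A" for z
  proof (rule ccontr)
    assume hi: "\<not> Im z \<le> Im v + Im w"
    have uA: "u \<in> A" using u d by auto
    obtain g where g: "path g" "path_image g \<subseteq> A" "pathstart g = u" "pathfinish g = z"
      using pc uA z unfolding path_connected_def by meson
    obtain m M where mM: "\<And>z. z \<in> path_image g \<Longrightarrow> m < Re z" "\<And>z. z \<in> path_image g \<Longrightarrow> Re z < M"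
      using Re_bounds_on_compact[OF compact_path_image[OF g(1)]] by metis
    define B where "B = \<bar>m\<bar> + \<bar>M\<bar> + \<bar>Re a\<bar> + \<bar>Re w\<bar>"
    obtain n :: nat where n: "real n * L > B" using reals_Archimedean3[OF L] by blast
    have "path_component S (a - of_real (real n * L)) (a + of_real (real (2 * n) * L) - of_real (real n * L))"
      using path_component_translation[OF nfold[of "2 * n"], of "- of_real (real n * L)" S] shift_back by simp
    moreover have "a + of_real (real (2 * n) * L) - of_real (real n * L) = a + of_real (real n * L)"
      by (simp add: algebra_simps)
    ultimately have "path_component ((\<lambda>z. z + w) ` S) (a - of_real (real n * L) + w) (a + of_real (real n * L) + w)"
      by (intro path_component_translation[of S _ _ w "(\<lambda>z. z + w) ` S"]) (simp_all add: add.commute)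
    then obtain f where f: "path f" "path_image f \<subseteq> (\<lambda>z. z + w) ` S" "f 0 = a - of_real (real n * L) + w" "f 1 = a + of_real (real n * L) + w"
      unfolding path_component_def pathstart_def pathfinish_def by blast
    have "path_image f \<inter> path_image g \<noteq> {}"
    proof (rule crossing_paths_meet)
      show "Re (f 0) \<le> m" "M \<le> Re (f 1)" 
        using n abs_ge_self[of M] abs_ge_minus_self[of m] abs_ge_self[of m] abs_ge_self[of "Re a"] abs_ge_minus_self[of "Re a"]
          abs_ge_self[of "Re w"] abs_ge_minus_self[of "Re w"] abs_ge_zero[of M] abs_ge_zero[of m]
        unfolding f(3,4) B_def by (simp_all, linarith+)
      show "Im u < Im x \<and> Im x < Im z" if "x \<in> path_image f" for x
      proof -
        have "x \<in> (\<lambda>z. z + w) ` S" using f(2) that by (rule subsetD)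
        then obtain x' where "x' \<in> S" "x = x' + w" by (rule imageE)
        thus ?thesis using w(1) hi by (simp add: S_def)
      qed
      show "Im (g 0) \<le> Im u" "Im z \<le> Im (g 1)" using g(3,4) by (simp_all add: pathstart_def pathfinish_def)
      show "m < Re x \<and> Re x < M" if "x \<in> path_image g" for x using mM[OF that] by simp
    qed (use f(1) g(1) in simp_all)
    then obtain x where x: "x \<in> path_image f" "x \<in> A" using g(2) by blast
    then obtain x' where "x' \<in> S" "x = x' + w" using f(2) by blast
    thus False using w(2)[of x'] x(2) by (simp add: S_def)
  qed
  thus ?thesis using that by blast
qed

lemma periodic_bounded:
  fixes A :: "complex set"
  assumes pc: "path_connected A" and a: "a \<in> A"
    and per: "\<And>z. z \<in> A \<Longrightarrow> z + of_real L \<in> A" "\<And>z. z \<in> A \<Longrightarrow> z - of_real L \<in> A" and L: "L > 0"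
    and w: "Im w > 0" "\<And>z. z \<in> A \<Longrightarrow> z + w \<notin> A"
  obtains Y where "\<And>z. z \<in> A \<Longrightarrow> \<bar>Im z\<bar> < Y"
proof -
  obtain Y1 where 1: "\<And>z. z \<in> A \<Longrightarrow> Im z \<le> Y1"
    using periodic_bounded_above[OF assms] by metis
  obtain Y2 where 2: "\<And>z. z \<in> uminus ` A \<Longrightarrow> Im z \<le> Y2"
  proof (rule periodic_bounded_above[of "uminus ` A" "- a" L w])
    show "path_connected (uminus ` A)" by (intro path_connected_continuous_image pc continuous_intros)
    show "z + of_real L \<in> uminus ` A" if zA: "z \<in> uminus ` A" for z
    proof -
      obtain x where "x \<in> A" "z = - x" using zA unfolding image_def by blast
      thus ?thesis using imageI[OF per(2), of x uminus] by (simp add: add.commute)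
    qed
    show "z - of_real L \<in> uminus ` A" if zA: "z \<in> uminus ` A" for z
    proof -
      obtain x where "x \<in> A" "z = - x" using zA unfolding image_def by blast
      thus ?thesis using imageI[OF per(1), of x uminus] by (simp add: algebra_simps)
    qed
    show "z + w \<notin> uminus ` A" if "z \<in> uminus ` A" for z
    proof
      assume "z + w \<in> uminus ` A"
      then obtain x where x: "x \<in> A" "z + w = - x" by auto
      hence "x + w = - z" by (simp add: eq_neg_iff_add_eq_0 algebra_simps)
      thus False using w(2)[OF x(1)] that by auto
    qed
  qed (use a L w in auto)
  have "\<bar>Im z\<bar> < \<bar>Y1\<bar> + \<bar>Y2\<bar> + 1" if "z \<in> A" for z
    using 1[OF that] 2[of "- z"] that by auto
  thus ?thesis using that by blast
qed

section \<open>Lifting the complementary components to the logarithmic coordinate\<close>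

lemma lift_path_exp:
  fixes p :: "real \<Rightarrow> complex"
  assumes "path p" "0 \<notin> path_image p" "exp a = pathstart p"
  obtains q where "path q" "pathstart q = a" "\<And>t. t \<in> {0..1} \<Longrightarrow> exp (q t) = p t"
proof -
  have ct: "continuous_on {0..1} p" using assms(1) by (simp add: path_def)
  obtain g where g: "continuous_on {0..1::real} g" "\<And>x. x \<in> {0..1} \<Longrightarrow> p x = exp (g x)"
    by (rule continuous_logarithm_on_contractible[OF ct convex_imp_contractible[OF convex_closed_interval]])
       (use assms(2) in \<open>auto simp: path_image_def image_iff\<close>)
  have e: "exp (a - g 0) = 1" using g(2)[of 0] assms(3) by (simp add: exp_diff pathstart_def)
  show ?thesis
  proof
    show "path (\<lambda>t. g t + (a - g 0))" unfolding path_def by (intro continuous_intros g)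
    show "exp (g t + (a - g 0)) = p t" if "t \<in> {0..1}" for t
      using g(2)[OF that] e by (simp add: exp_add)
  qed (simp add: pathstart_def)
qed

lemma reaches_left_translation:
  assumes "reaches_left A a" "\<And>z. z \<in> A \<Longrightarrow> z + c \<in> B"
  shows "reaches_left B (a + c)"
  unfolding reaches_left_def
proof
  fix M
  obtain b where "Re b < M - Re c" "path_component (A \<inter> {z. Re z \<le> Re a}) a b"
    using assms(1) unfolding reaches_left_def by blast
  moreover from this(2) have "path_component (B \<inter> {z. Re z \<le> Re (a + c)}) (a + c) (b + c)"
    by (rule path_component_translation) (use assms(2) in auto)
  ultimately show "\<exists>b. Re b < M \<and> path_component (B \<inter> {z. Re z \<le> Re (a + c)}) (a + c) b"
    by (intro exI[of _ "b + c"]) auto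
qed

lemma reaches_right_translation:
  assumes "reaches_right A a" "\<And>z. z \<in> A \<Longrightarrow> z + c \<in> B"
  shows "reaches_right B (a + c)"
proof -
  obtain m where m: "\<And>M. \<exists>b. Re b > M \<and> path_component (A \<inter> {z. m \<le> Re z}) a b"
    using assms(1) unfolding reaches_right_def by blast
  show ?thesis unfolding reaches_right_def
  proof (intro exI[of _ "m + Re c"] allI)
    fix M
    obtain b where "Re b > M - Re c" "path_component (A \<inter> {z. m \<le> Re z}) a b" using m by blast
    moreover from this(2) have "path_component (B \<inter> {z. m + Re c \<le> Re z}) (a + c) (b + c)"
      by (rule path_component_translation) (use assms(2) in auto)
    ultimately show "\<exists>b. Re b > M \<and> path_component (B \<inter> {z. m + Re c \<le> Re z}) (a + c) b"
      by (intro exI[of _ "b + c"]) auto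
  qed
qed

lemma strict_mono_periodic_int:
  fixes \<sigma> :: "int \<Rightarrow> int"
  assumes mono: "\<And>k j. k < j \<Longrightarrow> \<sigma> k < \<sigma> j" and per: "\<And>k. \<sigma> (k + int n) = \<sigma> k + int n" and n: "n > 0"
  shows "\<sigma> k = \<sigma> 0 + k"
proof -
  have ge: "\<sigma> (k + int i) \<ge> \<sigma> k + int i" for k i
  proof (induction i)
    case (Suc i)
    have "\<sigma> (k + int i) < \<sigma> (k + int (Suc i))" by (rule mono) simp
    thus ?case using Suc by simp
  qed simp
  have step: "\<sigma> (k + 1) = \<sigma> k + 1" for k
  proof -
    have "\<sigma> (k + 1 + int (n - 1)) \<ge> \<sigma> (k + 1) + int (n - 1)" by (rule ge)
    moreover have "k + 1 + int (n - 1) = k + int n" using n by simp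
    ultimately have "\<sigma> k + int n \<ge> \<sigma> (k + 1) + int (n - 1)" using per[of k] by simp
    moreover have "\<sigma> k < \<sigma> (k + 1)" by (rule mono) simp
    ultimately show ?thesis using n by simp
  qed
  show ?thesis
  proof (induction k rule: int_induct[where k = 0])
    case (step1 i) thus ?case using step[of i] by simp
  next
    case (step2 i) thus ?case using step[of "i - 1"] by simp
  qed simp
qed

text \<open>  The complement of \<open>S\<close> is studied in the logarithmic coordinate, that is, through its preimage \<open>E\<close> under the
  exponential. The unbounded connected set \<open>C\<close> through the origin plays the part of a branch cut.\<close>

locale log_cover =
  fixes S C :: "complex set" and l :: complex
  assumes closed: "closed S" and zero: "0 \<in> C" and CS: "C \<subseteq> S" and conn: "connected C" and unb: "\<not> bounded C"
    and inv: "\<And>z. l * z \<in> S \<longleftrightarrow> z \<in> S" and l1: "cmod l > 1"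
begin

definition E where "E = exp -` (- S)"

lemma open_E: "open E"
  unfolding E_def using closed by (intro open_vimage continuous_intros) (auto simp: open_Compl)

lemma E_period: "z + of_int n * (2 * pi * \<i>) \<in> E \<longleftrightarrow> z \<in> E"
  using exp_plus_2pin[of z n] by (simp add: E_def mult_ac)

lemma E_log: "exp \<tau> = l \<Longrightarrow> z + \<tau> \<in> E \<longleftrightarrow> z \<in> E"
  using inv[of "exp z"] by (simp add: E_def exp_add mult.commute)

lemma E_log_power:
  assumes "exp T = l ^ n" shows "z + T \<in> E \<longleftrightarrow> z \<in> E"
proof -
  have "l ^ n * z \<in> S \<longleftrightarrow> z \<in> S" for z
    by (induction n) (auto simp: inv mult.assoc)
  thus ?thesis using assms by (simp add: E_def exp_add mult.commute)
qed

lemma lift_component: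
  assumes "path_component (- S) x y" "exp a = x"
  obtains b where "exp b = y" "path_component E a b"
proof -
  obtain p where p: "path p" "path_image p \<subseteq> - S" "pathstart p = x" "pathfinish p = y"
    using assms(1) unfolding path_component_def by blast
  obtain q where q: "path q" "pathstart q = a" "\<And>t. t \<in> {0..1} \<Longrightarrow> exp (q t) = p t"
    by (rule lift_path_exp[OF p(1), of a]) (use p assms zero CS in auto)
  have "path_image q \<subseteq> E" using q(3) p(2) by (auto simp: E_def path_image_def)
  hence "path_component E a (pathfinish q)" unfolding path_component_def using q by blast
  moreover have "exp (pathfinish q) = y" using q(3)[of 1] p by (simp add: pathfinish_def)
  ultimately show ?thesis using that by blast
qed

text \<open>  The exponential of a path from \<open>a\<close> to \<open>a + 2 \<pi> \<i> n\<close> is a loop with winding number \<open>n\<close> around the origin. But the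
  loop avoids \<open>C\<close>, so the origin lies outside it.\<close>

lemma no_loops:
  assumes "path_component E a (a + of_int n * (2 * pi * \<i>))"
  shows "n = 0"
proof -
  obtain p where p: "path p" "path_image p \<subseteq> E" "pathstart p = a" "pathfinish p = a + of_int n * (2 * pi * \<i>)"
    using assms unfolding path_component_def by blast
  define g where "g = exp \<circ> p"
  have g: "path g" "pathfinish g = pathstart g"
    using p exp_plus_2pin[of a n]
    by (auto simp: g_def path_def pathstart_def pathfinish_def mult_ac intro!: continuous_intros)
  have gS: "path_image g \<subseteq> - S" using p(2) by (auto simp: g_def path_image_def E_def)
  have "0 \<in> outside (path_image g)"
  proof -
    have "C \<subseteq> - path_image g" using gS CS by blast
    hence "C \<subseteq> connected_component_set (- path_image g) 0"
      using zero conn by (intro connected_component_maximal)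
    hence "\<not> bounded (connected_component_set (- path_image g) 0)" using unb bounded_subset by blast
    thus ?thesis using gS zero CS by (auto simp: outside_def)
  qed
  hence w0: "winding_number g 0 = 0" using g by (intro winding_number_zero_in_outside) auto
  have "0 \<notin> path_image g" using gS zero CS by blast
  then obtain q where q: "path q" "pathfinish q - pathstart q = 2 * of_real pi * \<i> * winding_number g 0"
     "\<And>t. t \<in> {0..1} \<Longrightarrow> g t = 0 + exp (q t)"
    using winding_number_as_continuous_log[OF g(1), of 0] by blast
  have "(\<lambda>t. q t + (p 0 - q 0)) 1 = p 1"
  proof (rule continuous_logs_unique[where S = "{0..1::real}" and ?L1.0 = "\<lambda>t. q t + (p 0 - q 0)" and ?L2.0 = p and ?p0.0 = 0])
    show "continuous_on {0..1} (\<lambda>t. q t + (p 0 - q 0))" using q(1) by (auto simp: path_def intro!: continuous_intros)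
    show "continuous_on {0..1} p" using p(1) by (simp add: path_def)
    have "exp (p 0 - q 0) = 1" using q(3)[of 0] by (simp add: g_def exp_diff)
    thus "exp (q t + (p 0 - q 0)) = exp (p t)" if "t \<in> {0..1}" for t
      using q(3)[OF that] by (simp add: g_def exp_add)
  qed auto
  hence "p 1 = p 0" using q(2) w0 by (simp add: pathstart_def pathfinish_def)
  thus ?thesis using p by (simp add: pathstart_def pathfinish_def)
qed

lemma component_path_connected:
  assumes "c \<in> components (- S)" "x \<in> c" "y \<in> c"
  shows "path_component (- S) x y"
proof -
  have "connected_component (- S) x y"
    using assms unfolding components_def
    by (auto simp: mem_Collect_eq intro: connected_component_trans connected_component_sym)
  thus ?thesis using closed by (simp add: path_component_eq_connected_component_set[symmetric] open_path_connected_component open_Compl)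
qed

end

text \<open>  \<open>U\<close> lists the complementary components in circular order, \<open>w j\<close> is the first point of the access \<open>\<Gamma> j\<close> on the
  circle of radius \<open>r\<close>, and \<open>\<theta> j\<close> is its argument.\<close>

locale ordered_cover = log_cover +
  fixes p' :: int and n :: nat and U :: "nat \<Rightarrow> complex set" and \<Gamma> :: "nat \<Rightarrow> real \<Rightarrow> complex"
    and r :: real and w :: "nat \<Rightarrow> complex" and \<theta> :: "nat \<Rightarrow> real"
  assumes n: "n > 0" and bij: "bij_betw U {..<n} (components (- S))" and r: "r > 0"
    and acc: "\<And>j. j < n \<Longrightarrow> is_access (U j) (\<Gamma> j)"
    and hit: "\<And>j. j < n \<Longrightarrow> first_hit (\<Gamma> j) r (w j)"
    and ang: "\<And>j. j < n \<Longrightarrow> w j = rcis r (\<theta> j)" "strict_mono_on {..<n} \<theta>" "\<And>j. j < n \<Longrightarrow> \<theta> j < \<theta> 0 + 2 * pi"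
    and shift: "\<And>j. j < n \<Longrightarrow> (*) l ` U j \<subseteq> U (nat ((int j + p') mod int n))"
begin

text \<open>  The points \<open>v k\<close> on the line \<open>Re z = ln r\<close> are all the logarithms of the points \<open>w j\<close>, numbered from below to
  above, and \<open>V k\<close> is the component of \<open>E\<close> that contains \<open>v k\<close>.\<close>

definition idx where "idx k = nat (k mod int n)"
definition v where "v k = Complex (ln r) (\<theta> (idx k) + 2 * pi * of_int (k div int n))"
definition V where "V k = {z. path_component E (v k) z}"

lemma idx_less: "idx k < n" using n by (simp add: idx_def nat_less_iff)

lemma int_idx: "int (idx k) = k mod int n" using n by (simp add: idx_def)

lemma exp_v: "exp (v k) = w (idx k)"
proof -
  have "exp (v k) = rcis r (\<theta> (idx k) + of_int (k div int n) * (2 * pi))"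
    using r by (simp add: v_def exp_eq_polar rcis_def mult_ac)
  also have "\<dots> = rcis r (\<theta> (idx k))"
    by (simp add: rcis_def cis.ctr sin_add cos_add mult.commute[of _ "2 * pi"])
  finally show ?thesis using ang(1)[OF idx_less] by simp
qed

lemma v_shift: "v (k + j * int n) = v k + of_int j * (2 * pi * \<i>)"
  using n by (simp add: v_def idx_def complex_eq_iff algebra_simps)

lemma v_mono: "Im (v k) < Im (v j)" if "k < j"
proof (cases "k div int n = j div int n")
  case True
  have "k mod int n - j mod int n = k - j" using True by (simp add: minus_div_mult_eq_mod[symmetric])
  hence "k mod int n < j mod int n" using that by linarith
  hence "idx k < idx j" by (simp only: int_idx[symmetric] of_nat_less_iff)
  hence "\<theta> (idx k) < \<theta> (idx j)" using ang(2) idx_less by (auto simp: strict_mono_on_def)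
  thus ?thesis using True by (simp add: v_def)
next
  case False
  have "k div int n \<le> j div int n" using that n by (intro zdiv_mono1) auto
  hence 1: "k div int n + 1 \<le> j div int n" using False by linarith
  have "\<theta> 0 \<le> \<theta> (idx j)"
  proof (cases "idx j = 0")
    case False
    hence "\<theta> 0 < \<theta> (idx j)" using ang(2) idx_less[of j] n by (auto simp: strict_mono_on_def)
    thus ?thesis by simp
  qed simp
  moreover have "\<theta> (idx k) < \<theta> 0 + 2 * pi" by (rule ang(3)[OF idx_less])
  moreover have "2 * pi * of_int (k div int n) + 2 * pi \<le> 2 * pi * of_int (j div int n)"
  proof -
    have "2 * pi * of_int (k div int n + 1) \<le> 2 * pi * of_int (j div int n)"
      using 1 by (intro mult_left_mono) (simp_all only: of_int_le_iff, simp)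
    thus ?thesis by (simp add: algebra_simps)
  qed
  ultimately show ?thesis by (simp add: v_def)
qed

lemma Re_v: "Re (v k) = ln r" by (simp add: v_def)

lemma U_component: "j < n \<Longrightarrow> U j \<in> components (- S)"
  using bij by (auto simp: bij_betw_def)

lemma w_in_U: "j < n \<Longrightarrow> w j \<in> U j"
proof -
  assume j: "j < n"
  obtain t where t: "t \<in> {0..1}" "\<Gamma> j t = w j" "cmod (w j) = r" using hit[OF j] unfolding first_hit_def by blast
  have "\<Gamma> j 0 = 0" "\<Gamma> j ` {0<..1} \<subseteq> U j" using acc[OF j] by (simp_all add: is_access_def)
  moreover from this(1) have "t \<noteq> 0" using t(2,3) r by (metis less_irrefl norm_zero)
  moreover from this have "t \<in> {0<..1}" using t(1) by simp
  ultimately show ?thesis using t(2) by (metis imageI subsetD)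
qed

lemma v_in_E: "v k \<in> E"
  using w_in_U[OF idx_less] U_component[OF idx_less] exp_v[of k] in_components_subset[of "U (idx k)" "- S"]
  by (auto simp: E_def)

lemma v_in_V: "v k \<in> V k"
  using v_in_E by (simp add: V_def path_component_refl)

lemma same_V: assumes "path_component E (v k) (v j)" shows "k = j"
proof -
  obtain p where p: "path p" "path_image p \<subseteq> E" "pathstart p = v k" "pathfinish p = v j"
    using assms unfolding path_component_def by blast
  have "path_component (- S) (exp (v k)) (exp (v j))"
    unfolding path_component_def
    using p by (intro exI[of _ "exp \<circ> p"])
      (auto simp: path_def pathstart_def pathfinish_def path_image_def E_def intro!: continuous_intros)
  hence "connected_component (- S) (w (idx k)) (w (idx j))"
    using path_component_subset_connected_component[of "- S" "exp (v k)"] unfolding exp_v by blast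
  hence "w (idx j) \<in> U (idx k)"
    using U_component[OF idx_less[of k]] w_in_U[OF idx_less[of k]]
    by (metis components_iff connected_component_eq mem_Collect_eq)
  hence "U (idx k) = U (idx j)"
    using U_component[OF idx_less] w_in_U[OF idx_less[of j]] components_eq by (metis IntI empty_iff)
  hence "idx k = idx j" using bij idx_less by (auto simp: bij_betw_def inj_on_def)
  hence "k mod int n = j mod int n" using int_idx by metis
  then obtain i where i: "j = k + i * int n"
    by (metis mod_eqE mult.commute)
  have "path_component E (v k) (v k + of_int i * (2 * pi * \<i>))" using assms unfolding i v_shift .
  hence "i = 0" by (rule no_loops)
  thus ?thesis using i by simp
qed

lemma V_disjoint: "k \<noteq> j \<Longrightarrow> V k \<inter> V j = {}"
  using same_V unfolding V_def by (blast intro: path_component_trans path_component_sym)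

lemma power_in_U: "j < n \<Longrightarrow> l ^ i * w j \<in> U (idx (int j + int i * p'))"
proof (induction i)
  case 0 thus ?case using w_in_U by (simp add: idx_def)
next
  case (Suc i)
  have "l * (l ^ i * w j) \<in> U (nat ((int (idx (int j + int i * p')) + p') mod int n))"
    using shift[OF idx_less] Suc by blast
  moreover have "nat ((int (idx (int j + int i * p')) + p') mod int n) = idx (int j + int (Suc i) * p')"
    unfolding int_idx by (simp add: idx_def mod_simps algebra_simps)
  ultimately show ?case by (simp add: mult.assoc)
qed

text \<open>  Since \<open>l ^ n\<close> maps the component \<open>U (idx k)\<close> into itself, \<open>V k\<close> contains a path from \<open>v k\<close> to \<open>v k + T\<close> for some \<open>T\<close>
  with \<open>exp T = l ^ n\<close>; its translates by multiples of \<open>T\<close> continue it to the right.\<close>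

lemma V_right: "reaches_right (V k) (v k)"
proof -
  have "l ^ n * w (idx k) \<in> U (idx (int (idx k) + int n * p'))" by (rule power_in_U[OF idx_less])
  also have "idx (int (idx k) + int n * p') = idx k" unfolding int_idx by (simp add: idx_def)
  finally have "path_component (- S) (w (idx k)) (l ^ n * w (idx k))"
    using component_path_connected[OF U_component[OF idx_less] w_in_U[OF idx_less]] by blast
  then obtain b where b: "exp b = l ^ n * w (idx k)" "path_component E (v k) b"
    using lift_component exp_v by metis
  define T where "T = b - v k"
  have wne: "w (idx k) \<noteq> 0" using exp_v[of k] exp_not_eq_zero by metis
  have T: "exp T = l ^ n" using b(1) exp_v[of k] wne by (simp add: T_def exp_diff)
  have ReT: "Re T > 0"
  proof -
    have "exp (Re T) = cmod l ^ n" using T norm_exp_eq_Re[of T] by (simp add: norm_power)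
    also have "\<dots> > 1" using l1 n by (simp add: one_less_power)
    finally show ?thesis by simp
  qed
  obtain p where p: "path p" "path_image p \<subseteq> E" "pathstart p = v k" "pathfinish p = b"
    using b(2) unfolding path_component_def by blast
  obtain m where m: "\<And>z. z \<in> path_image p \<Longrightarrow> m < Re z"
    using Re_bounds_on_compact[OF compact_path_image[OF p(1)]] by metis
  define W where "W = V k \<inter> {z. m \<le> Re z}"
  have pV: "path_image p \<subseteq> V k"
    unfolding V_def using path_component_maximal[of "v k" "path_image p" E] p
    by (metis mem_Collect_eq path_connected_path_image pathstart_in_path_image subset_eq)
  have 1: "path_component W (v k) (v k + T)"
    unfolding path_component_def using p pV m by (intro exI[of _ p]) (auto simp: W_def T_def less_imp_le)
  have tr: "z + T \<in> W" if "z \<in> W" for z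
  proof -
    have "path_component E (v k + T) (z + T)"
      using that E_log_power[OF T] by (intro path_component_translation[of E]) (auto simp: W_def V_def)
    hence "path_component E (v k) (z + T)" using b(2) path_component_trans by (fastforce simp: T_def)
    thus ?thesis using that ReT by (auto simp: W_def V_def)
  qed
  have nf: "path_component W (v k) (v k + of_nat i * T)" for i
  proof (induction i)
    case 0 thus ?case using path_component_mem(1)[OF 1] by (simp add: path_component_refl)
  next
    case (Suc i)
    have "path_component W (v k + T) (v k + of_nat i * T + T)" by (rule path_component_translation[OF Suc tr])
    with 1 have "path_component W (v k) (v k + of_nat i * T + T)" by (rule path_component_trans)
    thus ?case by (simp add: algebra_simps)
  qed
  show ?thesis unfolding reaches_right_def
  proof (intro exI[of _ m] allI)
    fix M
    obtain i :: nat where "real i * Re T > M - Re (v k)" using reals_Archimedean3[OF ReT] by blast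
    thus "\<exists>b. Re b > M \<and> path_component (V k \<inter> {z. m \<le> Re z}) (v k) b"
      using nf[of i] by (intro exI[of _ "v k + of_nat i * T"]) (auto simp: W_def)
  qed
qed

text \<open>  The access, followed backwards from \<open>w (idx k)\<close> to the origin, stays in the disc of radius \<open>r\<close> because \<open>w (idx k)\<close> is its first
  point on the circle.\<close>

lemma V_left: "reaches_left (V k) (v k)"
  unfolding reaches_left_def
proof
  fix M
  define j where "j = idx k"
  have j: "j < n" using idx_less by (simp add: j_def)
  obtain t where t: "t \<in> {0..1}" "\<Gamma> j t = w j" "cmod (w j) = r" "\<And>s. s \<in> {0..<t} \<Longrightarrow> cmod (\<Gamma> j s) \<noteq> r"
    using hit[OF j] unfolding first_hit_def by blast
  have ac: "path (\<Gamma> j)" "\<Gamma> j 0 = 0" "\<Gamma> j ` {0<..1} \<subseteq> U j" using acc[OF j] by (auto simp: is_access_def)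
  have cG: "continuous_on {0..1} (\<Gamma> j)" using ac(1) by (simp add: path_def)
  have t0: "t > 0" using t ac(2) r by (cases "t = 0") auto
  have le: "cmod (\<Gamma> j s) \<le> r" if "s \<in> {0..t}" for s
  proof (rule ccontr)
    assume gt: "\<not> cmod (\<Gamma> j s) \<le> r"
    have "\<exists>x\<ge>0. x \<le> s \<and> cmod (\<Gamma> j x) = r"
      using that gt r ac(2) t(1)
      by (intro IVT') (auto intro!: continuous_intros continuous_on_subset[OF cG])
    then obtain x where x: "0 \<le> x" "x \<le> s" "cmod (\<Gamma> j x) = r" by blast
    have "x \<noteq> s" using x gt by auto
    hence "x \<in> {0..<t}" using x that by auto
    thus False using t(4) x by blast
  qed
  have "(\<Gamma> j \<longlongrightarrow> \<Gamma> j 0) (at 0 within {0..1})" using cG unfolding continuous_on_def by simp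
  hence "((\<lambda>s. cmod (\<Gamma> j s)) \<longlongrightarrow> 0) (at 0 within {0..1})" unfolding ac(2) by (rule tendsto_norm_zero)
  hence ev: "eventually (\<lambda>s. cmod (\<Gamma> j s) < exp M) (at 0 within {0..1})"
    by (rule order_tendstoD) simp
  obtain \<epsilon> where eps: "0 < \<epsilon>" "\<epsilon> \<le> t" "cmod (\<Gamma> j \<epsilon>) < exp M"
  proof -
    obtain d where d: "d > 0" "\<And>x. x \<in> {0..1} \<Longrightarrow> x \<noteq> 0 \<Longrightarrow> dist x 0 < d \<Longrightarrow> cmod (\<Gamma> j x) < exp M"
      using ev unfolding eventually_at by metis
    show ?thesis using that[of "min t (d / 2)"] d(2)[of "min t (d / 2)"] d(1) t0 t(1) by auto
  qed
  define g where "g = subpath t \<epsilon> (\<Gamma> j)"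
  have g: "path g" "pathstart g = w j" "pathfinish g = \<Gamma> j \<epsilon>"
    using ac(1) t eps by (auto simp: g_def)
  have gi: "path_image g = \<Gamma> j ` {\<epsilon>..t}"
    using eps by (simp add: g_def path_image_subpath)
  have gU: "path_image g \<subseteq> U j" using gi ac(3) eps t(1) by force
  have US: "U j \<subseteq> - S" using in_components_subset[OF U_component[OF j]] .
  obtain q where q: "path q" "pathstart q = v k" "\<And>s. s \<in> {0..1} \<Longrightarrow> exp (q s) = g s"
    by (rule lift_path_exp[OF g(1), of "v k"]) (use gU US zero CS exp_v[of k] g(2) in \<open>auto simp: j_def\<close>)
  have qE: "path_image q \<subseteq> E" using q(3) gU US by (force simp: E_def path_image_def)
  have qV: "path_image q \<subseteq> V k"
    unfolding V_def using path_component_maximal[of "v k" "path_image q" E] q(1,2) qE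
    by (metis mem_Collect_eq path_connected_path_image pathstart_in_path_image subset_eq)
  have Req: "Re (q s) = ln (cmod (g s))" if "s \<in> {0..1}" for s
    using q(3)[OF that] norm_exp_eq_Re[of "q s"] by (metis ln_exp)
  have gpos: "cmod (g s) > 0" if "s \<in> {0..1}" for s using q(3)[OF that] by (metis exp_not_eq_zero zero_less_norm_iff)
  have "Re (q s) \<le> Re (v k)" if "s \<in> {0..1}" for s
  proof -
    have "g s \<in> \<Gamma> j ` {\<epsilon>..t}" using gi that by (auto simp: path_image_def)
    hence "cmod (g s) \<le> r" using le eps by auto
    thus ?thesis unfolding Re_v Req[OF that] using gpos[OF that] r by simp
  qed
  hence "path_image q \<subseteq> V k \<inter> {z. Re z \<le> Re (v k)}" using qV by (auto simp: path_image_def)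
  hence "path_component (V k \<inter> {z. Re z \<le> Re (v k)}) (v k) (q 1)"
    unfolding path_component_def using q(1,2) by (intro exI[of _ q]) (auto simp: pathfinish_def)
  moreover have "Re (q 1) < M"
  proof -
    have "cmod (g 1) < exp M" using g(3) eps by (simp add: pathfinish_def)
    hence "ln (cmod (g 1)) < ln (exp M)" using gpos[of 1] by (subst ln_less_cancel_iff) auto
    thus ?thesis using Req[of 1] by simp
  qed
  ultimately show "\<exists>b. Re b < M \<and> path_component (V k \<inter> {z. Re z \<le> Re (v k)}) (v k) b" by blast
qed

lemma ex_next:
  assumes "exp \<tau> = l"
  shows "\<exists>j. j mod int n = (k + p') mod int n \<and> path_component E (v k + \<tau>) (v j)"
proof -
  define i where "i = idx (k + p')"
  have "l * w (idx k) \<in> U (idx (int (idx k) + p'))" using power_in_U[OF idx_less[of k], of 1] by simp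
  moreover have "idx (int (idx k) + p') = i" unfolding int_idx i_def by (simp add: idx_def mod_simps)
  ultimately have "path_component (- S) (l * w (idx k)) (w i)"
    using component_path_connected[OF U_component] w_in_U idx_less i_def by metis
  moreover have "exp (v k + \<tau>) = l * w (idx k)" using assms exp_v[of k] by (simp add: exp_add)
  ultimately obtain b where b: "exp b = w i" "path_component E (v k + \<tau>) b"
    using lift_component by metis
  have "idx (k + p') = idx (int i)" by (simp add: i_def int_idx) (simp add: idx_def)
  hence "exp b = exp (v (int i))" using b(1) exp_v[of "int i"] by (simp add: i_def)
  then obtain m :: int where "b = v (int i) + of_int m * (2 * pi * \<i>)"
    unfolding exp_eq by (auto simp: mult_ac)
  hence "b = v (int i + m * int n)" by (simp add: v_shift)
  thus ?thesis using b(2) by (intro exI[of _ "int i + m * int n"]) (simp add: i_def int_idx)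
qed

text \<open>  Translation by \<open>Ln l\<close> sends \<open>V k\<close> to \<open>V (\<sigma> k)\<close>. The map \<open>\<sigma>\<close> preserves the order by
  \<open>vertical_order_invariant\<close> and commutes with \<open>k \<mapsto> k + n\<close>, so \<open>\<sigma> k = \<sigma> 0 + k\<close>; and \<open>\<sigma> 0\<close> is congruent to \<open>p'\<close>
  modulo \<open>n\<close>. Subtracting a multiple of \<open>2 \<pi> \<i>\<close> from \<open>Ln l\<close> turns \<open>\<sigma> 0\<close> into \<open>p'\<close>.\<close>

lemma ordered_lifts:
  obtains \<tau> where "exp \<tau> = l" "\<And>k z. z \<in> V k \<longleftrightarrow> z + \<tau> \<in> V (k + p')"
    "\<And>k z. z \<in> V k \<longleftrightarrow> z + 2 * pi * \<i> \<in> V (k + int n)"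
proof -
  have l0: "l \<noteq> 0" using l1 by auto
  define \<tau>0 where "\<tau>0 = Ln l"
  have t0: "exp \<tau>0 = l" using l0 by (simp add: \<tau>0_def)
  obtain \<sigma> where sig: "\<And>k. \<sigma> k mod int n = (k + p') mod int n" "\<And>k. path_component E (v k + \<tau>0) (v (\<sigma> k))"
    using ex_next[OF t0] by metis
  have trE: "path_component E (x + \<tau>0) (y + \<tau>0)" if "path_component E x y" for x y
    by (rule path_component_translation[OF that]) (simp add: E_log[OF t0])
  have trE': "path_component E x y" if "path_component E (x + \<tau>0) (y + \<tau>0)" for x y
    using path_component_translation[OF that, of "- \<tau>0" E] E_log[OF t0, of "_ - \<tau>0"] by simp
  have trP: "path_component E (x + of_int i * (2 * pi * \<i>)) (y + of_int i * (2 * pi * \<i>))" if "path_component E x y" for x y i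
    by (rule path_component_translation[OF that]) (simp only: E_period)
  have VV: "z + \<tau>0 \<in> V (\<sigma> k)" if "z \<in> V k" for z k
    using trE[of "v k" z] that sig(2)[of k] unfolding V_def by (blast intro: path_component_trans path_component_sym)
  have mono: "\<sigma> k < \<sigma> j" if "k < j" for k j
  proof -
    have ne: "\<sigma> k \<noteq> \<sigma> j"
    proof
      assume "\<sigma> k = \<sigma> j"
      hence "path_component E (v k + \<tau>0) (v j + \<tau>0)" using sig(2) path_component_trans path_component_sym by metis
      hence "k = j" using trE' same_V by blast
      thus False using that by simp
    qed
    have pc: "path_component (V (\<sigma> i)) (v i + \<tau>0) (v (\<sigma> i))" for i
    proof -
      have "path_connected (V (\<sigma> i))" unfolding V_def by (rule path_connected_path_component)
      thus ?thesis using VV[OF v_in_V] v_in_V unfolding path_connected_component by blast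
    qed
    have "Im (v (\<sigma> k)) < Im (v (\<sigma> j))"
    proof (rule vertical_order_invariant[OF V_disjoint pc pc])
      show "Re (v j + \<tau>0) = Re (v k + \<tau>0)" "Re (v (\<sigma> j)) = Re (v (\<sigma> k))" by (simp_all add: Re_v)
      show "Im (v k + \<tau>0) < Im (v j + \<tau>0)" using v_mono[OF that] by simp
    qed (use ne VV in \<open>auto intro: reaches_left_translation[OF V_left] reaches_right_translation[OF V_right] V_left\<close>)
    thus ?thesis using v_mono[of "\<sigma> j" "\<sigma> k"] ne by (meson not_less_iff_gr_or_eq)
  qed
  have per: "\<sigma> (k + int n) = \<sigma> k + int n" for k
  proof -
    have vs: "v (k + int n) = v k + of_int 1 * (2 * pi * \<i>)" for k using v_shift[of k 1] by simp
    have "path_component E (v k + \<tau>0 + of_int 1 * (2 * pi * \<i>)) (v (\<sigma> k) + of_int 1 * (2 * pi * \<i>))" by (rule trP[OF sig(2)])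
    hence "path_component E (v (k + int n) + \<tau>0) (v (\<sigma> k + int n))" unfolding vs by (simp add: algebra_simps)
    thus ?thesis using sig(2)[of "k + int n"] same_V path_component_trans path_component_sym by metis
  qed
  have s: "\<sigma> k = \<sigma> 0 + k" for k by (rule strict_mono_periodic_int[of \<sigma> n k, OF mono per n])
  have "\<sigma> 0 mod int n = p' mod int n" using sig(1)[of 0] by simp
  then obtain c where c: "\<sigma> 0 = p' + c * int n" by (metis mod_eqE mult.commute)
  define \<tau> where "\<tau> = \<tau>0 - of_int c * (2 * pi * \<i>)"
  have e: "exp \<tau> = l" using t0 exp_plus_2pin[of \<tau>0 "- c"] by (simp add: \<tau>_def mult_ac)
  have tv: "path_component E (v k + \<tau>) (v (k + p'))" for k
  proof -
    have "path_component E (v k + \<tau>0 + of_int (- c) * (2 * pi * \<i>)) (v (\<sigma> k) + of_int (- c) * (2 * pi * \<i>))"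
      by (rule trP[OF sig(2)])
    also have "v (\<sigma> k) + of_int (- c) * (2 * pi * \<i>) = v (k + p')"
      unfolding v_shift[symmetric] using s[of k] c by (simp add: algebra_simps)
    finally show ?thesis by (simp add: \<tau>_def algebra_simps)
  qed
  have shiftV: "z \<in> V k \<longleftrightarrow> z + d \<in> V k'"
    if "\<And>z. z + d \<in> E \<longleftrightarrow> z \<in> E" "path_component E (v k + d) (v k')" for z d k k'
  proof
    assume "z \<in> V k"
    hence "path_component E (v k + d) (z + d)"
      unfolding V_def by (intro path_component_translation[of E]) (auto simp: that(1))
    thus "z + d \<in> V k'" using that(2) unfolding V_def by (blast intro: path_component_trans path_component_sym)
  next
    assume "z + d \<in> V k'"
    hence "path_component E (v k + d) (z + d)" using that(2) unfolding V_def by (blast intro: path_component_trans)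
    hence "path_component E (v k + d + (- d)) (z + d + (- d))"
      by (rule path_component_translation) (use that(1)[of "_ - d"] in simp)
    thus "z \<in> V k" by (simp add: V_def)
  qed
  show ?thesis
  proof (rule that[OF e])
    show "z \<in> V k \<longleftrightarrow> z + \<tau> \<in> V (k + p')" for z k
      by (rule shiftV[OF E_log[OF e] tv])
    show "z \<in> V k \<longleftrightarrow> z + 2 * pi * \<i> \<in> V (k + int n)" for z k
    proof (rule shiftV)
      show "z + 2 * pi * \<i> \<in> E \<longleftrightarrow> z \<in> E" for z using E_period[of z 1] by simp
      show "path_component E (v k + 2 * pi * \<i>) (v (k + int n))"
        using v_shift[of k 1] v_in_E[of "k + int n"] by (simp add: path_component_refl)
    qed
  qed
qed

end

section \<open>The Green function on the unstable manifold\<close>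

abbreviation lastc :: "(complex, 'n :: {finite, linorder}) vec \<Rightarrow> complex" where
  "lastc z \<equiv> z $ Max UNIV"

text \<open>  For large \<open>R\<close> the maps send the closed cone into the open one, and an orbit that never enters it is bounded.\<close>

definition escape_cone :: "real \<Rightarrow> (complex, 'n :: {finite, linorder}) vec set" where
  "escape_cone R = {z. R < cmod (lastc z) \<and> (\<forall>i. i \<noteq> Max UNIV \<longrightarrow> cmod (z $ i) < cmod (lastc z))}"

definition escape_cone_closed :: "real \<Rightarrow> (complex, 'n :: {finite, linorder}) vec set" where
  "escape_cone_closed R = {z. R \<le> cmod (lastc z) \<and> (\<forall>i. cmod (z $ i) \<le> cmod (lastc z))}"

lemma escape_cone_subset: "escape_cone R \<subseteq> escape_cone_closed R"
  unfolding escape_cone_def escape_cone_closed_def by (auto, metis less_imp_le order_refl)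

lemma open_escape_cone: "open (escape_cone R :: (complex, 'n :: {finite, linorder}) vec set)"
proof -
  have "escape_cone R = {z::(complex, 'n) vec. R < cmod (lastc z)} \<inter> (\<Inter>i\<in>{i. i \<noteq> Max UNIV}. {z. cmod (z $ i) < cmod (lastc z)})"
    by (auto simp: escape_cone_def)
  thus ?thesis by (auto intro!: open_Int open_INT open_Collect_less continuous_intros)
qed

lemma closed_escape_cone: "closed (escape_cone_closed R :: (complex, 'n :: {finite, linorder}) vec set)"
proof -
  have "escape_cone_closed R = {z::(complex, 'n) vec. R \<le> cmod (lastc z)} \<inter> (\<Inter>i. {z. cmod (z $ i) \<le> cmod (lastc z)})"
    by (auto simp: escape_cone_closed_def)
  thus ?thesis by (auto intro!: closed_Int closed_INT closed_Collect_le continuous_intros)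
qed

lemma lastc_shift_map: "lastc (shift_map \<alpha> P z) = \<alpha> * z $ Min UNIV + poly P (lastc z)"
  by (simp add: shift_map_def)

lemma continuous_shift_map: "continuous_on S (shift_map \<alpha> P)"
  unfolding shift_map_def[abs_def]
proof (rule continuous_on_vec_lambda)
  fix i :: 'a
  show "continuous_on S (\<lambda>z. if i = Max UNIV then \<alpha> * z $ Min UNIV + poly P (lastc z) else z $ Min {i<..})"
    by (cases "i = Max UNIV") (auto intro!: continuous_intros)
qed

lemma continuous_shift_comp: "continuous_on S (shift_comp \<alpha> P m)"
proof (induction m)
  case (Suc m)
  show ?case unfolding shift_comp.simps by (intro continuous_on_compose Suc continuous_shift_map)
qed (simp add: id_def)

lemma shift_ratio:
  fixes P :: "complex poly"
  assumes d: "degree P \<ge> 2" and e: "\<epsilon> > 0"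
  obtains R where "R \<ge> 1" "\<And>w x. R \<le> cmod w \<Longrightarrow> cmod x \<le> cmod w \<Longrightarrow>
      cmod ((\<alpha> * x + poly P w) / (lead_coeff P * w ^ degree P) - 1) < \<epsilon> \<and> 2 * cmod w \<le> cmod (\<alpha> * x + poly P w)"
proof -
  define c where "c = lead_coeff P"
  have c: "c \<noteq> 0" using d by (auto simp: c_def)
  define \<delta> where "\<delta> = min \<epsilon> (1/2)"
  have del: "\<delta> > 0" "\<delta> \<le> \<epsilon>" "\<delta> \<le> 1/2" using e by (auto simp: \<delta>_def)
  have "((\<lambda>w. poly P w / w ^ degree P) \<longlongrightarrow> c) at_infinity"
    unfolding c_def by (rule poly_divide_tendsto_aux)
  hence "\<forall>\<^sub>F w in at_infinity. dist (poly P w / w ^ degree P) c < cmod c * (\<delta> / 2)"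
    using c del by (intro tendstoD) auto
  then obtain b where b: "\<And>w. b \<le> cmod w \<Longrightarrow> dist (poly P w / w ^ degree P) c < cmod c * (\<delta> / 2)"
    unfolding eventually_at_infinity by blast
  define R where "R = Max {1, b, 4 / cmod c, 2 * cmod \<alpha> / (cmod c * \<delta>) + 1}"
  have R: "1 \<le> R" "b \<le> R" "4 / cmod c \<le> R" "2 * cmod \<alpha> / (cmod c * \<delta>) + 1 \<le> R" by (auto simp: R_def)
  show ?thesis
  proof (rule that[OF R(1)], intro conjI)
    fix w x assume w: "R \<le> cmod w" and x: "cmod x \<le> cmod w"
    define W where "W = w ^ degree P"
    have w1: "1 \<le> cmod w" using R w by linarith
    have W0: "W \<noteq> 0" using w1 by (auto simp: W_def)
    have W2: "cmod w * cmod w \<le> cmod W"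
      using power_increasing[OF d w1] by (simp add: W_def norm_power power2_eq_square)
    have Wx: "cmod x * cmod w \<le> cmod W" using x W2 mult_right_mono[OF x, of "cmod w"] by simp
    have "cmod (\<alpha> * x) * cmod w \<le> cmod \<alpha> * cmod W"
      using mult_left_mono[OF Wx, of "cmod \<alpha>"] by (simp add: norm_mult mult.assoc)
    moreover have "2 * cmod \<alpha> < cmod w * (cmod c * \<delta>)"
    proof -
      have "2 * cmod \<alpha> / (cmod c * \<delta>) < cmod w" using R(4) w by linarith
      thus ?thesis using c del by (simp add: pos_divide_less_eq)
    qed
    hence "2 * cmod \<alpha> * cmod W < cmod w * (cmod c * \<delta>) * cmod W"
      using W0 by (intro mult_strict_right_mono) auto
    ultimately have "2 * (cmod (\<alpha> * x) * cmod w) < cmod w * (cmod c * \<delta>) * cmod W" by linarith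
    hence "cmod w * (2 * cmod (\<alpha> * x)) < cmod w * (cmod c * \<delta> * cmod W)" by (simp add: mult_ac)
    hence t1: "cmod (\<alpha> * x) < cmod c * (\<delta> / 2) * cmod W" using w1 by (simp add: mult_less_cancel_left)
    have "cmod (poly P w / W - c) < cmod c * (\<delta> / 2)" using b[of w] R w by (simp add: W_def dist_norm)
    hence "cmod (poly P w / W - c) * cmod W < cmod c * (\<delta> / 2) * cmod W" using W0 by (intro mult_strict_right_mono) auto
    moreover have "(poly P w / W - c) * W = poly P w - c * W" using W0 by (simp add: left_diff_distrib)
    ultimately have t2: "cmod (poly P w - c * W) < cmod c * (\<delta> / 2) * cmod W" by (metis norm_mult)
    have "cmod ((\<alpha> * x + poly P w) - c * W) \<le> cmod (\<alpha> * x) + cmod (poly P w - c * W)"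
      using norm_triangle_ineq[of "\<alpha> * x" "poly P w - c * W"] by (simp add: algebra_simps)
    moreover have "\<delta> * cmod (c * W) = cmod c * (\<delta> / 2) * cmod W + cmod c * (\<delta> / 2) * cmod W" by (simp add: norm_mult)
    ultimately have t3: "cmod ((\<alpha> * x + poly P w) - c * W) < \<delta> * cmod (c * W)"
      using t1 t2 by linarith
    have "cmod ((\<alpha> * x + poly P w) / (c * W) - 1) * cmod (c * W) = cmod ((\<alpha> * x + poly P w) - c * W)"
    proof -
      have "((\<alpha> * x + poly P w) / (c * W) - 1) * (c * W) = (\<alpha> * x + poly P w) - c * W"
        using c W0 by (simp add: left_diff_distrib)
      thus ?thesis by (metis norm_mult)
    qed
    hence "cmod ((\<alpha> * x + poly P w) / (c * W) - 1) * cmod (c * W) < \<delta> * cmod (c * W)" using t3 by simp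
    hence "cmod ((\<alpha> * x + poly P w) / (c * W) - 1) < \<delta>" by (rule mult_right_less_imp_less) simp
    thus "cmod ((\<alpha> * x + poly P w) / (lead_coeff P * w ^ degree P) - 1) < \<epsilon>"
      using del by (simp add: c_def W_def)
    have "\<delta> * cmod (c * W) \<le> 1/2 * cmod (c * W)" using del by (intro mult_right_mono) auto
    hence "cmod (c * W) / 2 \<le> cmod (\<alpha> * x + poly P w)"
      using t3 norm_triangle_ineq2[of "c * W" "\<alpha> * x + poly P w"] by (simp add: norm_minus_commute)
    moreover have "4 * cmod w \<le> cmod (c * W)"
    proof -
      have "4 / cmod c \<le> cmod w" using R(3) w by linarith
      hence "4 \<le> cmod c * cmod w" using c by (simp add: pos_divide_le_eq mult.commute)
      hence "4 * cmod w \<le> cmod c * cmod w * cmod w" by (intro mult_right_mono) auto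
      also have "\<dots> \<le> cmod c * cmod W" using W2 by (simp add: mult.assoc mult_left_mono)
      finally show ?thesis by (simp add: norm_mult)
    qed
    ultimately show "2 * cmod w \<le> cmod (\<alpha> * x + poly P w)" by linarith
  qed
qed

lemma shift_map_cone:
  fixes z :: "(complex, 'n :: {finite, linorder}) vec"
  assumes "R \<ge> 1" "z \<in> escape_cone_closed R" "2 * cmod (lastc z) \<le> cmod (lastc (shift_map \<alpha> P z))"
  shows "shift_map \<alpha> P z \<in> escape_cone R"
proof -
  have z: "R \<le> cmod (lastc z)" "\<And>i. cmod (z $ i) \<le> cmod (lastc z)"
    using assms(2) by (auto simp: escape_cone_closed_def)
  have gt: "cmod (lastc z) < cmod (lastc (shift_map \<alpha> P z))" using assms(1,3) z(1) by linarith
  have "cmod (shift_map \<alpha> P z $ i) < cmod (lastc (shift_map \<alpha> P z))" if "i \<noteq> Max UNIV" for i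
    using that z(2)[of "Min {i<..}"] gt by (simp add: shift_map_def[of \<alpha> P z, THEN arg_cong[where f="\<lambda>v. vec_nth v i"]])
  thus ?thesis using z(1) gt by (auto simp: escape_cone_def)
qed

text \<open>  All coordinates of the image but the last are coordinates of \<open>z\<close>, and the last one can exceed them, and \<open>R\<close>,
  only by being dominant.\<close>

lemma shift_map_bounded:
  fixes z :: "(complex, 'n :: {finite, linorder}) vec"
  assumes "R \<le> M" "\<And>i. cmod (z $ i) \<le> M" "shift_map \<alpha> P z \<notin> escape_cone R"
  shows "cmod (shift_map \<alpha> P z $ i) \<le> M"
proof -
  have le: "cmod (shift_map \<alpha> P z $ i) \<le> M" if "i \<noteq> Max UNIV" for i
    using assms(2)[of "Min {i<..}"] that by (simp add: shift_map_def[of \<alpha> P z, THEN arg_cong[where f="\<lambda>v. vec_nth v i"]])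
  have "cmod (lastc (shift_map \<alpha> P z)) \<le> M"
  proof (rule ccontr)
    assume "\<not> cmod (lastc (shift_map \<alpha> P z)) \<le> M"
    hence "shift_map \<alpha> P z \<in> escape_cone R"
      using le assms(1) by (force simp: escape_cone_def)
    thus False using assms(3) by blast
  qed
  thus ?thesis using le by (cases "i = Max UNIV") auto
qed

lemma near_one_mult_power:
  assumes "\<epsilon> > 0"
  obtains \<delta> where "\<delta> > 0" "\<And>x y :: complex. cmod (x - 1) < \<delta> \<Longrightarrow> cmod (y - 1) < \<delta> \<Longrightarrow> cmod (x * y ^ k - 1) < \<epsilon>"
proof -
  have "isCont (\<lambda>p::complex \<times> complex. fst p * snd p ^ k) (1, 1)" by (intro continuous_intros)
  then obtain e where e: "e > 0" "\<And>p. dist p (1, 1) < e \<Longrightarrow> dist (fst p * snd p ^ k) (1::complex) < \<epsilon>"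
    using assms unfolding continuous_at_eps_delta by force
  show ?thesis
  proof (rule that[of "e / 2"])
    fix x y :: complex assume "cmod (x - 1) < e / 2" "cmod (y - 1) < e / 2"
    moreover have "dist (x, y) (1, 1) \<le> dist x 1 + dist y 1"
      unfolding dist_Pair_Pair by (rule sqrt_sum_squares_le_sum) auto
    ultimately have "dist (x, y) (1, 1) < e" by (simp add: dist_norm)
    thus "cmod (x * y ^ k - 1) < \<epsilon>" using e(2)[of "(x, y)"] by (simp add: dist_norm)
  qed (use e in simp)
qed

text \<open>  The map \<open>F\<close> is meant to be a composition of \<open>m\<close> shift maps; for \<open>m = 0\<close> it only preserves the closed cone.\<close>

definition escape_estimate ::
  "nat \<Rightarrow> ((complex, 'n :: {finite, linorder}) vec \<Rightarrow> (complex, 'n) vec) \<Rightarrow> complex \<Rightarrow> nat \<Rightarrow> real \<Rightarrow> real \<Rightarrow> bool"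
where
  "escape_estimate m F C D \<epsilon> R \<longleftrightarrow>
     (\<forall>z\<in>escape_cone_closed R. F z \<in> escape_cone_closed R \<and> (m > 0 \<longrightarrow> F z \<in> escape_cone R) \<and>
        2 ^ m * cmod (lastc z) \<le> cmod (lastc (F z)) \<and> cmod (lastc (F z) / (C * lastc z ^ D) - 1) < \<epsilon>) \<and>
     (\<forall>z. \<forall>M\<ge>R. (\<forall>i. cmod (z $ i) \<le> M) \<longrightarrow> F z \<notin> escape_cone R \<longrightarrow> (\<forall>i. cmod (F z $ i) \<le> M))"

text \<open>  In the cone the composition acts on the last coordinate like \<open>C x ^ d\<close> up to a factor close to 1, where \<open>d\<close> is the
  product of the degrees; and as long as the cone is avoided, the coordinates keep every bound \<open>M \<ge> R\<close>. The
  ratio has to be made arbitrarily close to 1 in the induction, because later maps raise it to a power.\<close>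

lemma shift_comp_escape:
  fixes \<alpha> :: "nat \<Rightarrow> complex" and P :: "nat \<Rightarrow> complex poly"
  assumes deg: "\<And>i. i \<in> {1..m} \<Longrightarrow> degree (P i) \<ge> 2"
  shows "\<exists>C. C \<noteq> 0 \<and> (\<forall>\<epsilon>>0. \<exists>R0\<ge>1. \<forall>R\<ge>R0.
    escape_estimate m (shift_comp \<alpha> P m :: (complex, 'n :: {finite, linorder}) vec \<Rightarrow> _) C (\<Prod>i=1..m. degree (P i)) \<epsilon> R)"
  using deg
proof (induction m)
  case 0
  show ?case
  proof (intro exI[of _ 1] conjI allI impI)
    fix \<epsilon> R :: real assume e: "\<epsilon> > 0" and R: "1 \<le> R"
    have "cmod (lastc z / (1 * lastc z ^ 1) - 1) < \<epsilon>" if "z \<in> escape_cone_closed R" for z :: "(complex, 'n) vec"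
    proof -
      have "lastc z \<noteq> 0" using that R by (auto simp: escape_cone_closed_def)
      thus ?thesis using e by simp
    qed
    thus "escape_estimate 0 (shift_comp \<alpha> P 0 :: (complex, 'n) vec \<Rightarrow> _) 1 (\<Prod>i=1..0. degree (P i)) \<epsilon> R"
      by (simp add: escape_estimate_def)
  qed simp_all
next
  case (Suc m)
  define D where "D = (\<Prod>i=1..m. degree (P i))"
  define Q where "Q = P (Suc m)"
  define k where "k = degree Q"
  define c where "c = lead_coeff Q"
  have k2: "degree Q \<ge> 2" using Suc.prems[of "Suc m"] by (simp add: Q_def)
  have c0: "c \<noteq> 0" using k2 by (auto simp: c_def)
  have D': "(\<Prod>i=1..Suc m. degree (P i)) = D * k" by (simp add: D_def k_def Q_def)
  obtain C where C: "C \<noteq> 0" and IH: "\<And>\<epsilon>. \<epsilon> > 0 \<Longrightarrow>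
      \<exists>R0\<ge>1. \<forall>R\<ge>R0. escape_estimate m (shift_comp \<alpha> P m :: (complex, 'n) vec \<Rightarrow> _) C D \<epsilon> R"
    using Suc.IH Suc.prems unfolding D_def by (metis (no_types, lifting) atLeastAtMost_iff le_Suc_eq)
  show ?case
  proof (rule exI[of _ "c * C ^ k"], intro conjI allI impI)
    show "c * C ^ k \<noteq> 0" using c0 C by simp
    fix \<epsilon> :: real assume "\<epsilon> > 0"
    then obtain \<delta> where del: "\<delta> > 0" "\<And>x y :: complex. cmod (x - 1) < \<delta> \<Longrightarrow> cmod (y - 1) < \<delta> \<Longrightarrow> cmod (x * y ^ k - 1) < \<epsilon>"
      using near_one_mult_power by metis
    obtain R1 where R1: "R1 \<ge> 1" "\<And>w x. R1 \<le> cmod w \<Longrightarrow> cmod x \<le> cmod w \<Longrightarrow>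
      cmod ((\<alpha> (Suc m) * x + poly Q w) / (c * w ^ k) - 1) < \<delta> \<and> 2 * cmod w \<le> cmod (\<alpha> (Suc m) * x + poly Q w)"
      using shift_ratio[OF k2 del(1)] unfolding c_def k_def by metis
    obtain R2 where R2: "R2 \<ge> 1" "\<And>R. R \<ge> R2 \<Longrightarrow> escape_estimate m (shift_comp \<alpha> P m :: (complex, 'n) vec \<Rightarrow> _) C D \<delta> R"
      using IH[OF del(1)] by metis
    have stp: "shift_map (\<alpha> (Suc m)) Q y \<in> escape_cone R \<and> 2 * cmod (lastc y) \<le> cmod (lastc (shift_map (\<alpha> (Suc m)) Q y)) \<and>
        cmod (lastc (shift_map (\<alpha> (Suc m)) Q y) / (c * lastc y ^ k) - 1) < \<delta>"
      if y: "y \<in> escape_cone_closed R" and R: "R \<ge> R1" for R and y :: "(complex, 'n) vec"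
    proof -
      have "R1 \<le> cmod (lastc y)" "cmod (y $ Min UNIV) \<le> cmod (lastc y)" using y R by (auto simp: escape_cone_closed_def)
      note r = R1(2)[OF this, folded lastc_shift_map]
      have "1 \<le> R" using R R1(1) by linarith
      thus ?thesis using r shift_map_cone[OF _ y] by blast
    qed
    have "escape_estimate (Suc m) (shift_comp \<alpha> P (Suc m) :: (complex, 'n) vec \<Rightarrow> _) (c * C ^ k) (D * k) \<epsilon> R"
      if "max R1 R2 \<le> R" for R
      unfolding escape_estimate_def
    proof (intro conjI ballI allI impI)
      have R: "R1 \<le> R" "R2 \<le> R" using that by auto
      note est = R2(2)[OF R(2), unfolded escape_estimate_def]
      fix z :: "(complex, 'n) vec"
      define y where "y = shift_comp \<alpha> P m z"
      have sy: "shift_comp \<alpha> P (Suc m) z = shift_map (\<alpha> (Suc m)) Q y" by (simp add: y_def Q_def)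
      {
        assume z: "z \<in> escape_cone_closed R"
        have y: "y \<in> escape_cone_closed R" "2 ^ m * cmod (lastc z) \<le> cmod (lastc y)"
          "cmod (lastc y / (C * lastc z ^ D) - 1) < \<delta>" using est z unfolding y_def by blast+
        note s = stp[OF y(1) R(1)]
        show "shift_comp \<alpha> P (Suc m) z \<in> escape_cone_closed R" "shift_comp \<alpha> P (Suc m) z \<in> escape_cone R"
          unfolding sy using s escape_cone_subset by blast+
        have "2 ^ Suc m * cmod (lastc z) \<le> 2 * cmod (lastc y)" using y(2) by simp
        thus "2 ^ Suc m * cmod (lastc z) \<le> cmod (lastc (shift_comp \<alpha> P (Suc m) z))"
          unfolding sy using s by linarith
        have y0: "lastc y \<noteq> 0" using y(1) R R1(1) by (auto simp: escape_cone_closed_def)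
        define X where "X = lastc (shift_map (\<alpha> (Suc m)) Q y)"
        have "cmod ((X / (c * lastc y ^ k)) * (lastc y / (C * lastc z ^ D)) ^ k - 1) < \<epsilon>"
          by (rule del(2)) (use s y X_def in blast)+
        also have "(X / (c * lastc y ^ k)) * (lastc y / (C * lastc z ^ D)) ^ k = X / (c * C ^ k * lastc z ^ (D * k))"
          using y0 by (simp add: power_divide power_mult_distrib power_mult)
        finally show "cmod (lastc (shift_comp \<alpha> P (Suc m) z) / (c * C ^ k * lastc z ^ (D * k)) - 1) < \<epsilon>"
          unfolding sy X_def .
      }
      {
        fix M i assume M: "R \<le> M" "\<forall>i. cmod (z $ i) \<le> M" "shift_comp \<alpha> P (Suc m) z \<notin> escape_cone R"
        have "y \<notin> escape_cone R" using stp[OF _ R(1), of y] escape_cone_subset M(3) unfolding sy by blast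
        hence yM: "\<And>i. cmod (y $ i) \<le> M" using est M(1,2) unfolding y_def by blast
        show "cmod (shift_comp \<alpha> P (Suc m) z $ i) \<le> M"
          unfolding sy by (rule shift_map_bounded[OF M(1) yM]) (use M(3) sy in simp)
      }
    qed
    thus "\<exists>R0\<ge>1. \<forall>R\<ge>R0. escape_estimate (Suc m) (shift_comp \<alpha> P (Suc m) :: (complex, 'n) vec \<Rightarrow> _)
        (c * C ^ k) (\<Prod>i=1..Suc m. degree (P i)) \<epsilon> R"
      unfolding D' using R1(1) by (intro exI[of _ "max R1 R2"]) auto
  qed
qed

lemma norm_le_sum_coords: "norm (z :: complex ^ 'n) \<le> (\<Sum>i\<in>UNIV. cmod (z $ i))"
  unfolding norm_vec_def by (rule L2_set_le_sum) simp

text \<open>  The size of \<open>R\<close> ensures that the logarithm of the last coordinate, which is at least \<open>ln R\<close>, outweighs all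
  later corrections, so that the Green function is positive as soon as the cone is reached.\<close>

locale escaping =
  fixes F :: "(complex, 'n :: {finite, linorder}) vec \<Rightarrow> (complex, 'n) vec" and C l :: complex and R :: real and d :: nat
    and H :: "complex \<Rightarrow> (complex, 'n) vec"
  assumes contF: "continuous_on UNIV F" and C: "C \<noteq> 0" and d: "d \<ge> 2" and R: "R \<ge> 1" "\<bar>ln (cmod C)\<bar> + 1 < ln R"
    and cone: "\<And>z. z \<in> escape_cone_closed R \<Longrightarrow> F z \<in> escape_cone R"
    and double: "\<And>z. z \<in> escape_cone_closed R \<Longrightarrow> 2 * cmod (lastc z) \<le> cmod (lastc (F z))"
    and ratio: "\<And>z. z \<in> escape_cone_closed R \<Longrightarrow> cmod (lastc (F z) / (C * lastc z ^ d) - 1) < 1/2"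
    and stay: "\<And>z M. R \<le> M \<Longrightarrow> (\<And>i. cmod (z $ i) \<le> M) \<Longrightarrow> F z \<notin> escape_cone R \<Longrightarrow> (\<forall>i. cmod (F z $ i) \<le> M)"
    and holH: "\<And>i. (\<lambda>t. H t $ i) holomorphic_on UNIV"
    and conj: "\<And>t. F (H t) = H (l * t)"
begin

lemma contH: "continuous_on S H"
proof -
  have "continuous_on S (\<lambda>t. \<chi> i. H t $ i)"
    by (intro continuous_on_vec_lambda continuous_on_subset[OF holomorphic_on_imp_continuous_on[OF holH]]) auto
  thus ?thesis by simp
qed

lemma F_iter: "(F ^^ j) (H t) = H (l ^ j * t)"
  by (induction j) (auto simp: conj mult.assoc)

text \<open>  The last coordinate of the \<open>j\<close>-th point of the orbit of \<open>H t\<close>, and the set of parameters whose orbit has entered the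
  cone by time \<open>j\<close>.\<close>

definition f where "f j t = lastc (H (l ^ j * t))"
definition Es where "Es j = {t. H (l ^ j * t) \<in> escape_cone R}"

lemma cone': "z \<in> escape_cone R \<Longrightarrow> F z \<in> escape_cone R"
  using cone escape_cone_subset by blast

lemma Es_Suc: "t \<in> Es j \<Longrightarrow> t \<in> Es (Suc j)"
  using cone'[of "H (l ^ j * t)"] by (simp add: Es_def conj mult.assoc)

lemma Es_mono: "j \<le> k \<Longrightarrow> t \<in> Es j \<Longrightarrow> t \<in> Es k"
  by (induction rule: dec_induct) (auto intro: Es_Suc)

lemma open_Es: "open (Es j)"
proof -
  have "Es j = (\<lambda>t. H (l ^ j * t)) -` escape_cone R" by (auto simp: Es_def)
  moreover have "continuous_on UNIV (\<lambda>t. H (l ^ j * t))"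
    by (rule continuous_on_compose2[OF contH[of UNIV]]) (auto intro!: continuous_intros)
  ultimately show ?thesis using open_vimage[OF open_escape_cone] by metis
qed

lemma f_holo: "f j holomorphic_on S"
proof -
  have "((\<lambda>t. H t $ Max UNIV) \<circ> (\<lambda>t. l ^ j * t)) holomorphic_on S"
    by (rule holomorphic_on_compose_gen[OF _ holH]) (auto intro!: holomorphic_intros)
  thus ?thesis by (simp add: f_def[abs_def] o_def)
qed

lemma f_gt: "t \<in> Es j \<Longrightarrow> R < cmod (f j t)"
  by (simp add: Es_def f_def escape_cone_def)

lemma f_nz: "t \<in> Es j \<Longrightarrow> f j t \<noteq> 0"
  using f_gt[of t j] R by auto

definition \<phi> where "\<phi> j t = f (Suc j) t / (C * f j t ^ d)"

lemma phi: "t \<in> Es j \<Longrightarrow> cmod (\<phi> j t - 1) < 1/2"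
  using ratio[of "H (l ^ j * t)"] escape_cone_subset by (auto simp: Es_def \<phi>_def f_def conj mult.assoc)

lemma Ln_phi: "t \<in> Es j \<Longrightarrow> cmod (Ln (\<phi> j t)) \<le> 1" "t \<in> Es j \<Longrightarrow> \<phi> j t \<notin> \<real>\<^sub>\<le>\<^sub>0"
proof -
  assume t: "t \<in> Es j"
  show "cmod (Ln (\<phi> j t)) \<le> 1" using norm_Ln_le[OF phi[OF t]] phi[OF t] by simp
  show "\<phi> j t \<notin> \<real>\<^sub>\<le>\<^sub>0"
  proof
    assume "\<phi> j t \<in> \<real>\<^sub>\<le>\<^sub>0"
    hence "Re (\<phi> j t) \<le> 0" by (simp add: complex_nonpos_Reals_iff)
    thus False using phi[OF t] abs_Re_le_cmod[of "\<phi> j t - 1"] by simp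
  qed
qed

definition K where "K = \<bar>ln (cmod C)\<bar> + 1"
definition u where "u j t = ln (cmod (f j t)) / d ^ j"

lemma K_pos: "K > 0" by (simp add: K_def)

lemma u_step: assumes "t \<in> Es j" shows "\<bar>u (Suc j) t - u j t\<bar> \<le> K / d ^ Suc j"
proof -
  have nz: "f j t \<noteq> 0" "f (Suc j) t \<noteq> 0" using f_nz Es_Suc assms by blast+
  have p0: "\<phi> j t \<noteq> 0" using nz C by (simp add: \<phi>_def)
  have d0: "real d > 0" using d by simp
  have "f (Suc j) t = C * f j t ^ d * \<phi> j t" using nz C by (simp add: \<phi>_def)
  hence "ln (cmod (f (Suc j) t)) = ln (cmod C) + real d * ln (cmod (f j t)) + ln (cmod (\<phi> j t))"
    using nz C p0 by (simp add: norm_mult norm_power ln_mult_pos ln_realpow)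
  hence "u (Suc j) t - u j t = (ln (cmod C) + ln (cmod (\<phi> j t))) / d ^ Suc j"
    using d0 by (simp add: u_def field_simps)
  moreover have "\<bar>ln (cmod (\<phi> j t))\<bar> \<le> 1"
    using Ln_phi(1)[OF assms] abs_Re_le_cmod[of "Ln (\<phi> j t)"] p0 by simp
  hence "\<bar>ln (cmod C) + ln (cmod (\<phi> j t))\<bar> \<le> K" by (simp add: K_def)
  ultimately show ?thesis using d0 by (simp add: divide_right_mono)
qed

lemma u_dist: assumes "t \<in> Es j" shows "\<bar>u (j + k) t - u j t\<bar> \<le> K / d ^ j * (1 - 1 / 2 ^ k)"
proof (induction k)
  case (Suc k)
  have "t \<in> Es (j + k)" using Es_mono[OF _ assms] by simp
  hence "\<bar>u (Suc (j + k)) t - u (j + k) t\<bar> \<le> K / d ^ Suc (j + k)" by (rule u_step)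
  also have "K / d ^ Suc (j + k) = K / d ^ j * (1 / d ^ Suc k)" by (simp add: power_add)
  also have "\<dots> \<le> K / d ^ j * (1 / 2 ^ Suc k)"
  proof (intro mult_left_mono divide_left_mono)
    have "(2::real) ^ Suc k \<le> real d ^ Suc k" using d by (intro power_mono) auto
    thus "(2::real) ^ Suc k \<le> real (d ^ Suc k)" by simp
  qed (use K_pos d in auto)
  finally have "\<bar>u (j + Suc k) t - u j t\<bar> \<le> K / d ^ j * (1 - 1 / 2 ^ k) + K / d ^ j * (1 / 2 ^ Suc k)"
    using Suc by simp
  also have "\<dots> = K / d ^ j * (1 - 1 / 2 ^ Suc k)"
    unfolding distrib_left[symmetric] by (rule arg_cong[where f = "\<lambda>x. K / d ^ j * x"]) (simp add: field_simps)
  finally show ?case .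
qed simp

text \<open>  Near a point of \<open>Es j\<close> the functions \<open>u (j + k)\<close> are the real parts of holomorphic functions \<open>\<Psi> k\<close>. Consecutive ones differ by
  \<open>(Ln C + Ln \<phi>) / d ^ (j + k + 1)\<close>, with the principal logarithm of a function \<open>\<phi>\<close> close to 1, so they converge
  uniformly.\<close>

lemma local_log:
  assumes "t \<in> Es j"
  obtains e \<Phi> where "e > 0" "ball t e \<subseteq> Es j" "\<Phi> holomorphic_on ball t e"
    "\<And>s. s \<in> ball t e \<Longrightarrow> (\<lambda>k. u k s) \<longlonglongrightarrow> Re (\<Phi> s)"
proof -
  obtain e where e: "e > 0" "ball t e \<subseteq> Es j" using open_Es assms open_contains_ball by blast
  define B where "B = ball t e"
  have B: "s \<in> Es (j + k)" if "s \<in> B" for s k using Es_mono[of j "j + k" s] e that by (auto simp: B_def)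
  have "convex B" by (simp add: B_def)
  obtain h where h: "h holomorphic_on B" "\<And>s. s \<in> B \<Longrightarrow> f j s = exp (h s)"
    by (rule contractible_imp_holomorphic_log[OF f_holo convex_imp_contractible[OF \<open>convex B\<close>]])
       (use B[of _ 0] f_nz in auto)
  define T where "T i s = (Ln C + Ln (\<phi> (j + i) s)) / of_nat d ^ (Suc (j + i))" for i s
  define \<Psi> where "\<Psi> k s = h s / of_nat d ^ j + (\<Sum>i<k. T i s)" for k s
  have d0: "(of_nat d :: complex) \<noteq> 0" "real d > 0" using d by auto
  have hphi: "\<phi> i holomorphic_on B" if "i \<ge> j" for i
    unfolding \<phi>_def[abs_def] using B[of _ "i - j"] that f_nz C
    by (intro holomorphic_intros f_holo) auto
  have hT: "T i holomorphic_on B" for i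
    unfolding T_def[abs_def] using Ln_phi(2) B d0 by (intro holomorphic_intros hphi) auto
  have hPsi: "\<Psi> k holomorphic_on B" for k
    unfolding \<Psi>_def[abs_def] using d0 by (intro holomorphic_intros hT h) auto
  have Re_Psi: "Re (\<Psi> k s) = u (j + k) s" if s: "s \<in> B" for k s
  proof -
    have ex: "exp (of_nat d ^ (j + k) * \<Psi> k s) = f (j + k) s"
    proof (induction k)
      case 0 thus ?case using h(2)[OF s] d0 by (simp add: \<Psi>_def)
    next
      case (Suc k)
      have nz: "f (j + k) s \<noteq> 0" "f (Suc (j + k)) s \<noteq> 0" using f_nz B[OF s] B[OF s, of "Suc k"] by auto
      have "of_nat d ^ (j + Suc k) * \<Psi> (Suc k) s = of_nat d * (of_nat d ^ (j + k) * \<Psi> k s) + (Ln C + Ln (\<phi> (j + k) s))"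
      proof -
        have "of_nat d ^ (j + Suc k) * T k s = Ln C + Ln (\<phi> (j + k) s)" using d0 by (simp add: T_def)
        moreover have "\<Psi> (Suc k) s = \<Psi> k s + T k s" by (simp add: \<Psi>_def)
        ultimately show ?thesis by (simp add: distrib_left mult.assoc)
      qed
      hence "exp (of_nat d ^ (j + Suc k) * \<Psi> (Suc k) s) = f (j + k) s ^ d * (C * \<phi> (j + k) s)"
        using Suc C nz by (simp add: exp_add exp_of_nat_mult \<phi>_def)
      thus ?case using nz C by (simp add: \<phi>_def)
    qed
    have "cmod (f (j + k) s) = exp (Re (of_nat d ^ (j + k) * \<Psi> k s))" unfolding ex[symmetric] by simp
    hence "ln (cmod (f (j + k) s)) = Re (of_real (real d ^ (j + k)) * \<Psi> k s)" by simp
    moreover have "Re (of_real x * z) = x * Re z" for x z by simp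
    ultimately have "ln (cmod (f (j + k) s)) = real d ^ (j + k) * Re (\<Psi> k s)" by metis
    thus ?thesis using d0 by (simp add: u_def)
  qed
  define M where "M i = (cmod (Ln C) + 1) * (1/2) ^ i" for i :: nat
  have ul0: "uniform_limit B (\<lambda>k s. \<Sum>i<k. T i s) (\<lambda>s. suminf (\<lambda>i. T i s)) sequentially"
  proof (rule Weierstrass_m_test)
    show "summable M" unfolding M_def by (intro summable_mult summable_geometric) auto
    show "norm (T i s) \<le> M i" if "s \<in> B" for i s
    proof -
      have "(2::real) ^ i \<le> real d ^ i" using d by (intro power_mono) auto
      also have "\<dots> \<le> real d ^ Suc (j + i)" using d by (intro power_increasing) auto
      finally have le: "(2::real) ^ i \<le> real d ^ Suc (j + i)" .
      have "norm (T i s) = cmod (Ln C + Ln (\<phi> (j + i) s)) / real d ^ Suc (j + i)"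
        by (simp add: T_def norm_divide norm_power norm_mult)
      also have "\<dots> \<le> (cmod (Ln C) + 1) / 2 ^ i"
        using norm_triangle_ineq[of "Ln C" "Ln (\<phi> (j + i) s)"] Ln_phi(1)[OF B[OF that, of i]] le
        by (intro frac_le) auto
      finally show ?thesis by (simp add: M_def power_divide)
    qed
  qed
  define \<Phi> where "\<Phi> s = h s / of_nat d ^ j + suminf (\<lambda>i. T i s)" for s
  have ul: "uniform_limit B \<Psi> \<Phi> sequentially"
    unfolding \<Psi>_def[abs_def] \<Phi>_def[abs_def] by (intro uniform_limit_intros ul0)
  show ?thesis
  proof (rule that[OF e])
    show "\<Phi> holomorphic_on ball t e"
      unfolding B_def[symmetric]
    proof (rule holomorphic_uniform_sequence[OF _ hPsi])
      show "open B" by (simp add: B_def)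
      fix x assume "x \<in> B"
      then obtain r where "r > 0" "cball x r \<subseteq> B" using \<open>open B\<close> open_contains_cball by blast
      thus "\<exists>d>0. cball x d \<subseteq> B \<and> uniform_limit (cball x d) \<Psi> \<Phi> sequentially"
        using uniform_limit_on_subset[OF ul] by blast
    qed
    fix s assume "s \<in> ball t e"
    hence s: "s \<in> B" by (simp add: B_def)
    have "(\<lambda>k. Re (\<Psi> k s)) \<longlonglongrightarrow> Re (\<Phi> s)" by (intro tendsto_Re tendsto_uniform_limitI[OF ul s])
    hence "(\<lambda>k. u (k + j) s) \<longlonglongrightarrow> Re (\<Phi> s)" using Re_Psi[OF s] by (simp add: add.commute)
    thus "(\<lambda>k. u k s) \<longlonglongrightarrow> Re (\<Phi> s)" by (rule LIMSEQ_offset)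
  qed
qed

definition green where "green t = (if \<exists>j. t \<in> Es j then lim (\<lambda>k. u k t) else 0)"

lemma green_lim: assumes "t \<in> Es j" shows "(\<lambda>k. u k t) \<longlonglongrightarrow> green t"
proof -
  obtain e \<Phi> where e: "e > 0" "\<And>s. s \<in> ball t e \<Longrightarrow> (\<lambda>k. u k s) \<longlonglongrightarrow> Re (\<Phi> s)"
    using local_log[OF assms] by metis
  hence "(\<lambda>k. u k t) \<longlonglongrightarrow> Re (\<Phi> t)" by simp
  moreover from this have "green t = Re (\<Phi> t)" using assms by (auto simp: green_def limI)
  ultimately show ?thesis by simp
qed

lemma green_dist: assumes "t \<in> Es j" shows "\<bar>green t - u j t\<bar> \<le> K / d ^ j"
proof (rule LIMSEQ_le_const2)
  show "(\<lambda>k. \<bar>u (k + j) t - u j t\<bar>) \<longlonglongrightarrow> \<bar>green t - u j t\<bar>"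
    by (intro tendsto_intros LIMSEQ_ignore_initial_segment green_lim[OF assms])
  have "\<bar>u (k + j) t - u j t\<bar> \<le> K / d ^ j" for k
  proof -
    have "\<bar>u (j + k) t - u j t\<bar> \<le> K / d ^ j * (1 - 1 / 2 ^ k)" by (rule u_dist[OF assms])
    also have "\<dots> \<le> K / d ^ j * 1" using K_pos by (intro mult_left_mono) auto
    finally show ?thesis by (simp add: add.commute)
  qed
  thus "\<exists>N. \<forall>k\<ge>N. \<bar>u (k + j) t - u j t\<bar> \<le> K / d ^ j" by blast
qed

lemma green_pos: assumes "t \<in> Es j" shows "green t > 0"
proof -
  have "ln R < ln (cmod (f j t))" using f_gt[OF assms] R by (subst ln_less_cancel_iff) auto
  hence "K < ln (cmod (f j t))" using R by (simp add: K_def)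
  hence "K / d ^ j < u j t" unfolding u_def using d by (intro divide_strict_right_mono) auto
  thus ?thesis using green_dist[OF assms] by linarith
qed

lemma green_zero: "(\<And>j. t \<notin> Es j) \<Longrightarrow> green t = 0"
  by (simp add: green_def)

lemma green_nonneg: "0 \<le> green t"
  using green_pos green_zero by (metis order_refl less_imp_le)

lemma Es_l: "l * t \<in> Es j \<longleftrightarrow> t \<in> Es (Suc j)"
  by (simp add: Es_def mult_ac)

lemma green_l: "green (l * t) = d * green t"
proof (cases "\<exists>j. t \<in> Es j")
  case True
  then obtain j where j: "t \<in> Es j" by blast
  have "l * t \<in> Es j" using Es_Suc[OF j] Es_l by blast
  hence 1: "(\<lambda>k. u k (l * t)) \<longlonglongrightarrow> green (l * t)" by (rule green_lim)
  have "u k (l * t) = d * u (Suc k) t" for k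
    using d by (simp add: u_def f_def mult_ac)
  moreover have "(\<lambda>k. d * u (Suc k) t) \<longlonglongrightarrow> d * green t"
    by (intro tendsto_intros LIMSEQ_Suc green_lim[OF j])
  ultimately have 2: "(\<lambda>k. u k (l * t)) \<longlonglongrightarrow> d * green t" by simp
  show ?thesis by (rule LIMSEQ_unique[OF 1 2])
next
  case False
  thus ?thesis using green_zero[of t] green_zero[of "l * t"] Es_l by auto
qed

lemma not_Es_bounded:
  assumes "R \<le> M" "\<And>i. cmod (H t $ i) \<le> M" "\<And>k. k \<le> j \<Longrightarrow> t \<notin> Es k"
  shows "cmod (H (l ^ j * t) $ i) \<le> M"
  using assms(3)
proof (induction j arbitrary: i)
  case 0 thus ?case using assms(2) by simp
next
  case (Suc j)
  have "F (H (l ^ j * t)) \<notin> escape_cone R" using Suc.prems[of "Suc j"] by (simp add: conj Es_def mult_ac)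
  moreover have "cmod (H (l ^ j * t) $ i) \<le> M" for i by (rule Suc.IH) (use Suc.prems in auto)
  ultimately have "\<forall>i. cmod (F (H (l ^ j * t)) $ i) \<le> M" using stay[OF assms(1)] by blast
  thus ?case by (simp add: conj mult_ac)
qed

lemma K_plus_iff: "H t \<in> K_plus F \<longleftrightarrow> (\<forall>j. t \<notin> Es j)"
proof
  assume b: "H t \<in> K_plus F"
  show "\<forall>j. t \<notin> Es j"
  proof (intro allI notI)
    fix j assume j: "t \<in> Es j"
    have grow: "2 ^ k * cmod (f j t) \<le> cmod (f (j + k) t)" for k
    proof (induction k)
      case (Suc k)
      have "t \<in> Es (j + k)" using Es_mono[OF _ j] by simp
      hence "2 * cmod (f (j + k) t) \<le> cmod (f (Suc (j + k)) t)"
        using double[of "H (l ^ (j + k) * t)"] escape_cone_subset by (auto simp: Es_def f_def conj mult_ac)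
      thus ?case using Suc by simp
    qed simp
    obtain B where B: "\<And>k. norm ((F ^^ k) (H t)) \<le> B"
      using b unfolding K_plus_def bounded_iff by auto
    have fB: "cmod (f k t) \<le> B" for k
      using B[of k] Finite_Cartesian_Product.norm_nth_le[of "(F ^^ k) (H t)" "Max UNIV"] by (simp add: f_def F_iter)
    obtain k :: nat where k: "B < 2 ^ k" using real_arch_pow[of 2 B] by auto
    have "2 ^ k * 1 \<le> 2 ^ k * cmod (f j t)" using f_gt[OF j] R by (intro mult_left_mono) auto
    thus False using grow[of k] fB[of "j + k"] k by linarith
  qed
next
  assume n: "\<forall>j. t \<notin> Es j"
  define M where "M = max R (Max (range (\<lambda>i. cmod (H t $ i))))"
  have M: "R \<le> M" "\<And>i. cmod (H t $ i) \<le> M" by (auto simp: M_def intro: Max_ge le_max_iff_disj[THEN iffD2])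
  have "norm ((F ^^ j) (H t)) \<le> (\<Sum>i\<in>(UNIV::'n set). M)" for j
  proof -
    have "norm ((F ^^ j) (H t)) \<le> (\<Sum>i\<in>UNIV. cmod (H (l ^ j * t) $ i))" unfolding F_iter by (rule norm_le_sum_coords)
    also have "\<dots> \<le> (\<Sum>i\<in>(UNIV::'n set). M)" by (intro sum_mono not_Es_bounded[OF M]) (use n in auto)
    finally show ?thesis .
  qed
  thus "H t \<in> K_plus F" unfolding K_plus_def bounded_iff by auto
qed

lemma green_pos_iff: "0 < green t \<longleftrightarrow> H t \<notin> K_plus F"
  using K_plus_iff green_pos green_zero by (metis less_irrefl)

lemma green_local:
  assumes "0 < green t"
  shows "\<exists>e>0. \<exists>\<Phi>. \<Phi> holomorphic_on ball t e \<and> (\<forall>s\<in>ball t e. green s = Re (\<Phi> s))"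
proof -
  obtain j where j: "t \<in> Es j" using assms green_zero by force
  obtain e \<Phi> where e: "e > 0" "ball t e \<subseteq> Es j" "\<Phi> holomorphic_on ball t e"
    "\<And>s. s \<in> ball t e \<Longrightarrow> (\<lambda>k. u k s) \<longlonglongrightarrow> Re (\<Phi> s)"
    using local_log[OF j] by metis
  have "green s = Re (\<Phi> s)" if "s \<in> ball t e" for s
    using green_lim[of s j] e(2) e(4)[OF that] that LIMSEQ_unique by blast
  thus ?thesis using e by blast
qed

text \<open>  At a point \<open>t\<close> that never escapes, a whole neighbourhood stays outside \<open>Es n\<close> for any given \<open>n\<close>, because the closed cone
  is mapped into the open one. A nearby orbit that enters the cone later does so at a bounded
  height, so that its Green function is of the order \<open>1 / d ^ n\<close>.\<close>

lemma green_continuous: "continuous_on UNIV green"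
proof (rule continuous_at_imp_continuous_on, rule ballI)
  fix t
  show "isCont green t"
  proof (cases "0 < green t")
    case True
    then obtain e \<Phi> where e: "e > 0" "\<Phi> holomorphic_on ball t e" "\<And>s. s \<in> ball t e \<Longrightarrow> green s = Re (\<Phi> s)"
      using green_local by blast
    have "continuous_on (ball t e) (\<lambda>s. Re (\<Phi> s))"
      by (intro continuous_intros holomorphic_on_imp_continuous_on e)
    hence "continuous_on (ball t e) green" by (rule continuous_on_eq) (use e in auto)
    thus ?thesis using e(1) by (simp add: continuous_on_eq_continuous_at)
  next
    case False
    hence nt: "\<And>j. t \<notin> Es j" using green_pos by blast
    have gt: "green t = 0" by (rule green_zero[OF nt])
    have "compact (H ` cball t 1)" by (intro compact_continuous_image contH) auto
    then obtain M0 where M0: "\<And>s. s \<in> cball t 1 \<Longrightarrow> norm (H s) \<le> M0"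
      using compact_imp_bounded[of "H ` cball t 1"] unfolding bounded_iff by blast
    define M where "M = max R M0"
    have M: "R \<le> M" "cmod (H s $ i) \<le> M" if "s \<in> cball t 1" for s i
      using M0[OF that] Finite_Cartesian_Product.norm_nth_le[of "H s" i] unfolding M_def by linarith+
    define N where "N = (\<Sum>i\<in>(UNIV::'n set). M)"
    have "compact (F ` cball 0 N)" by (intro compact_continuous_image continuous_on_subset[OF contF]) auto
    then obtain B0 where B0: "\<And>z. z \<in> cball 0 N \<Longrightarrow> norm (F z) \<le> B0"
      using compact_imp_bounded[of "F ` cball 0 N"] unfolding bounded_iff by blast
    define B where "B = max 1 B0"
    have B: "1 \<le> B" "\<And>z. z \<in> cball 0 N \<Longrightarrow> cmod (lastc (F z)) \<le> B"
    proof -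
      show "1 \<le> B" by (simp add: B_def)
      fix z :: "(complex, 'n) vec" assume "z \<in> cball 0 N"
      from B0[OF this] show "cmod (lastc (F z)) \<le> B"
        using Finite_Cartesian_Product.norm_nth_le[of "F z" "Max UNIV"] unfolding B_def by linarith
    qed
    show ?thesis unfolding continuous_at_eps_delta gt
    proof (intro allI impI)
      fix \<epsilon> :: real assume eps: "\<epsilon> > 0"
      obtain n where n: "(ln B + K) / \<epsilon> < 2 ^ n" using real_arch_pow[of 2 "(ln B + K) / \<epsilon>"] by auto
      have bnd: "(ln B + K) / d ^ j < \<epsilon>" if "j \<ge> n" for j
      proof -
        have "(2::real) ^ n \<le> 2 ^ j" using that by (intro power_increasing) auto
        also have "\<dots> \<le> real d ^ j" using d by (intro power_mono) auto
        finally have "(ln B + K) / \<epsilon> < real d ^ j" using n by linarith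
        thus ?thesis using eps d by (simp add: field_simps)
      qed
      define Z where "Z = {s. H (l ^ n * s) \<in> escape_cone_closed R}"
      have "closed Z"
      proof -
        have "Z = (\<lambda>t. H (l ^ n * t)) -` escape_cone_closed R" by (auto simp: Z_def)
        moreover have "continuous_on UNIV (\<lambda>t. H (l ^ n * t))"
          by (rule continuous_on_compose2[OF contH[of UNIV]]) (auto intro!: continuous_intros)
        ultimately show ?thesis using closed_vimage[OF closed_escape_cone] by metis
      qed
      moreover have "t \<notin> Z"
        using cone[of "H (l ^ n * t)"] nt[of "Suc n"] by (auto simp: Z_def Es_def conj mult_ac)
      ultimately obtain r where r: "r > 0" "ball t r \<subseteq> - Z"
        using open_contains_ball[of "- Z"] by (auto simp: open_Compl)
      show "\<exists>\<delta>>0. \<forall>s. dist s t < \<delta> \<longrightarrow> dist (green s) 0 < \<epsilon>"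
      proof (intro exI[of _ "min r 1"] conjI allI impI)
        fix s assume s: "dist s t < min r 1"
        hence sb: "s \<in> cball t 1" "s \<notin> Z" using r by (auto simp: dist_commute mem_ball subset_eq)
        show "dist (green s) 0 < \<epsilon>"
        proof (cases "\<exists>j. s \<in> Es j")
          case False
          thus ?thesis using green_zero[of s] eps by auto
        next
          case True
          define j where "j = (LEAST j. s \<in> Es j)"
          have j: "s \<in> Es j" "\<And>k. k < j \<Longrightarrow> s \<notin> Es k"
            using LeastI_ex[OF True] not_less_Least unfolding j_def by auto
          have "s \<notin> Es n" using sb(2) escape_cone_subset by (auto simp: Z_def Es_def)
          hence "\<not> j \<le> n" using Es_mono j(1) by blast
          then obtain i where i: "j = Suc i" "n \<le> i" by (metis Suc_leI Suc_le_D Suc_le_mono not_le)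
          have "cmod (H (l ^ i * s) $ k) \<le> M" for k
            by (rule not_Es_bounded[OF M(1)[OF sb(1)] M(2)[OF sb(1)]]) (use j(2) i in auto)
          hence "norm (H (l ^ i * s)) \<le> N"
            unfolding N_def by (intro order.trans[OF norm_le_sum_coords] sum_mono)
          hence "cmod (f j s) \<le> B" using B(2)[of "H (l ^ i * s)"] by (simp add: f_def i conj mult_ac)
          hence "ln (cmod (f j s)) \<le> ln B" using f_gt[OF j(1)] R B(1) by (subst ln_le_cancel_iff) auto
          hence "u j s \<le> ln B / d ^ j" unfolding u_def using d by (intro divide_right_mono) auto
          hence "green s \<le> (ln B + K) / d ^ j" using green_dist[OF j(1)] by (simp add: add_divide_distrib)
          also have "\<dots> < \<epsilon>" by (rule bnd) (use i in simp)
          finally show ?thesis using green_nonneg[of s] by simp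
        qed
      qed (use r in simp)
    qed
  qed
qed

end

text \<open>  The estimates with \<open>\<epsilon> = 1/2\<close> make \<open>F\<close> an instance of \<open>escaping\<close>, and the escape rate along \<open>H\<close> is the function \<open>green\<close>.\<close>

lemma green_function_exists:
  fixes H :: "complex \<Rightarrow> (complex, 'n :: {finite, linorder}) vec"
  assumes m: "m \<ge> 1" and deg: "\<And>i. i \<in> {1..m} \<Longrightarrow> degree (P i) \<ge> 2"
    and F: "F = shift_comp \<alpha> P m" and d: "d = (\<Prod>i=1..m. degree (P i))"
    and holH: "\<And>i. (\<lambda>t. H t $ i) holomorphic_on UNIV" and conj: "\<And>t. F (H t) = H (l * t)"
  obtains g :: "complex \<Rightarrow> real" where "continuous_on UNIV g" "\<And>t. 0 \<le> g t" "\<And>t. 0 < g t \<longleftrightarrow> H t \<notin> K_plus F"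
    "\<And>t. g (l * t) = d * g t"
    "\<And>t. 0 < g t \<Longrightarrow> \<exists>e>0. \<exists>\<Phi>. \<Phi> holomorphic_on ball t e \<and> (\<forall>s\<in>ball t e. g s = Re (\<Phi> s))"
proof -
  have ex: "\<exists>C. C \<noteq> 0 \<and> (\<forall>\<epsilon>>0. \<exists>R0\<ge>1. \<forall>R\<ge>R0. escape_estimate m F C d \<epsilon> R)"
    unfolding F d by (rule shift_comp_escape) (rule deg)
  obtain C where C: "C \<noteq> 0" "\<forall>\<epsilon>>0. \<exists>R0\<ge>1. \<forall>R\<ge>R0. escape_estimate m F C d \<epsilon> R"
    using ex by (elim exE conjE) (rule that)
  have "(0::real) < 1/2" by simp
  with C(2) obtain R0 where R0: "R0 \<ge> 1" "\<And>R. R \<ge> R0 \<Longrightarrow> escape_estimate m F C d (1/2) R" by metis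
  define R where "R = max R0 (exp (\<bar>ln (cmod C)\<bar> + 2))"
  have RR: "R \<ge> R0" "R \<ge> exp (\<bar>ln (cmod C)\<bar> + 2)" by (auto simp: R_def)
  have R1: "R \<ge> 1" using RR R0(1) by linarith
  have "ln R \<ge> ln (exp (\<bar>ln (cmod C)\<bar> + 2))" using RR R1 by (subst ln_le_cancel_iff) auto
  hence lnR: "\<bar>ln (cmod C)\<bar> + 1 < ln R" by simp
  have d2: "d \<ge> 2"
  proof -
    have "d \<noteq> 0" using deg d by fastforce
    moreover have "degree (P 1) dvd d" unfolding d using m by (intro dvd_prodI) auto
    ultimately have "degree (P 1) \<le> d" by (intro dvd_imp_le) auto
    thus ?thesis using deg[of 1] m by simp
  qed
  note P = R0(2)[OF RR(1), unfolded escape_estimate_def]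
  interpret escaping F C l R d H
  proof
    show "continuous_on UNIV F" unfolding F by (rule continuous_shift_comp)
    show "2 * cmod (lastc z) \<le> cmod (lastc (F z))" if "z \<in> escape_cone_closed R" for z
    proof -
      have "(2::real) ^ 1 \<le> 2 ^ m" using m by (intro power_increasing) auto
      hence "2 * cmod (lastc z) \<le> 2 ^ m * cmod (lastc z)" by (intro mult_right_mono) auto
      also have "\<dots> \<le> cmod (lastc (F z))" using P that by blast
      finally show ?thesis .
    qed
    show "F z \<in> escape_cone R" if "z \<in> escape_cone_closed R" for z using P that m by auto
    show "cmod (lastc (F z) / (C * lastc z ^ d) - 1) < 1/2" if "z \<in> escape_cone_closed R" for z using P that by blast
    show "\<forall>i. cmod (F z $ i) \<le> M" if "R \<le> M" "\<And>i. cmod (z $ i) \<le> M" "F z \<notin> escape_cone R" for z :: "(complex, 'n) vec" and M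
      using P that by blast
  qed (fact C(1) d2 R1 lnR holH conj)+
  show ?thesis
    by (rule that[of green]) (use green_continuous green_nonneg green_pos_iff green_l green_local in auto)
qed

section \<open>The inequality\<close>

text \<open>  The Green function restricted to one lift and extended by zero: a relatively closed and open part of the set of
  positivity has its boundary in the zero set.\<close>

lemma continuous_on_relative_component:
  fixes e :: "complex \<Rightarrow> real"
  assumes ce: "continuous_on UNIV e" and nn: "\<And>z. 0 \<le> e z" and A: "open A" "A \<subseteq> {z. 0 < e z}" "open ({z. 0 < e z} - A)"
  shows "continuous_on UNIV (\<lambda>z. if z \<in> A then e z else 0)"
proof (rule continuous_at_imp_continuous_on, rule ballI)
  fix z
  define g where "g = (\<lambda>z. if z \<in> A then e z else 0)"
  have ice: "isCont e z" using ce by (simp add: continuous_on_eq_continuous_at)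
  consider "z \<in> A" | "z \<in> {z. 0 < e z} - A" | "z \<notin> A" "e z = 0" using nn[of z] by fastforce
  hence "isCont g z"
  proof cases
    case 1
    have "isCont e z \<longleftrightarrow> isCont g z"
      by (rule isCont_cong) (use eventually_nhds_in_open[OF A(1) 1] in \<open>auto elim!: eventually_mono simp: g_def\<close>)
    thus ?thesis using ice by simp
  next
    case 2
    have "isCont (\<lambda>_. 0::real) z \<longleftrightarrow> isCont g z"
      by (rule isCont_cong) (use eventually_nhds_in_open[OF A(3) 2] in \<open>auto elim!: eventually_mono simp: g_def\<close>)
    thus ?thesis by simp
  next
    case 3
    have "(e \<longlongrightarrow> 0) (at z)" using ice 3 by (simp add: isCont_def)
    hence "(g \<longlongrightarrow> 0) (at z)"
      by (rule Lim_null_comparison[rotated]) (use nn in \<open>auto simp: g_def\<close>)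
    thus ?thesis using 3 by (simp add: isCont_def g_def)
  qed
  thus "isCont (\<lambda>z. if z \<in> A then e z else 0) z" by (simp add: g_def)
qed

context ordered_cover begin

lemma open_V: "open (V k)"
  unfolding V_def by (rule open_path_component[OF open_E])

lemma open_E_minus_V: "open (E - V k)"
  unfolding V_def by (rule open_non_path_component[OF open_E])

lemma V_subset: "V k \<subseteq> E"
  unfolding V_def by (rule path_component_subset)

lemma V_path_connected: "path_connected (V k)"
  unfolding V_def by (rule path_connected_path_component)

text \<open>  \<open>A k\<close> is the lift \<open>V k\<close>, rotated by \<open>\<zeta>\<close> so that its period \<open>T\<close> becomes the positive number \<open>L\<close>; the translation
  \<open>2 \<pi> \<i>\<close> becomes \<open>w\<close>, of height \<open>h > 0\<close>. Disjointness of \<open>A k\<close> from \<open>A k + w\<close> and from \<open>A k - w\<close> bounds its height, and the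
  packing of the strips \<open>A k\<close> gives \<open>\<pi> n \<le> \<kappa> h\<close>.\<close>

lemma lifts_inequality:
  fixes g :: "complex \<Rightarrow> real" and N p q :: int and d :: real
  assumes cg: "continuous_on UNIV g" and g0: "\<And>t. 0 \<le> g t" and gS: "\<And>t. 0 < g t \<longleftrightarrow> t \<notin> S"
    and gl: "\<And>t. g (l * t) = d * g t" and d: "d > 1"
    and loc: "\<And>t. 0 < g t \<Longrightarrow> \<exists>e>0. \<exists>\<Phi>. \<Phi> holomorphic_on ball t e \<and> (\<forall>s\<in>ball t e. g s = Re (\<Phi> s))"
    and N: "N = gcd p' (int n)" and p: "p = p' div N" and q: "q = int n div N"
  shows "\<exists>\<tau>. exp \<tau> = l \<and> N * q / (2 * ln d) \<le> Re \<tau> / (cmod (\<tau> - 2 * pi * \<i> * of_int p / of_int q))\<^sup>2"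
proof -
  obtain \<tau> where tau: "exp \<tau> = l" "\<And>k z. z \<in> V k \<longleftrightarrow> z + \<tau> \<in> V (k + p')"
    "\<And>k z. z \<in> V k \<longleftrightarrow> z + 2 * pi * \<i> \<in> V (k + int n)"
    using ordered_lifts by blast
  have Npos: "N > 0" using n by (simp add: N)
  have pN: "p' = N * p" and qN: "int n = N * q" by (simp_all add: N p q)
  have qpos: "q > 0" using qN n Npos by (metis of_nat_0_less_iff zero_less_mult_pos)
  define Q where "Q = nat q"
  have Q: "int Q = q" "Q > 0" using qpos by (auto simp: Q_def)
  have Vtau: "z \<in> V k \<longleftrightarrow> z + of_nat i * \<tau> \<in> V (k + int i * p')" for z k i
  proof (induction i)
    case (Suc i)
    thus ?case using tau(2)[of "z + of_nat i * \<tau>" "k + int i * p'"] by (simp add: algebra_simps)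
  qed simp
  have Vper: "z \<in> V k \<longleftrightarrow> z + of_int i * (2 * pi * \<i>) \<in> V (k + i * int n)" for z k i
  proof (induction i rule: int_induct[where k = 0])
    case (step1 i)
    thus ?case using tau(3)[of "z + of_int i * (2 * pi * \<i>)" "k + i * int n"] by (simp add: algebra_simps)
  next
    case (step2 i)
    thus ?case using tau(3)[of "z + of_int (i - 1) * (2 * pi * \<i>)" "k + (i - 1) * int n"] by (simp add: algebra_simps)
  qed simp
  define T where "T = of_nat Q * \<tau> - of_int p * (2 * pi * \<i>)"
  have VT: "z \<in> V k \<longleftrightarrow> z + T \<in> V k" for z k
  proof -
    have "z \<in> V k \<longleftrightarrow> z + of_nat Q * \<tau> \<in> V (k + int Q * p')" by (rule Vtau)
    also have "\<dots> \<longleftrightarrow> z + of_nat Q * \<tau> + of_int (- p) * (2 * pi * \<i>) \<in> V (k + int Q * p' + (- p) * int n)" by (rule Vper)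
    also have "k + int Q * p' + (- p) * int n = k" by (simp add: Q pN qN)
    also have "z + of_nat Q * \<tau> + of_int (- p) * (2 * pi * \<i>) = z + T" by (simp add: T_def)
    finally show ?thesis .
  qed
  have expT: "exp T = l ^ Q"
  proof -
    have "exp T = exp (of_nat Q * \<tau>)" using exp_plus_2pin[of "of_nat Q * \<tau>" "- p"] by (simp add: T_def mult_ac)
    thus ?thesis by (simp only: exp_of_nat_mult tau(1))
  qed
  have Retau: "Re \<tau> > 0"
  proof -
    have "exp (Re \<tau>) = cmod l" using tau(1) norm_exp_eq_Re by metis
    thus ?thesis using l1 by (metis exp_gt_one exp_less_cancel_iff exp_zero)
  qed
  have ReT: "Re T = Q * Re \<tau>" by (simp add: T_def)
  hence ReT0: "Re T > 0" using Retau Q by simp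
  define L where "L = cmod T"
  have L: "L > 0" using ReT0 by (auto simp: L_def)
  define \<zeta> where "\<zeta> = T / of_real L"
  have z0: "\<zeta> \<noteq> 0" and zL: "\<zeta> * of_real L = T" using L ReT0 by (auto simp: \<zeta>_def)
  define w where "w = 2 * pi * \<i> / \<zeta>"
  have zw: "\<zeta> * w = 2 * pi * \<i>" using z0 by (simp add: w_def)
  define h where "h = 2 * pi * Re T / L"
  have Imw: "Im w = h"
  proof -
    have "w = 2 * pi * \<i> * cnj T / of_real L"
    proof -
      have "cnj T * T = of_real L * of_real L" by (simp add: L_def complex_norm_square[symmetric] power2_eq_square mult.commute)
      hence "2 * pi * \<i> * cnj T / of_real L * \<zeta> = 2 * pi * \<i>"
        using L unfolding \<zeta>_def by (simp add: mult.assoc)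
      thus ?thesis unfolding w_def by (rule eq_divide_imp[OF z0, symmetric])
    qed
    thus ?thesis by (simp add: h_def Im_divide_of_real)
  qed
  have h: "h > 0" using ReT0 L by (simp add: h_def)
  define A where "A k = {x. \<zeta> * x \<in> V k}" for k
  have A_alt: "A k = (\<lambda>z. z / \<zeta>) ` V k" for k
    using z0 by (force simp: A_def image_iff)
  have pcA: "path_connected (A k)" for k
    unfolding A_alt by (intro path_connected_continuous_image V_path_connected continuous_intros) (use z0 in auto)
  have A_ne: "v k / \<zeta> \<in> A k" for k using v_in_V z0 by (simp add: A_def)
  have A_L: "x \<in> A k \<longleftrightarrow> x + of_real L \<in> A k" for x k
    using VT[of "\<zeta> * x" k] zL by (simp add: A_def distrib_left)
  have A_w: "x \<in> A k \<longleftrightarrow> x + of_int i * w \<in> A (k + i * int n)" for x k i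
  proof -
    have "\<zeta> * (x + of_int i * w) = \<zeta> * x + of_int i * (2 * pi * \<i>)" using zw by (simp add: algebra_simps)
    thus ?thesis using Vper[of "\<zeta> * x" k i] by (simp add: A_def)
  qed
  have A_disj: "x \<in> A k \<Longrightarrow> x \<in> A j \<Longrightarrow> k = j" for x k j
    using V_disjoint unfolding A_def by blast
  have bnd: "\<exists>Y. \<forall>z\<in>A k. \<bar>Im z\<bar> < Y" for k
  proof -
    have 1: "x + w \<notin> A k" if "x \<in> A k" for x
      using A_w[of x k 1] that A_disj[of "x + w" k "k + int n"] n by auto
    have 2: "z - of_real L \<in> A k" "z + of_real L \<in> A k" if "z \<in> A k" for z
      using A_L[of "z - of_real L" k] A_L[of z k] that by simp_all
    obtain Y where "\<And>z. z \<in> A k \<Longrightarrow> \<bar>Im z\<bar> < Y"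
      by (rule periodic_bounded[OF pcA A_ne 2(2,1) L _ 1]) (use Imw h in auto)
    thus ?thesis by blast
  qed
  then obtain Y where Y: "\<And>k z. z \<in> A k \<Longrightarrow> \<bar>Im z\<bar> < Y k" by metis
  define B where "B = Max ((\<lambda>j. Y (int j)) ` {..<n})"
  have B: "Y (int j) \<le> B" if "j < n" for j using that by (auto simp: B_def)
  define e where "e z = g (exp (\<zeta> * z))" for z
  have ce: "continuous_on UNIV e"
    unfolding e_def by (rule continuous_on_compose2[OF cg]) (auto intro!: continuous_intros)
  have e_pos: "0 < e z \<longleftrightarrow> \<zeta> * z \<in> E" for z by (simp add: e_def gS E_def)
  have vim: "open {x. \<zeta> * x \<in> W}" if "open W" for W
  proof -
    have "{x. \<zeta> * x \<in> W} = (\<lambda>x. \<zeta> * x) -` W" by auto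
    moreover have "open ((\<lambda>x. \<zeta> * x) -` W)" by (intro open_vimage that continuous_intros)
    ultimately show ?thesis by simp
  qed
  have oA: "open (A k)" for k unfolding A_def by (rule vim[OF open_V])
  have oA': "open ({z. 0 < e z} - A k)" for k
  proof -
    have "{z. 0 < e z} - A k = {x. \<zeta> * x \<in> E - V k}" by (auto simp: e_pos A_def)
    thus ?thesis using vim[OF open_E_minus_V] by simp
  qed
  have sA: "A k \<subseteq> {z. 0 < e z}" for k using V_subset by (auto simp: A_def e_pos)
  define G where "G k z = (if z \<in> A k then e z else 0)" for k z
  have Gpos: "0 < G k z \<longleftrightarrow> z \<in> A k" for k z using sA by (auto simp: G_def)
  have g_pow: "g (l ^ i * t) = d ^ i * g t" for i t
    by (induction i) (simp_all add: gl mult.assoc)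
  define \<kappa> where "\<kappa> = Q * ln d / L"
  have \<kappa>: "\<kappa> > 0" using Q d L by (simp add: \<kappa>_def)
  have kL: "exp (\<kappa> * L) = d ^ Q" using L d by (simp add: \<kappa>_def exp_of_nat_mult)
  have e_L: "e (z + of_real L) = d ^ Q * e z" for z
  proof -
    have "exp (\<zeta> * (z + of_real L)) = l ^ Q * exp (\<zeta> * z)" using zL expT by (simp add: distrib_left exp_add mult.commute)
    thus ?thesis by (simp add: e_def g_pow)
  qed
  have G_local: "\<exists>r>0. \<exists>\<Phi>. \<Phi> holomorphic_on ball z r \<and> (\<forall>s\<in>ball z r. G k s = Re (\<Phi> s))" if z: "0 < G k z" for k z
  proof -
    have zA: "z \<in> A k" using z Gpos by blast
    hence "0 < g (exp (\<zeta> * z))" using sA by (auto simp: e_def)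
    then obtain r0 \<Phi> where r0: "r0 > 0" "\<Phi> holomorphic_on ball (exp (\<zeta> * z)) r0"
      "\<And>s. s \<in> ball (exp (\<zeta> * z)) r0 \<Longrightarrow> g s = Re (\<Phi> s)" using loc by blast
    define W where "W = (\<lambda>s. exp (\<zeta> * s)) -` ball (exp (\<zeta> * z)) r0 \<inter> A k"
    have "open W" unfolding W_def by (intro open_Int oA open_vimage open_ball continuous_intros)
    moreover have "z \<in> W" using zA r0(1) by (simp add: W_def)
    ultimately obtain r where r: "r > 0" "ball z r \<subseteq> W" using open_contains_ball by blast
    have "(\<Phi> \<circ> (\<lambda>s. exp (\<zeta> * s))) holomorphic_on ball z r"
      by (rule holomorphic_on_compose_gen[OF _ r0(2)]) (use r(2) in \<open>auto simp: W_def intro!: holomorphic_intros\<close>)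
    moreover have "G k s = Re ((\<Phi> \<circ> (\<lambda>s. exp (\<zeta> * s))) s)" if "s \<in> ball z r" for s
    proof -
      have "s \<in> W" using r(2) that by blast
      thus ?thesis using r0(3) by (simp add: W_def G_def e_def)
    qed
    ultimately show ?thesis using r(1) by blast
  qed
  have opG: "open {z. 0 < G k z}" for k using oA[of k] by (simp add: Gpos)
  have "\<exists>\<psi>. harmonic_strip (G k) \<psi> (Y k) L \<kappa>" for k
  proof -
    obtain \<psi> where psi: "\<psi> holomorphic_on {z. 0 < G k z}" "\<And>z. 0 < G k z \<Longrightarrow> (G k has_derivative (\<lambda>v. Re (\<psi> z * v))) (at z)"
      using local_real_part_gradient[OF G_local opG] by metis
    have "harmonic_strip (G k) \<psi> (Y k) L \<kappa>"
    proof
      show "continuous_on UNIV (G k)" unfolding G_def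
        by (rule continuous_on_relative_component[OF ce _ oA sA oA']) (simp add: e_def g0)
      show "0 \<le> G k z" for z by (simp add: G_def e_def g0)
      show "G k z = 0" if "Y k \<le> \<bar>Im z\<bar>" for z using Y[of z k] that by (auto simp: G_def)
      show "G k (z + of_real L) = exp (\<kappa> * L) * G k z" for z
        unfolding kL using A_L[of z k] e_L[of z] by (simp add: G_def)
      show "\<exists>z. 0 < G k z" using A_ne Gpos by blast
    qed (use psi L \<kappa> in auto)
    thus ?thesis by blast
  qed
  then obtain \<psi> where strip: "\<And>k. harmonic_strip (G k) (\<psi> k) (Y k) L \<kappa>" by metis
  have main: "pi * n \<le> \<kappa> * h"
  proof (rule strips_packing[of "\<lambda>i. G (int i)" "\<lambda>i. \<psi> (int i)" "\<lambda>i. Y (int i)", OF strip n h])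
    show "\<not> 0 < G (int j) z" if "i \<noteq> j" "0 < G (int i) z" for i j z
      using that A_disj[of z "int i" "int j"] by (auto simp: Gpos)
    show "\<bar>Im z - real (i div n) * h\<bar> \<le> B" if "0 < G (int i) z" for i z
    proof -
      have "z \<in> A (int i)" using that Gpos by blast
      moreover have "int i = int (i mod n) + int (i div n) * int n"
        by (metis mod_div_mult_eq of_nat_add of_nat_mult)
      ultimately have "z \<in> A (int (i mod n) + int (i div n) * int n)" by simp
      hence "z - of_int (int (i div n)) * w \<in> A (int (i mod n))"
        using A_w[of "z - of_int (int (i div n)) * w" "int (i mod n)" "int (i div n)"] by simp
      from Y[OF this] have "\<bar>Im z - real (i div n) * h\<bar> < Y (int (i mod n))" using Imw by simp
      also have "\<dots> \<le> B" by (rule B) (use n in simp)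
      finally show ?thesis by simp
    qed
  qed
  have "pi * n * L\<^sup>2 \<le> (\<kappa> * h) * L\<^sup>2" using main by (intro mult_right_mono) auto
  also have "\<dots> = pi * (2 * Q * ln d * (Q * Re \<tau>))"
    using L by (simp add: \<kappa>_def h_def ReT power2_eq_square field_simps)
  finally have "n * L\<^sup>2 \<le> 2 * Q * ln d * (Q * Re \<tau>)" by (simp add: mult.assoc)
  moreover define c where "c = cmod (\<tau> - 2 * pi * \<i> * of_int p / of_int q)"
  have Qq: "(of_int q :: complex) = of_nat Q" using Q by (metis of_int_of_nat_eq)
  have Lc: "L = Q * c"
  proof -
    have "T = of_nat Q * (\<tau> - 2 * pi * \<i> * of_int p / of_int q)"
      unfolding Qq T_def using Q by (simp add: field_simps)
    thus ?thesis by (simp add: L_def c_def norm_mult)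
  qed
  ultimately have "n * (Q * c)\<^sup>2 \<le> 2 * Q * ln d * (Q * Re \<tau>)" by simp
  hence "(real Q)\<^sup>2 * (n * c\<^sup>2) \<le> (real Q)\<^sup>2 * (2 * ln d * Re \<tau>)"
    by (simp add: power2_eq_square mult_ac)
  hence key: "n * c\<^sup>2 \<le> 2 * ln d * Re \<tau>" using Q by simp
  have c: "c > 0" using Lc L Q by (simp add: zero_less_mult_iff)
  have lnd: "ln d > 0" using d by simp
  have nNq: "real n = of_int N * of_int q" using qN by (metis of_int_mult of_int_of_nat_eq)
  have "real n / (2 * ln d) \<le> Re \<tau> / c\<^sup>2"
    using key c lnd by (simp add: field_simps)
  thus ?thesis using tau(1) unfolding c_def nNq by auto
qed

end


text \<open>  A nonzero point of the component is carried to infinity inside it by the powers of \<open>l\<close>.\<close>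

lemma unbounded_component:
  assumes inv: "\<And>z. l * z \<in> S \<longleftrightarrow> z \<in> S" and l: "cmod l > 1" and zero: "0 \<in> S" and br: "bridged S"
  shows "\<not> bounded (connected_component_set S 0)"
proof
  define C where "C = connected_component_set S 0"
  assume "bounded (connected_component_set S 0)"
  then obtain B where B: "\<And>z. z \<in> C \<Longrightarrow> cmod z \<le> B" unfolding C_def bounded_iff by blast
  have C0: "0 \<in> C" using zero by (simp add: C_def connected_component_refl)
  then obtain z where z: "z \<in> C" "z \<noteq> 0" using br unfolding bridged_def C_def[symmetric] by blast
  have sub: "(*) l ` C \<subseteq> C"
    unfolding C_def
  proof (rule connected_component_maximal)
    show "0 \<in> (*) l ` connected_component_set S 0" using C0 unfolding C_def by (metis imageI mult_zero_right)
    show "connected ((*) l ` connected_component_set S 0)"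
      by (intro connected_continuous_image continuous_intros connected_connected_component)
    show "(*) l ` connected_component_set S 0 \<subseteq> S"
      using inv connected_component_subset[of S 0] by blast
  qed
  have "l ^ i * z \<in> C" for i
    using sub z(1) by (induction i) (auto simp: mult.assoc)
  hence "cmod l ^ i * cmod z \<le> B" for i using B[of "l ^ i * z"] by (simp add: norm_mult norm_power)
  moreover obtain i where "B / cmod z < cmod l ^ i" using real_arch_pow[OF l] by blast
  ultimately show False using z(2) by (metis linorder_not_le pos_divide_less_eq zero_less_norm_iff)
qed

theorem theorem1p5:
  fixes F :: "(complex, 'n :: {finite, linorder}) vec \<Rightarrow> (complex, 'n) vec"
    and \<alpha> :: "nat \<Rightarrow> complex" and P :: "nat \<Rightarrow> complex poly" and m d :: nat
    and a :: "(complex, 'n) vec" and l :: complex and H :: "complex \<Rightarrow> (complex, 'n) vec"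
    and Kt :: "complex set" and q' :: nat and p' N p q :: int
  assumes "CARD('n) \<ge> 2" and "m \<ge> 2"
    and "\<And>i. i \<in> {1..m} \<Longrightarrow> \<alpha> i \<noteq> 0"
    and "\<And>i. i \<in> {1..m} \<Longrightarrow> degree (P i) \<ge> 2"
    and "F = shift_comp \<alpha> P m"
    and "d = (\<Prod>i=1..m. degree (P i))"
    and "saddle F a l"
    and "\<And>i. (\<lambda>t. H t $ i) holomorphic_on UNIV"
    and "range H = unstable_set F a" and "H 0 = a"
    and "\<And>t. F (H t) = H (l * t)"
    and "Kt = H -` K_set F"
    and "component_shift l Kt p' q'"
    and "N = gcd p' (int q')" and "p = p' div N" and "q = int q' div N"
    and "bridged Kt"
  shows "\<exists>\<tau>. exp \<tau> = l \<and>
    Re \<tau> / (cmod (\<tau> - 2 * of_real pi * \<i> * of_int p / of_int q))\<^sup>2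
      \<ge> of_int N * of_int q / (2 * ln (real d))"
proof (cases "q' = 0")
  have l1: "cmod l > 1" using assms(7) by (auto simp: saddle_def)
  hence l0: "l \<noteq> 0" by auto
  {
    \<comment> \<open>Here \<open>q = 0\<close>, so the quotient \<open>p / q\<close> and the asserted lower bound are both 0 by the convention for division.\<close>
    case True
    have "exp (Re (Ln l)) > exp 0" using l0 l1 norm_exp_eq_Re[of "Ln l"] by simp
    hence "Re (Ln l) > 0" by (simp only: exp_less_cancel_iff)
    thus ?thesis using l0 True assms(16) by (intro exI[of _ "Ln l"]) simp
  next
    case False
    hence q'0: "q' > 0" by simp
    have m1: "m \<ge> 1" using assms(2) by simp
    obtain g :: "complex \<Rightarrow> real" where g: "continuous_on UNIV g" "\<And>t. 0 \<le> g t" "\<And>t. 0 < g t \<longleftrightarrow> H t \<notin> K_plus F"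
      "\<And>t. g (l * t) = d * g t"
      "\<And>t. 0 < g t \<Longrightarrow> \<exists>e>0. \<exists>\<Phi>. \<Phi> holomorphic_on ball t e \<and> (\<forall>s\<in>ball t e. g s = Re (\<Phi> s))"
      by (rule green_function_exists[OF m1 assms(4) assms(5,6,8,11)], assumption, rule that)
    have d2: "real d > 1"
    proof -
      have "d \<noteq> 0" using assms(4,6) by fastforce
      moreover have "degree (P 1) dvd d" unfolding assms(6) using m1 by (intro dvd_prodI) auto
      ultimately have "degree (P 1) \<le> d" by (intro dvd_imp_le) auto
      moreover have "2 \<le> degree (P 1)" using assms(4)[of 1] m1 by simp
      ultimately show ?thesis by linarith
    qed
    have Kminus: "H t \<in> K_minus F" for t
    proof -
      have "H t \<in> unstable_set F a" using assms(9) by blast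
      thus ?thesis unfolding unstable_set_def K_minus_def by (auto intro: convergent_imp_bounded)
    qed
    have gS: "0 < g t \<longleftrightarrow> t \<notin> Kt" for t
      using g(3)[of t] Kminus[of t] assms(12) by (simp add: K_set_def)
    have closed: "closed Kt"
    proof -
      have "Kt = {t. g t \<le> 0}" using gS by (auto simp: not_less[symmetric])
      thus ?thesis using closed_Collect_le[OF g(1) continuous_on_const] by simp
    qed
    have "g 0 = 0" using g(4)[of 0] d2 by simp
    hence zero: "0 \<in> Kt" using gS[of 0] by auto
    have inv: "l * z \<in> Kt \<longleftrightarrow> z \<in> Kt" for z
    proof -
      have "0 < g (l * z) \<longleftrightarrow> 0 < g z" unfolding g(4) using d2 by (simp add: zero_less_mult_iff)
      thus ?thesis unfolding gS by blast
    qed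
    define C where "C = connected_component_set Kt 0"
    interpret log_cover Kt C l
    proof
      show "\<not> bounded C" unfolding C_def by (rule unbounded_component[OF inv l1 zero assms(17)])
      show "0 \<in> C" using zero by (simp add: C_def connected_component_refl)
      show "C \<subseteq> Kt" unfolding C_def by (rule connected_component_subset)
      show "connected C" unfolding C_def by (rule connected_connected_component)
      show "l * z \<in> Kt \<longleftrightarrow> z \<in> Kt" for z by (rule inv)
    qed (fact closed, fact l1)
    obtain U where U: "circular_ordering Kt q' U" "\<And>j. j < q' \<Longrightarrow> (*) l ` U j \<subseteq> U (nat ((int j + p') mod int q'))"
      using assms(13) unfolding component_shift_def by blast
    obtain \<Gamma> r w where G: "bij_betw U {..<q'} (components (- Kt))" "r > 0"
      "\<And>j. j < q' \<Longrightarrow> is_access (U j) (\<Gamma> j)" "\<And>j. j < q' \<Longrightarrow> first_hit (\<Gamma> j) r (w j)" "anticlockwise r q' w"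
      using U(1) unfolding circular_ordering_def by blast
    obtain \<theta> where th: "\<And>j. j < q' \<Longrightarrow> w j = rcis r (\<theta> j)" "strict_mono_on {..<q'} \<theta>" "\<And>j. j < q' \<Longrightarrow> \<theta> j < \<theta> 0 + 2 * pi"
      using G(5) unfolding anticlockwise_def by blast
    interpret ordered_cover Kt C l p' q' U \<Gamma> r w \<theta>
      by unfold_locales (fact q'0 G th U(2))+
    show ?thesis
      using lifts_inequality[OF g(1,2) gS g(4) d2 g(5) assms(14-16)] by simp
  }
qed

end
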